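(* Let $A_1,\dots,A_k$ be Hermitian $m\times m$ matrices that are linearly independent over $\mathbb{R}$ and such that $\sum_j c^0_jA_j>0$ for some $c^0\in\mathbb{R}^k$, let $n=k+m$, and let $M_0\subset\mathbb{C}^n$ be the (strongly pseudoconvex, Levi generating) quadric $$x_j=\langle A_jw,\bar w\rangle,\quad 1\le j\le k,\qquad z=x+iy\in\mathbb{C}^k,\ w\in\mathbb{C}^m.$$ Then there exists a non-defective s-pair for $M_0$. Moreover, the set of all defective s-pairs forms a proper algebraic set in the space of parameters $(\lambda,c,w_0,y_0,v)$.
   Context: Notation: $\langle a,b\rangle=\sum_\ell a_\ell b_\ell$; $\mathbb{D}\subset\mathbb{C}$ is the open unit disc with boundary $b\mathbb{D}$; for Hermitian matrices, $A>B$ means $A-B$ is positive definite. $T^{*1,0}(\mathbb{C}^n)$ is the bundle of $(1,0)$-forms in $\mathbb{C}^n$. For a generic manifold $M\subset\mathbb{C}^n$ the conormal bundle is regarded as the real submanifold $N^*(M)\subset T^{*1,0}(\mathbb{C}^n)$ with fibers $N^*_p(M)=\{\omega\in T^{*1,0}_p(\mathbb{C}^n):\operatorname{Re}\langle\omega,X\rangle=0\ \forall X\in T_p(M)\}$. If $M=\{\rho=0\}$ with $\rho=(\rho_1,\dots,\rho_k)$ real, $\partial\rho_1\wedge\dots\wedge\partial\rho_k\ne0$, then $N_p^*(M)=\{\sum_jc_j\partial\rho_j(p):c\in\mathbb{R}^k\}$. A complex disc is a map $\phi:\overline{\mathbb{D}}\to\mathbb{C}^n$ continuous on $\overline{\mathbb{D}}$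 and holomorphic in $\mathbb{D}$; it is attached to $M$ if $\phi(b\mathbb{D})\subset M$. A disc $\phi$ attached to $M$ is stationary if there is a nonzero continuous map $\phi^*:\overline{\mathbb{D}}\setminus\{0\}\to T^{*1,0}(\mathbb{C}^n)$, holomorphic in $\mathbb{D}\setminus\{0\}$ and projecting to $\phi$, such that $\zeta\mapsto\zeta\phi^*(\zeta)$ is holomorphic in $\mathbb{D}$ (so $\phi^*$ has a pole of order at most one at $0$) and $\phi^*(\zeta)\in N^*_{\phi(\zeta)}(M)$ for all $\zeta\in b\mathbb{D}$. Such $\phi^*$ is called a lift of $\phi$. The disc $\phi$ is defective if it has a nonzero lift that is holomorphic in the whole disc $\mathbb{D}$, including $0$. For the quadric $M_0$ put $\rho_j(z,w)=x_j-\langle A_jw,\bar w\rangle$. The following is known: for every $\epsilon>0$ there is $\delta>0$ such that for all $\lambda\in\mathbb{C}^k$, $c\in\mathbb{R}^k$, $w_0\in\mathbb{C}^m$, $y_0\in\mathbb{R}^k$, $v\in\mathbb{C}^m$ with $$\sum_j\operatorname{Re}(\lambda_j\zeta+c_j)A_j>\epsilon(|\lambda|+|c|)I\quad\text{for all }\zeta\in b\mathbb{D},\qquad |w_0|,|y_0|,|v|<\delta,$$ there is a unique stationary disc $\phi(\zeta)=(z(\zeta),w(\zeta))$ for $M_0$ with lift $\phi^*$ such that $w(1)=w_0$, $w'(1)=v$, $y(1)=y_0$ (where $y=\operatorname{Im}z$), and $\phi^*|_{b\mathbb{D}}=\sum_j\operatorname{Re}(\lambda_j\zeta+c_j)\,\partial\rho_j\circ\phi$.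 The pairs $(\phi,\phi^* )$ obtained in this way (for some $\epsilon>0$) are called s-pairs (stationary pairs) for $M_0$. They are parametrized by $(\lambda,c,w_0,y_0,v)$, which range over an open set (the space of parameters) in a real vector space of dimension $4n$. An s-pair $(\phi,\phi^* )$ is called defective (non-defective) if the disc $\phi$ is defective (not defective).
   Formalization: "Algebraic set" is taken as the common zero set of finitely many smooth algebraic (Nash) functions on the space of parameters, lying in a proper polynomial zero set; with polynomial equations alone the claim fails, e.g. for m=2, k=4. *)

theory Defs
  imports "HOL-Analysis.Analysis"
begin

section \<open>Hermitian matrices\<close>

definition hermitian :: "complex^'m^'m \<Rightarrow> bool" where
  "hermitian H \<longleftrightarrow> (\<forall>i j. H $ i $ j = cnj (H $ j $ i))"

definition pairing :: "complex^'n \<Rightarrow> complex^'n \<Rightarrow> complex" where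
  "pairing a b = (\<Sum>l\<in>UNIV. a $ l * b $ l)"

definition cnj_vec :: "complex^'n \<Rightarrow> complex^'n" where
  "cnj_vec w = (\<chi> l. cnj (w $ l))"

definition pos_definite :: "complex^'m^'m \<Rightarrow> bool" where
  "pos_definite H \<longleftrightarrow> hermitian H \<and> (\<forall>w. w \<noteq> 0 \<longrightarrow> 0 < Re (pairing (H *v w) (cnj_vec w)))"

section \<open>Conormal bundle, discs and lifts\<close>

text \<open>The real tangent space of a manifold \<open>M\<close> at \<open>p\<close>, as the set of velocities of curves in \<open>M\<close>
  through \<open>p\<close>.\<close>

definition tangent_vectors :: "(complex^'n) set \<Rightarrow> complex^'n \<Rightarrow> (complex^'n) set" where
  "tangent_vectors M p =
     {X. \<exists>\<gamma>::real \<Rightarrow> complex^'n. \<gamma> 0 = p \<and> (\<forall>t. \<gamma> t \<in> M) \<and> (\<gamma> has_vector_derivative X) (at 0)}"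

text \<open>A (1,0)-form at a point is given by its coefficient vector \<open>\<omega>\<close>, standing for
  \<open>\<Sum>l. \<omega>\<^sub>l dz\<^sub>l\<close>.\<close>

definition conormal_space :: "(complex^'n) set \<Rightarrow> complex^'n \<Rightarrow> (complex^'n) set" where
  "conormal_space M p = {\<omega>. \<forall>X\<in>tangent_vectors M p. Re (pairing \<omega> X) = 0}"

definition vec_holomorphic_on :: "(complex \<Rightarrow> complex^'n) \<Rightarrow> complex set \<Rightarrow> bool" where
  "vec_holomorphic_on f S \<longleftrightarrow> (\<forall>l. (\<lambda>\<zeta>. f \<zeta> $ l) holomorphic_on S)"

text \<open>The value of \<open>f\<close> at 0 is irrelevant here.\<close>

definition extends_holomorphically :: "(complex \<Rightarrow> complex^'n) \<Rightarrow> bool" where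
  "extends_holomorphically f \<longleftrightarrow>
     (\<exists>g. vec_holomorphic_on g (ball 0 1) \<and> (\<forall>\<zeta>\<in>ball 0 1 - {0}. g \<zeta> = f \<zeta>))"

text \<open>Only the values of a disc on \<open>cball 0 1\<close>, and of a lift on \<open>cball 0 1 - {0}\<close>, are meaningful.\<close>

definition attached_disc :: "(complex^'n) set \<Rightarrow> (complex \<Rightarrow> complex^'n) \<Rightarrow> bool" where
  "attached_disc M \<phi> \<longleftrightarrow>
     continuous_on (cball 0 1) \<phi> \<and> vec_holomorphic_on \<phi> (ball 0 1) \<and> \<phi> ` sphere 0 1 \<subseteq> M"

text \<open>A map into the bundle of (1,0)-forms that projects to \<open>\<phi>\<close> is given by the coefficient vectors
  \<open>\<omega> \<zeta>\<close> of its values, which are covectors at \<open>\<phi> \<zeta>\<close>.  Nonzero means not identically zero.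
  A disc attached to \<open>M\<close> is stationary if it has a lift.\<close>

definition is_lift :: "(complex^'n) set \<Rightarrow> (complex \<Rightarrow> complex^'n) \<Rightarrow> (complex \<Rightarrow> complex^'n) \<Rightarrow> bool" where
  "is_lift M \<phi> \<omega> \<longleftrightarrow>
     continuous_on (cball 0 1 - {0}) \<omega> \<and>
     vec_holomorphic_on \<omega> (ball 0 1 - {0}) \<and>
     (\<exists>\<zeta>\<in>cball 0 1 - {0}. \<omega> \<zeta> \<noteq> 0) \<and>
     extends_holomorphically (\<lambda>\<zeta>. \<zeta> *s \<omega> \<zeta>) \<and>
     (\<forall>\<zeta>\<in>sphere 0 1. \<omega> \<zeta> \<in> conormal_space M (\<phi> \<zeta>))"

definition defective_disc :: "(complex^'n) set \<Rightarrow> (complex \<Rightarrow> complex^'n) \<Rightarrow> bool" where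
  "defective_disc M \<phi> \<longleftrightarrow> attached_disc M \<phi> \<and> (\<exists>\<omega>. is_lift M \<phi> \<omega> \<and> extends_holomorphically \<omega>)"

section \<open>The quadric\<close>

text \<open>Points \<open>(z, w)\<close> of \<open>\<complex>\<^sup>n\<close>, \<open>n = k + m\<close>, are vectors indexed by \<^typ>\<open>'k + 'm\<close>:
  \<open>z\<^sub>j = p $ Inl j\<close> and \<open>w\<^sub>l = p $ Inr l\<close>.\<close>

definition w_part :: "complex^('k::finite + 'm::finite) \<Rightarrow> complex^'m" where
  "w_part p = (\<chi> l. p $ Inr l)"

text \<open>For Hermitian \<open>A j\<close> the pairing below is real, so taking its real part loses nothing.\<close>

definition quadric_rho :: "('k \<Rightarrow> complex^'m^'m) \<Rightarrow> 'k \<Rightarrow> complex^('k::finite + 'm::finite) \<Rightarrow> real" where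
  "quadric_rho A j p = Re (p $ Inl j) - Re (pairing (A j *v w_part p) (cnj_vec (w_part p)))"

definition quadric :: "('k \<Rightarrow> complex^'m^'m) \<Rightarrow> (complex^('k::finite + 'm::finite)) set" where
  "quadric A = {p. \<forall>j. quadric_rho A j p = 0}"

text \<open>The coefficients \<open>\<partial>\<rho>/\<partial>z\<^sub>l = (\<partial>\<rho>/\<partial>x\<^sub>l - \<i> \<partial>\<rho>/\<partial>y\<^sub>l) / 2\<close> of the (1,0)-form \<open>\<partial>\<rho>\<close>.\<close>

definition del_form :: "(complex^'n \<Rightarrow> real) \<Rightarrow> complex^'n \<Rightarrow> complex^'n" where
  "del_form \<rho> p =
     (\<chi> l. (of_real (frechet_derivative \<rho> (at p) (axis l 1))
           - \<i> * of_real (frechet_derivative \<rho> (at p) (axis l \<i>))) / 2)"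

section \<open>Stationary pairs\<close>

text \<open>The parameters \<open>(\<lambda>, c, w\<^sub>0, y\<^sub>0, v)\<close>, in a real vector space of dimension \<open>4 (k + m)\<close>.\<close>

type_synonym ('k, 'm) param =
  "(complex^'k) \<times> (real^'k) \<times> (complex^'m) \<times> (real^'k) \<times> (complex^'m)"

definition stationary_data ::
  "('k \<Rightarrow> complex^'m^'m) \<Rightarrow> ('k::finite, 'm::finite) param \<Rightarrow>
   (complex \<Rightarrow> complex^('k + 'm)) \<Rightarrow> (complex \<Rightarrow> complex^('k + 'm)) \<Rightarrow> bool" where
  "stationary_data A = (\<lambda>(lam, c, w0, y0, v) \<phi> \<omega>.
     attached_disc (quadric A) \<phi> \<and> is_lift (quadric A) \<phi> \<omega> \<and>
     w_part (\<phi> 1) = w0 \<and>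
     ((\<lambda>\<zeta>. w_part (\<phi> \<zeta>)) has_derivative (\<lambda>h. h *s v)) (at 1 within cball 0 1) \<and>
     (\<forall>j. Im (\<phi> 1 $ Inl j) = y0 $ j) \<and>
     (\<forall>\<zeta>\<in>sphere 0 1.
        \<omega> \<zeta> = (\<Sum>j\<in>UNIV. Re (lam $ j * \<zeta> + of_real (c $ j)) *\<^sub>R del_form (quadric_rho A j) (\<phi> \<zeta>))))"

definition param_region ::
  "('k \<Rightarrow> complex^'m^'m) \<Rightarrow> real \<Rightarrow> real \<Rightarrow> ('k::finite, 'm::finite) param set" where
  "param_region A \<epsilon> \<delta> = {(lam, c, w0, y0, v).
     (\<forall>\<zeta>\<in>sphere 0 1.
        pos_definite ((\<Sum>j\<in>UNIV. Re (lam $ j * \<zeta> + of_real (c $ j)) *\<^sub>R A j)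
                      - (\<epsilon> * (norm lam + norm c)) *\<^sub>R mat 1)) \<and>
     norm w0 < \<delta> \<and> norm y0 < \<delta> \<and> norm v < \<delta>}"

text \<open>\<open>\<delta>\<close> is admissible for \<open>\<epsilon>\<close> if all parameters in the corresponding region determine a unique
  stationary disc with lift; uniqueness refers to the values on the closed disc.\<close>

definition admissible :: "('k::finite \<Rightarrow> complex^'m::finite^'m) \<Rightarrow> real \<Rightarrow> real \<Rightarrow> bool" where
  "admissible A \<epsilon> \<delta> \<longleftrightarrow> \<epsilon> > 0 \<and> \<delta> > 0 \<and>
     (\<forall>P\<in>param_region A \<epsilon> \<delta>.
        (\<exists>\<phi> \<omega>. stationary_data A P \<phi> \<omega>) \<and>
        (\<forall>\<phi> \<omega> \<phi>' \<omega>'. stationary_data A P \<phi> \<omega> \<and> stationary_data A P \<phi>' \<omega>' \<longrightarrow>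
           (\<forall>\<zeta>\<in>cball 0 1. \<phi> \<zeta> = \<phi>' \<zeta>) \<and> (\<forall>\<zeta>\<in>cball 0 1 - {0}. \<omega> \<zeta> = \<omega>' \<zeta>)))"

definition param_space :: "('k::finite \<Rightarrow> complex^'m::finite^'m) \<Rightarrow> ('k, 'm) param set" where
  "param_space A = (\<Union>{param_region A \<epsilon> \<delta> | \<epsilon> \<delta>. admissible A \<epsilon> \<delta>})"

definition s_pair ::
  "('k \<Rightarrow> complex^'m^'m) \<Rightarrow> ('k::finite, 'm::finite) param \<Rightarrow>
   (complex \<Rightarrow> complex^('k + 'm)) \<Rightarrow> (complex \<Rightarrow> complex^('k + 'm)) \<Rightarrow> bool" where
  "s_pair A P \<phi> \<omega> \<longleftrightarrow> P \<in> param_space A \<and> stationary_data A P \<phi> \<omega>"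

definition defective_params :: "('k::finite \<Rightarrow> complex^'m::finite^'m) \<Rightarrow> ('k, 'm) param set" where
  "defective_params A = {P. \<exists>\<phi> \<omega>. s_pair A P \<phi> \<omega> \<and> defective_disc (quadric A) \<phi>}"

section \<open>Algebraic functions and algebraic sets\<close>

text \<open>Infinite differentiability: \<open>f\<close> lies in a family of functions closed under
  directional derivatives.\<close>

definition smooth_fun_on :: "'a::euclidean_space set \<Rightarrow> ('a \<Rightarrow> real) \<Rightarrow> bool" where
  "smooth_fun_on U f \<longleftrightarrow>
     (\<exists>F. f \<in> F \<and>
        (\<forall>g\<in>F. \<exists>g'. (\<forall>v. g' v \<in> F) \<and> (\<forall>x\<in>U. (g has_derivative (\<lambda>v. g' v x)) (at x))))"

text \<open>Algebraic functions in the sense of CR geometry (Nash functions): smooth (equivalently, given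
  the algebraic equation, real-analytic) functions on an open set \<open>U\<close> that are roots of a nonzero
  polynomial \<open>Q\<close> with polynomial coefficients.\<close>

definition algebraic_fun_on :: "'a::euclidean_space set \<Rightarrow> ('a \<Rightarrow> real) \<Rightarrow> bool" where
  "algebraic_fun_on U f \<longleftrightarrow> smooth_fun_on U f \<and>
     (\<exists>Q::'a \<times> real \<Rightarrow> real. real_polynomial_function Q \<and> Q \<noteq> (\<lambda>_. 0) \<and> (\<forall>x\<in>U. Q (x, f x) = 0))"

text \<open>The equations of an algebraic set are algebraic functions on \<open>U\<close> rather than polynomials.
  The discs of an s-pair depend on \<open>(\<lambda>, c)\<close> through the solution \<open>X\<close> with spectrum in the unit disc of
  \<open>P + 2 C X + P\<^sup>* X\<^sup>2 = 0\<close>, where \<open>P = \<Sum>j. \<lambda>\<^sub>j A\<^sub>j\<close> and \<open>C = \<Sum>j. c\<^sub>j A\<^sub>j\<close>.  This \<open>X\<close> is an algebraic, but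
  not a rational function of the parameters, and polynomial equations alone cannot distinguish it
  from the other solutions.\<close>

definition algebraic_set_in :: "'a::euclidean_space set \<Rightarrow> 'a set \<Rightarrow> bool" where
  "algebraic_set_in U D \<longleftrightarrow>
     (\<exists>S. finite S \<and> (\<forall>f\<in>S. algebraic_fun_on U f) \<and> D = {x\<in>U. \<forall>f\<in>S. f x = 0})"

text \<open>Proper: different from \<open>U\<close>, and even contained in the zero set of a nonzero polynomial.\<close>

definition proper_algebraic_set_in :: "'a::euclidean_space set \<Rightarrow> 'a set \<Rightarrow> bool" where
  "proper_algebraic_set_in U D \<longleftrightarrow> algebraic_set_in U D \<and> D \<subset> U \<and>
     (\<exists>q. real_polynomial_function q \<and> q \<noteq> (\<lambda>_. 0) \<and> (\<forall>x\<in>D. q x = 0))"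

end

theory Submission
  imports Defs "HOL-Complex_Analysis.Conformal_Mappings"
begin

text \<open>Write \<open>P = \<Sum>j. \<lambda>\<^sub>j A\<^sub>j\<close>, \<open>C = \<Sum>j. c\<^sub>j A\<^sub>j\<close> and
  \<open>2 G(\<zeta>) = \<zeta> P + 2 C + \<zeta>\<^sup>-\<^sup>1 P\<^sup>*\<close>, which is positive on the circle.  If \<open>g\<^sub>n\<close> are the Fourier coefficients of
  the inverse of \<open>2 G\<close>, then \<open>X = g\<^sub>1 g\<^sub>0\<^sup>-\<^sup>1\<close> has its spectrum in the open disc and
  \<open>2 G = (1 - \<zeta> X)\<^sup>* K (1 - \<zeta> X)\<close> on the circle, with \<open>K\<close> Hermitian.  The conormal condition forces
  \<open>w(\<zeta>) = w\<^sub>0 + (\<zeta> - 1) (1 - \<zeta> X)\<^sup>-\<^sup>1 (v - X v)\<close>, and solutions of the Stein equations \<open>S - X\<^sup>* S X = A\<^sub>j\<close>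
  give \<open>z(\<zeta>)\<close> in closed form.

  Such a disc is defective iff some nonzero \<open>B\<close> in the real span of the \<open>A\<^sub>j\<close> satisfies \<open>B X\<^sup>n v = 0\<close> for
  all \<open>n\<close>, that is, iff a Gram determinant in \<open>X\<close> and \<open>v\<close> vanishes.  This determinant is smooth, because the
  \<open>g\<^sub>n\<close> are integrals of rational functions.  It is algebraic, because \<open>(K, X) \<mapsto> (P, 2 C)\<close> is a polynomial map
  between spaces of equal dimension, so that any polynomial in \<open>K, X, v\<close> is algebraically dependent on
  \<open>P, C, v\<close>.  It does not vanish if \<open>P\<close> is a small multiple of an element \<open>B\<close> of the span with the maximal number of
  eigenvalues relative to \<open>C\<close> and \<open>v\<close> is a sum of eigenvectors, one for each eigenvalue: a matrix \<open>M\<close> in the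
  span with \<open>M X\<^sup>n v = 0\<close> for all \<open>n\<close> kills each of them, so all \<open>B + t M\<close> have the same relative spectrum, which is
  impossible for large \<open>t\<close> unless \<open>M = 0\<close>.\<close>

section \<open>Algebraic dependence of polynomials\<close>

text \<open>Smoothness and the algebraic relation are therefore proved on the space of all positive
  coefficients, and the parameter space enters as the preimage of this open convex set under a
  linear map. Two obstacles result. A polynomial relation on the large space may vanish identically
  on the image of the parameters; moving off the image with one extra variable, cancelling a power
  of it and letting it tend to 0 repairs this. And \<open>Q (x, F) = 0\<close> confines the zeros of
  \<open>F\<close> to a hypersurface only if \<open>Q (x, 0)\<close> is not identically zero; so
  powers of the last variable are cancelled, which is legitimate because \<open>F\<close> cannot
  vanish near a point without vanishing everywhere. Convexity reduces this identity principle to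
  segments, hence to holomorphic functions of one variable, and also serves differentiation under
  the integral. Existence and uniqueness of the discs are proved for all parameters that are
  positive on the circle, which identifies the parameter space with the region of
  positivity.\<close>

definition monomial :: "('a::euclidean_space \<Rightarrow> nat) \<Rightarrow> 'a \<Rightarrow> real" where
  "monomial \<alpha> x = (\<Prod>b\<in>Basis. (x \<bullet> b) ^ \<alpha> b)"

text \<open>Extensionality off \<open>Basis\<close> gives each multi-index exactly one
  representative. Bounding every exponent separately, rather than the total degree, makes the
  cardinality an exact power.\<close>

definition exponents :: "nat \<Rightarrow> ('a::euclidean_space \<Rightarrow> nat) set" where
  "exponents N = PiE Basis (\<lambda>_. {..N})"

lemma finite_exponents [simp]: "finite (exponents N)"
  by (simp add: exponents_def finite_PiE)

lemma card_exponents: "card (exponents N :: ('a::euclidean_space \<Rightarrow> nat) set) = Suc N ^ DIM('a)"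
  by (simp add: exponents_def card_PiE)

lemma exponents_mono: "N \<le> N' \<Longrightarrow> exponents N \<subseteq> exponents N'"
  unfolding exponents_def by (intro PiE_mono) auto

text \<open>Freezing all variables but one leaves a polynomial in one variable that vanishes
  identically. Its coefficients vanish, and they are polynomials in the remaining variables, to
  which the induction hypothesis applies.\<close>

lemma product_monomials_independent:
  assumes "finite S"
    and "\<forall>y::'b \<Rightarrow> real. (\<Sum>\<alpha>\<in>PiE S (\<lambda>_. {..N}). c \<alpha> * (\<Prod>b\<in>S. y b ^ \<alpha> b)) = 0"
  shows "\<forall>\<alpha>\<in>PiE S (\<lambda>_. {..N::nat}). c \<alpha> = (0::real)"
  using assms
proof (induction S arbitrary: c rule: finite_induct)
  case empty
  then show ?case by simp
next
  case (insert b S)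
  let ?E = "PiE S (\<lambda>_. {..N})"
  have inj: "inj_on (\<lambda>(i, g). g(b := i)) ({..N} \<times> ?E)"
    using inj_combinator[OF insert.hyps(2), of "\<lambda>_. {..N}"] by simp
  have expand: "(\<Sum>\<alpha>\<in>PiE (insert b S) (\<lambda>_. {..N}). c \<alpha> * (\<Prod>a\<in>insert b S. y a ^ \<alpha> a)) =
     (\<Sum>i\<le>N. (\<Sum>g\<in>?E. c (g(b := i)) * (\<Prod>a\<in>S. y a ^ g a)) * y b ^ i)" for y
  proof -
    have p: "(\<Prod>a\<in>S. y a ^ (if a = b then i else g a)) = (\<Prod>a\<in>S. y a ^ g a)" for i g
      using insert.hyps(2) by (intro prod.cong) auto
    have "(\<Sum>\<alpha>\<in>PiE (insert b S) (\<lambda>_. {..N}). c \<alpha> * (\<Prod>a\<in>insert b S. y a ^ \<alpha> a)) =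
      (\<Sum>(i, g)\<in>{..N} \<times> ?E. c (g(b := i)) * (\<Prod>a\<in>insert b S. y a ^ (g(b := i)) a))"
      unfolding PiE_insert_eq by (subst sum.reindex[OF inj]) (simp add: case_prod_unfold)
    also have "\<dots> = (\<Sum>i\<le>N. \<Sum>g\<in>?E. c (g(b := i)) * (\<Prod>a\<in>insert b S. y a ^ (g(b := i)) a))"
      by (simp add: sum.cartesian_product)
    also have "\<dots> = (\<Sum>i\<le>N. (\<Sum>g\<in>?E. c (g(b := i)) * (\<Prod>a\<in>S. y a ^ g a)) * y b ^ i)"
      using insert.hyps by (simp add: p sum_distrib_left sum_distrib_right algebra_simps)
    finally show ?thesis .
  qed
  have coeff: "\<forall>i\<le>N. (\<Sum>g\<in>?E. c (g(b := i)) * (\<Prod>a\<in>S. y a ^ g a)) = 0" for y :: "'b \<Rightarrow> real"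
  proof -
    have "(\<Sum>i\<le>N. (\<Sum>g\<in>?E. c (g(b := i)) * (\<Prod>a\<in>S. y a ^ g a)) * t ^ i) = 0" for t
    proof -
      have "(\<Prod>a\<in>S. (y(b := t)) a ^ g a) = (\<Prod>a\<in>S. y a ^ g a)" for g
        using insert.hyps(2) by (intro prod.cong) auto
      then show ?thesis
        using insert.prems[rule_format, of "y(b := t)"] expand[of "y(b := t)"] by simp
    qed
    then show ?thesis
      using Transcendental.polyfun_eq_0[of "\<lambda>i. \<Sum>g\<in>?E. c (g(b := i)) * (\<Prod>a\<in>S. y a ^ g a)" N] by blast
  qed
  have "c (g(b := i)) = 0" if "i \<le> N" "g \<in> ?E" for i g
    using insert.IH[of "\<lambda>g. c (g(b := i))"] coeff that by blast
  then show ?case unfolding PiE_insert_eq by auto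
qed

lemma monomials_independent:
  assumes "\<forall>x::'a::euclidean_space. (\<Sum>\<alpha>\<in>exponents N. c \<alpha> * monomial \<alpha> x) = 0" and "\<alpha> \<in> exponents N"
  shows "c \<alpha> = 0"
proof -
  have "(\<Sum>\<alpha>\<in>PiE Basis (\<lambda>_. {..N}). c \<alpha> * (\<Prod>b\<in>Basis. y b ^ \<alpha> b)) = 0" for y :: "'a \<Rightarrow> real"
    using assms(1)[rule_format, of "\<Sum>b\<in>Basis. y b *\<^sub>R b"]
    by (simp add: exponents_def monomial_def)
  then show ?thesis
    using product_monomials_independent[where S = Basis and N = N and c = c] assms(2) by (auto simp: exponents_def)
qed

text \<open>Elimination: either the new equation has only zero coefficients, or it is solved for one
  unknown \<open>p\<close> and substituted into the others, which lowers both counts by one.\<close>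

lemma underdetermined_system:
  fixes a :: "'i \<Rightarrow> 'b \<Rightarrow> 'c::field"
  assumes "finite B" "finite I" "card B < card I"
  shows "\<exists>c. (\<exists>i\<in>I. c i \<noteq> 0) \<and> (\<forall>b\<in>B. (\<Sum>i\<in>I. c i * a i b) = 0)"
  using assms
proof (induction B arbitrary: I a rule: finite_induct)
  case empty
  then have "I \<noteq> {}" by auto
  then show ?case by (intro exI[of _ "\<lambda>_. 1"]) auto
next
  case (insert b B)
  show ?case
  proof (cases "\<forall>i\<in>I. a i b = 0")
    case True
    obtain c where "\<exists>i\<in>I. c i \<noteq> 0" "\<forall>\<beta>\<in>B. (\<Sum>i\<in>I. c i * a i \<beta>) = 0"
      using insert.IH[of I a] insert.prems insert.hyps by auto
    then show ?thesis using True by (intro exI[of _ c]) auto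
  next
    case False
    then obtain p where p: "p \<in> I" "a p b \<noteq> 0" by auto
    define I' where "I' = I - {p}"
    have "card B < card I'" using insert p by (simp add: I'_def)
    then obtain c where c: "\<exists>i\<in>I'. c i \<noteq> 0"
        "\<forall>\<beta>\<in>B. (\<Sum>i\<in>I'. c i * (a i \<beta> - a i b / a p b * a p \<beta>)) = 0"
      using insert.IH[of I' "\<lambda>i \<beta>. a i \<beta> - a i b / a p b * a p \<beta>"] insert.prems I'_def by auto
    define d where "d = c(p := - (\<Sum>i\<in>I'. c i * a i b / a p b))"
    have I: "I = insert p I'" "p \<notin> I'" "finite I'" using p insert.prems by (auto simp: I'_def)
    have sum: "(\<Sum>i\<in>I. d i * a i \<beta>) = (\<Sum>i\<in>I'. c i * (a i \<beta> - a i b / a p b * a p \<beta>))" for \<beta>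
    proof -
      have "(\<Sum>i\<in>I'. d i * a i \<beta>) = (\<Sum>i\<in>I'. c i * a i \<beta>)"
        using I by (intro sum.cong) (auto simp: d_def)
      then have "(\<Sum>i\<in>I. d i * a i \<beta>) = - (\<Sum>i\<in>I'. c i * a i b / a p b) * a p \<beta> + (\<Sum>i\<in>I'. c i * a i \<beta>)"
        using I by (simp add: d_def)
      also have "\<dots> = (\<Sum>i\<in>I'. c i * (a i \<beta> - a i b / a p b * a p \<beta>))"
        by (simp add: sum_distrib_left sum_subtractf right_diff_distrib mult_ac)
      finally show ?thesis .
    qed
    have "(\<Sum>i\<in>I. d i * a i b) = 0"
      unfolding sum using p by simp
    moreover have "\<forall>\<beta>\<in>B. (\<Sum>i\<in>I. d i * a i \<beta>) = 0" using c sum by simp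
    moreover have "\<exists>i\<in>I. d i \<noteq> 0" using c I by (auto simp: d_def)
    ultimately show ?thesis by (intro exI[of _ d]) auto
  qed
qed

section \<open>Polynomials of bounded degree in each variable\<close>

definition box_poly :: "nat \<Rightarrow> ('a::euclidean_space \<Rightarrow> real) \<Rightarrow> bool" where
  "box_poly N f \<longleftrightarrow> (\<exists>c. \<forall>x. f x = (\<Sum>\<alpha>\<in>exponents N. c \<alpha> * monomial \<alpha> x))"

lemma box_poly_mono: "box_poly N f \<Longrightarrow> N \<le> N' \<Longrightarrow> box_poly N' f"
proof -
  assume "box_poly N f" and le: "N \<le> N'"
  then obtain c where c: "\<And>x. f x = (\<Sum>\<alpha>\<in>exponents N. c \<alpha> * monomial \<alpha> x)"
    by (auto simp: box_poly_def)
  have "f x = (\<Sum>\<alpha>\<in>exponents N'. (if \<alpha> \<in> exponents N then c \<alpha> else 0) * monomial \<alpha> x)" for x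
    unfolding c using exponents_mono[OF le] by (intro sum.mono_neutral_cong_left) auto
  then show ?thesis
    unfolding box_poly_def by (intro exI[of _ "\<lambda>\<alpha>. if \<alpha> \<in> exponents N then c \<alpha> else 0"]) blast
qed

lemma box_poly_monomial: "\<alpha> \<in> exponents N \<Longrightarrow> box_poly N (monomial \<alpha>)"
  unfolding box_poly_def
  by (intro exI[of _ "\<lambda>\<beta>. if \<beta> = \<alpha> then 1 else 0"]) (simp add: if_distrib[of "\<lambda>u. u * _"] cong: if_cong)

lemma box_poly_scale: "box_poly N f \<Longrightarrow> box_poly N (\<lambda>x. r * f x)"
  unfolding box_poly_def
proof (elim exE)
  fix c assume "\<forall>x. f x = (\<Sum>\<alpha>\<in>exponents N. c \<alpha> * monomial \<alpha> x)"
  then show "\<exists>c. \<forall>x. r * f x = (\<Sum>\<alpha>\<in>exponents N. c \<alpha> * monomial \<alpha> x)"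
    by (intro exI[of _ "\<lambda>\<alpha>. r * c \<alpha>"]) (simp add: sum_distrib_left mult.assoc)
qed

lemma box_poly_add: "box_poly N f \<Longrightarrow> box_poly N g \<Longrightarrow> box_poly N (\<lambda>x. f x + g x)"
  unfolding box_poly_def
proof (elim exE)
  fix c d assume "\<forall>x. f x = (\<Sum>\<alpha>\<in>exponents N. c \<alpha> * monomial \<alpha> x)"
    "\<forall>x. g x = (\<Sum>\<alpha>\<in>exponents N. d \<alpha> * monomial \<alpha> x)"
  then show "\<exists>c. \<forall>x. f x + g x = (\<Sum>\<alpha>\<in>exponents N. c \<alpha> * monomial \<alpha> x)"
    by (intro exI[of _ "\<lambda>\<alpha>. c \<alpha> + d \<alpha>"]) (simp add: sum.distrib algebra_simps)
qed

lemma box_poly_const: "box_poly N (\<lambda>x. r)"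
proof -
  let ?z = "restrict (\<lambda>_. 0) Basis :: 'a \<Rightarrow> nat"
  have "box_poly N (\<lambda>x::'a. r * monomial ?z x)"
    by (intro box_poly_scale box_poly_monomial) (auto simp: exponents_def)
  then show ?thesis by (simp add: monomial_def)
qed

lemma box_poly_sum: "(\<And>i. i \<in> I \<Longrightarrow> box_poly N (f i)) \<Longrightarrow> box_poly N (\<lambda>x. \<Sum>i\<in>I. f i x)"
  by (induction I rule: infinite_finite_induct) (auto intro: box_poly_add box_poly_const)

lemma box_poly_mult:
  assumes "box_poly N f" "box_poly N' g"
  shows "box_poly (N + N') (\<lambda>x. f x * g x)"
proof -
  obtain c d where c: "\<And>x. f x = (\<Sum>\<alpha>\<in>exponents N. c \<alpha> * monomial \<alpha> x)"
    and d: "\<And>x. g x = (\<Sum>\<alpha>\<in>exponents N'. d \<alpha> * monomial \<alpha> x)"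
    using assms unfolding box_poly_def by metis
  \<comment> \<open>Restriction keeps the sum of two multi-indices extensional, as membership in
    \<open>exponents\<close> requires.\<close>
  define s where "s \<alpha> \<beta> = restrict (\<lambda>b. \<alpha> b + \<beta> b) Basis" for \<alpha> \<beta> :: "'a \<Rightarrow> nat"
  have s: "monomial \<alpha> x * monomial \<beta> x = monomial (s \<alpha> \<beta>) x" for \<alpha> \<beta> x
    by (simp add: monomial_def s_def power_add prod.distrib)
  have eq: "f x * g x = (\<Sum>\<alpha>\<in>exponents N. \<Sum>\<beta>\<in>exponents N'. c \<alpha> * d \<beta> * monomial (s \<alpha> \<beta>) x)" for x
    unfolding c d sum_product s[symmetric] by (simp add: algebra_simps)
  have "box_poly (N + N') (\<lambda>x. \<Sum>\<alpha>\<in>exponents N. \<Sum>\<beta>\<in>exponents N'. c \<alpha> * d \<beta> * monomial (s \<alpha> \<beta>) x)"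
  proof (intro box_poly_sum box_poly_scale box_poly_monomial)
    fix \<alpha> \<beta> :: "'a \<Rightarrow> nat" assume "\<alpha> \<in> exponents N" "\<beta> \<in> exponents N'"
    then show "s \<alpha> \<beta> \<in> exponents (N + N')"
      by (auto simp: exponents_def s_def PiE_iff intro!: add_mono)
  qed
  then show ?thesis by (simp only: eq)
qed

lemma box_poly_power: "box_poly N f \<Longrightarrow> box_poly (n * N) (\<lambda>x. f x ^ n)"
  by (induction n) (auto intro: box_poly_const box_poly_mult)

lemma box_poly_prod:
  "finite I \<Longrightarrow> (\<And>i. i \<in> I \<Longrightarrow> box_poly (N i) (f i)) \<Longrightarrow> box_poly (\<Sum>i\<in>I. N i) (\<lambda>x. \<Prod>i\<in>I. f i x)"
  by (induction I rule: finite_induct) (auto intro: box_poly_const box_poly_mult)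

lemma real_polynomial_function_imp_box_poly:
  "real_polynomial_function f \<Longrightarrow> \<exists>N. box_poly N f"
proof (induction rule: real_polynomial_function.induct)
  case (linear f)
  have "box_poly 1 (\<lambda>x::'a. x \<bullet> b)" if "b \<in> Basis" for b
  proof -
    let ?e = "restrict (\<lambda>a. if a = b then 1 else 0) Basis :: 'a \<Rightarrow> nat"
    have "monomial ?e x = x \<bullet> b" for x :: 'a
    proof -
      have "monomial ?e x = (\<Prod>a\<in>Basis. if a = b then x \<bullet> a else 1)"
        unfolding monomial_def by (intro prod.cong) auto
      then show ?thesis using that by simp
    qed
    moreover have "?e \<in> exponents 1" by (auto simp: exponents_def)
    moreover from calculation have "(\<lambda>x. x \<bullet> b) = monomial ?e" by (intro ext) metis
    ultimately show ?thesis
      using box_poly_monomial[of ?e 1] by metis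
  qed
  then have "box_poly 1 (\<lambda>x. \<Sum>b\<in>Basis. f b * (x \<bullet> b))"
    by (intro box_poly_sum box_poly_scale)
  moreover have "(\<lambda>x. \<Sum>b\<in>Basis. f b * (x \<bullet> b)) = f"
  proof
    fix x show "(\<Sum>b\<in>Basis. f b * (x \<bullet> b)) = f x"
    using linear_sum[OF bounded_linear.linear[OF linear], of "\<lambda>b. (x \<bullet> b) *\<^sub>R b" Basis]
    by (simp add: euclidean_representation linear_cmul[OF bounded_linear.linear[OF linear]] mult.commute)
  qed
  ultimately show ?case by metis
next
  case (add f g)
  then obtain N N' where "box_poly N f" "box_poly N' g" by auto
  then show ?case
    by (intro exI[of _ "max N N'"] box_poly_add) (auto elim: box_poly_mono)
qed (blast intro: box_poly_const box_poly_mult)+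

lemma real_polynomial_function_monomial: "real_polynomial_function (monomial \<alpha>)"
proof -
  have "real_polynomial_function (\<lambda>x. \<Prod>b\<in>Basis. (x \<bullet> b) ^ \<alpha> b)"
    by (intro real_polynomial_function_prod real_polynomial_function_power
        real_polynomial_function.intros(1) bounded_linear_inner_left) auto
  then show ?thesis unfolding monomial_def[abs_def] .
qed

text \<open>The monomials with exponents at most \<open>N\<close> number \<open>(N + 1)\<close> to the power \<open>DIM('b)\<close>, whereas their
  pullbacks span a space whose dimension grows like \<open>N\<close> to the power \<open>DIM('a)\<close>.\<close>

lemma polynomial_map_algebraically_dependent:
  fixes \<Phi> :: "'a::euclidean_space \<Rightarrow> 'b::euclidean_space"
  assumes \<Phi>: "polynomial_function \<Phi>" and dim: "DIM('a) < DIM('b)"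
  shows "\<exists>Q. real_polynomial_function Q \<and> Q \<noteq> (\<lambda>_. 0) \<and> (\<forall>u. Q (\<Phi> u) = 0)"
proof -
  have "\<exists>e. box_poly e (\<lambda>u. \<Phi> u \<bullet> b)" if "b \<in> Basis" for b
    using \<Phi> that unfolding polynomial_function_iff_Basis_inner
    by (intro real_polynomial_function_imp_box_poly) auto
  then obtain e where e: "\<And>b. b \<in> Basis \<Longrightarrow> box_poly (e b) (\<lambda>u. \<Phi> u \<bullet> b)" by metis
  define E where "E = (\<Sum>b\<in>Basis. e b)"
  \<comment> \<open>Chosen so that the factor \<open>Suc E ^ DIM('a)\<close> in the count below
    becomes \<open>N\<close>, which is less than one more factor \<open>Suc N\<close>; the strict
    inequality of dimensions supplies that factor.\<close>
  define N where "N = Suc E ^ DIM('a)"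
  have "e b \<le> E" if "b \<in> Basis" for b
    unfolding E_def using that by (intro member_le_sum) auto
  have "box_poly (N * E) (\<lambda>u. monomial \<alpha> (\<Phi> u))" if "\<alpha> \<in> exponents N" for \<alpha>
  proof -
    have "box_poly (\<Sum>b\<in>Basis. \<alpha> b * e b) (\<lambda>u. \<Prod>b\<in>Basis. (\<Phi> u \<bullet> b) ^ \<alpha> b)"
      by (intro box_poly_prod box_poly_power e) auto
    moreover have "(\<Sum>b\<in>Basis. \<alpha> b * e b) \<le> N * E"
      using that unfolding E_def sum_distrib_left
      by (intro sum_mono mult_right_mono) (auto simp: exponents_def PiE_iff)
    ultimately show ?thesis unfolding monomial_def by (rule box_poly_mono)
  qed
  then have "\<forall>\<alpha>\<in>exponents N. \<exists>a. \<forall>u. monomial \<alpha> (\<Phi> u) = (\<Sum>\<beta>\<in>exponents (N * E). a \<beta> * monomial \<beta> u)"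
    unfolding box_poly_def by blast
  then obtain a where a: "\<And>\<alpha> u. \<alpha> \<in> exponents N \<Longrightarrow>
      monomial \<alpha> (\<Phi> u) = (\<Sum>\<beta>\<in>exponents (N * E). a \<alpha> \<beta> * monomial \<beta> u)"
    by metis
  have "Suc (N * E) ^ DIM('a) \<le> (Suc E * Suc N) ^ DIM('a)"
    by (intro power_mono) auto
  also have "\<dots> = N * Suc N ^ DIM('a)" by (simp only: power_mult_distrib N_def)
  also have "\<dots> < Suc N * Suc N ^ DIM('a)" by simp
  also have "\<dots> \<le> Suc N ^ DIM('b)"
    unfolding power_Suc[symmetric] using dim by (intro power_increasing) auto
  finally have "card (exponents (N * E) :: ('a \<Rightarrow> nat) set) < card (exponents N :: ('b \<Rightarrow> nat) set)"
    by (simp only: card_exponents)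
  then obtain c where c: "\<exists>\<alpha>\<in>exponents N. c \<alpha> \<noteq> 0"
      "\<forall>\<beta>\<in>exponents (N * E). (\<Sum>\<alpha>\<in>exponents N. c \<alpha> * a \<alpha> \<beta>) = 0"
    using underdetermined_system[of "exponents (N * E)" "exponents N" a] by auto
  define Q where "Q = (\<lambda>x::'b. \<Sum>\<alpha>\<in>exponents N. c \<alpha> * monomial \<alpha> x)"
  have "real_polynomial_function Q"
    unfolding Q_def
    by (intro real_polynomial_function_sum real_polynomial_function.intros(4) real_polynomial_function.intros(2)
        real_polynomial_function_monomial) auto
  moreover have "Q \<noteq> (\<lambda>_. 0)"
    using monomials_independent[where N = N and c = c] c(1) by (auto simp: Q_def fun_eq_iff)
  moreover have "Q (\<Phi> u) = 0" for u
  proof -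
    have "Q (\<Phi> u) = (\<Sum>\<alpha>\<in>exponents N. \<Sum>\<beta>\<in>exponents (N * E). c \<alpha> * a \<alpha> \<beta> * monomial \<beta> u)"
      unfolding Q_def by (intro sum.cong) (simp_all add: a sum_distrib_left mult.assoc)
    also have "\<dots> = (\<Sum>\<beta>\<in>exponents (N * E). (\<Sum>\<alpha>\<in>exponents N. c \<alpha> * a \<alpha> \<beta>) * monomial \<beta> u)"
      by (subst sum.swap) (simp add: sum_distrib_right)
    also have "\<dots> = 0" using c(2) by simp
    finally show ?thesis .
  qed
  ultimately show ?thesis by blast
qed

section \<open>Polynomials in one distinguished variable\<close>

lemma real_polynomial_function_compose':
  "real_polynomial_function g \<Longrightarrow> polynomial_function f \<Longrightarrow> real_polynomial_function (\<lambda>x. g (f x))"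
  using real_polynomial_function_compose[of f g] by (simp add: o_def)

lemma polynomial_function_Pair:
  fixes f :: "'a::real_normed_vector \<Rightarrow> 'b::euclidean_space" and g :: "'a \<Rightarrow> 'c::euclidean_space"
  assumes "polynomial_function f" "polynomial_function g"
  shows "polynomial_function (\<lambda>x. (f x, g x))"
  using assms unfolding polynomial_function_iff_Basis_inner Basis_prod_def by auto

lemma polynomial_in_last_variable:
  fixes p :: "'a::real_normed_vector \<times> real \<Rightarrow> real"
  assumes "real_polynomial_function p"
  shows "\<exists>n a. (\<forall>i. real_polynomial_function (a i)) \<and> (\<forall>x s. p (x, s) = (\<Sum>i\<le>n. a i x * s ^ i))"
  using assms
proof (induction rule: real_polynomial_function.induct)
  case (linear f)
  have f1: "f (x, s) = f (x, 0) + s * f (0, 1)" for x s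
  proof -
    have "f (x, s) = f ((x, 0) + s *\<^sub>R (0, 1))" by simp
    also have "\<dots> = f (x, 0) + s * f (0, 1)"
      unfolding linear_add[OF bounded_linear.linear[OF linear]]
        linear_cmul[OF bounded_linear.linear[OF linear]] by simp
    finally show ?thesis .
  qed
  have "bounded_linear (\<lambda>x. f (x, 0))"
    using bounded_linear_compose[OF linear bounded_linear_Pair[OF bounded_linear_ident bounded_linear_zero]]
    by simp
  then have "real_polynomial_function (\<lambda>x. if i = 0 then f (x, 0) else f (0, 1))" for i :: nat
    by (cases "i = 0") auto
  moreover have "f (x, s) = (\<Sum>i\<le>1. (if i = 0 then f (x, 0) else f (0, 1)) * s ^ i)" for x s
    by (subst f1) simp
  ultimately show ?case
    by (intro exI[of _ "1::nat"] exI[of _ "\<lambda>i x. if i = (0::nat) then f (x, 0) else f (0, 1)"]) blast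
next
  case (const c)
  then show ?case by (intro exI[of _ 0] exI[of _ "\<lambda>_ _. c"]) auto
next
  case (add f g)
  from add.IH(1) obtain n a where f: "\<And>i. real_polynomial_function (a i)"
      "\<And>x s. f (x, s) = (\<Sum>i\<le>n. a i x * s ^ i)" by blast
  from add.IH(2) obtain n' a' where g: "\<And>i. real_polynomial_function (a' i)"
      "\<And>x s. g (x, s) = (\<Sum>i\<le>n'. a' i x * s ^ i)" by blast
  note * = f g
  define b where "b i = (\<lambda>x. if i \<le> n then a i x else 0)" for i
  define b' where "b' i = (\<lambda>x. if i \<le> n' then a' i x else 0)" for i
  have rb: "real_polynomial_function (b i)" "real_polynomial_function (b' i)" for i
    unfolding b_def b'_def using * by (cases "i \<le> n"; cases "i \<le> n'"; auto)+
  have 1: "f (x, s) = (\<Sum>i\<le>max n n'. b i x * s ^ i)" for x s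
    unfolding *(2) b_def by (intro sum.mono_neutral_cong_left) auto
  have 2: "g (x, s) = (\<Sum>i\<le>max n n'. b' i x * s ^ i)" for x s
    unfolding *(4) b'_def by (intro sum.mono_neutral_cong_left) auto
  show ?case
    by (intro exI[of _ "max n n'"] exI[of _ "\<lambda>i x. b i x + b' i x"])
       (auto simp: rb 1 2 sum.distrib algebra_simps)
next
  case (mult f g)
  from mult.IH(1) obtain n a where f: "\<And>i. real_polynomial_function (a i)"
      "\<And>x s. f (x, s) = (\<Sum>i\<le>n. a i x * s ^ i)" by blast
  from mult.IH(2) obtain n' a' where g: "\<And>i. real_polynomial_function (a' i)"
      "\<And>x s. g (x, s) = (\<Sum>i\<le>n'. a' i x * s ^ i)" by blast
  note * = f g
  \<comment> \<open>Cauchy product: pairs of exponents are grouped by their sum.\<close>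
  define b where "b r = (\<lambda>x. \<Sum>p\<in>{p \<in> {..n} \<times> {..n'}. fst p + snd p = r}. a (fst p) x * a' (snd p) x)" for r
  have fin: "finite {p \<in> {..n} \<times> {..n'}. fst p + snd p = r}" for r by simp
  have rb: "real_polynomial_function (b r)" for r
    unfolding b_def using * fin
    by (intro real_polynomial_function_sum real_polynomial_function.intros(4)) auto
  have "f (x, s) * g (x, s) = (\<Sum>r\<le>n + n'. b r x * s ^ r)" for x s
  proof -
    have "f (x, s) * g (x, s) = (\<Sum>(i, j)\<in>{..n} \<times> {..n'}. a i x * a' j x * s ^ (i + j))"
      unfolding * sum_product sum.cartesian_product
      by (intro sum.cong) (auto simp: power_add algebra_simps)
    also have "\<dots> = (\<Sum>r\<in>{..n + n'}. \<Sum>p\<in>{p \<in> {..n} \<times> {..n'}. fst p + snd p = r}.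
        case p of (i, j) \<Rightarrow> a i x * a' j x * s ^ (i + j))"
      by (subst sum.group) auto
    also have "\<dots> = (\<Sum>r\<in>{..n + n'}. b r x * s ^ r)"
      unfolding b_def sum_distrib_right by (intro sum.cong) auto
    finally show ?thesis .
  qed
  then show ?case using rb by (intro exI[of _ "n + n'"] exI[of _ b]) auto
qed

text \<open>\<open>r\<close> is the order of vanishing at \<open>s = 0\<close>, the index of the
  first coefficient that is not identically zero. Putting \<open>s = 0\<close> in the quotient
  leaves a nonzero polynomial, which makes a relation fit for specialisation.\<close>

lemma divide_out_last_variable:
  fixes p :: "'a::real_normed_vector \<times> real \<Rightarrow> real"
  assumes "real_polynomial_function p" "p \<noteq> (\<lambda>_. 0)"
  shows "\<exists>r q x0. real_polynomial_function q \<and> (\<forall>x s. p (x, s) = s ^ r * q (x, s)) \<and> q (x0, 0) \<noteq> 0"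
proof -
  obtain n a where a: "\<And>i. real_polynomial_function (a i)"
      "\<And>x s. p (x, s) = (\<Sum>i\<le>n. a i x * s ^ i)"
    using polynomial_in_last_variable[OF assms(1)] by blast
  define r where "r = (LEAST i. i \<le> n \<and> a i \<noteq> (\<lambda>_. 0))"
  have "\<exists>i. i \<le> n \<and> a i \<noteq> (\<lambda>_. 0)"
  proof (rule ccontr)
    assume "\<not> (\<exists>i. i \<le> n \<and> a i \<noteq> (\<lambda>_. 0))"
    then have "p (x, s) = 0" for x s unfolding a(2) by (intro sum.neutral) auto
    then show False using assms(2) by auto
  qed
  then have r: "r \<le> n" "a r \<noteq> (\<lambda>_. 0)" and least: "\<And>i. i < r \<Longrightarrow> a i = (\<lambda>_. 0)"
    using LeastI_ex[of "\<lambda>i. i \<le> n \<and> a i \<noteq> (\<lambda>_. 0)"] not_less_Least[of _ "\<lambda>i. i \<le> n \<and> a i \<noteq> (\<lambda>_. 0)"]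
    unfolding r_def[symmetric] by (auto simp: less_imp_le) 
  define q where "q = (\<lambda>z::'a \<times> real. \<Sum>i\<le>n - r. a (i + r) (fst z) * snd z ^ i)"
  have "polynomial_function (fst :: 'a \<times> real \<Rightarrow> 'a)"
    by (intro polynomial_function_bounded_linear bounded_linear_fst)
  then have "real_polynomial_function q"
    unfolding q_def
    by (intro real_polynomial_function_sum real_polynomial_function.intros(4) real_polynomial_function_power
        real_polynomial_function_compose'[OF a(1)] real_polynomial_function.intros(1) bounded_linear_snd) auto
  moreover have "p (x, s) = s ^ r * q (x, s)" for x s
  proof -
    have "p (x, s) = (\<Sum>i\<in>{r..n}. a i x * s ^ i)"
      unfolding a(2) by (intro sum.mono_neutral_right) (auto simp: least)
    also have "\<dots> = (\<Sum>i\<in>{0..n - r}. a (i + r) x * s ^ (i + r))"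
      using r(1) by (intro sum.reindex_bij_witness[of _ "\<lambda>i. i + r" "\<lambda>i. i - r"]) auto
    also have "\<dots> = s ^ r * q (x, s)"
      unfolding q_def sum_distrib_left atMost_atLeast0[symmetric]
      by (intro sum.cong) (auto simp: power_add algebra_simps)
    finally show ?thesis .
  qed
  moreover obtain x0 where "a r x0 \<noteq> 0" using r(2) by auto
  then have "q (x0, 0) \<noteq> 0" unfolding q_def by (simp add: power_0_left if_distrib cong: if_cong)
  ultimately show ?thesis by blast
qed

section \<open>Matrices over function rings\<close>

abbreviation circle_range :: "real set" where
  "circle_range \<equiv> cbox 0 (2 * pi)"

text \<open>Matrix-valued functions are handled through the class in which their entries lie:
  continuously differentiable functions, holomorphic functions, the disc algebra, period integrals,
  polynomials. Closure under constants, sums and products carries determinants, matrix products and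
  Cramer inverses over to all these classes at once.\<close>

definition function_subring :: "('x \<Rightarrow> complex) set \<Rightarrow> bool" where
  "function_subring C \<longleftrightarrow> (\<forall>c. (\<lambda>_. c) \<in> C) \<and> (\<forall>f\<in>C. \<forall>g\<in>C. (\<lambda>x. f x + g x) \<in> C) \<and>
     (\<forall>f\<in>C. \<forall>g\<in>C. (\<lambda>x. f x * g x) \<in> C)"

lemma subring_const: "function_subring C \<Longrightarrow> (\<lambda>_. c) \<in> C"
  and subring_add: "function_subring C \<Longrightarrow> f \<in> C \<Longrightarrow> g \<in> C \<Longrightarrow> (\<lambda>x. f x + g x) \<in> C"
  and subring_mult: "function_subring C \<Longrightarrow> f \<in> C \<Longrightarrow> g \<in> C \<Longrightarrow> (\<lambda>x. f x * g x) \<in> C"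
  unfolding function_subring_def by blast+

lemma subring_sum:
  assumes "function_subring C" "\<And>i. i \<in> I \<Longrightarrow> f i \<in> C"
  shows "(\<lambda>x. \<Sum>i\<in>I. f i x) \<in> C"
  using assms(2)
  by (induction I rule: infinite_finite_induct) (auto intro: subring_const[OF assms(1)] subring_add[OF assms(1)])

lemma subring_prod:
  assumes "function_subring C" "\<And>i. i \<in> I \<Longrightarrow> f i \<in> C"
  shows "(\<lambda>x. \<Prod>i\<in>I. f i x) \<in> C"
  using assms(2)
  by (induction I rule: infinite_finite_induct) (auto intro: subring_const[OF assms(1)] subring_mult[OF assms(1)])

lemma subring_det:
  fixes M :: "'x \<Rightarrow> complex^'m^'m"
  assumes C: "function_subring C" and "\<And>i j. (\<lambda>x. M x $ i $ j) \<in> C"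
  shows "(\<lambda>x. det (M x)) \<in> C"
  unfolding det_def
  by (intro subring_sum[OF C] subring_mult[OF C] subring_const[OF C] subring_prod[OF C] assms(2))

lemma subring_mat_mult:
  fixes M :: "'x \<Rightarrow> complex^'m^'p" and N :: "'x \<Rightarrow> complex^'q^'m"
  assumes C: "function_subring C" and "\<And>i j. (\<lambda>x. M x $ i $ j) \<in> C" "\<And>i j. (\<lambda>x. N x $ i $ j) \<in> C"
  shows "(\<lambda>x. (M x ** N x) $ i $ j) \<in> C"
proof -
  have "(\<lambda>x. \<Sum>k\<in>UNIV. M x $ i $ k * N x $ k $ j) \<in> C"
    by (intro subring_sum[OF C] subring_mult[OF C] assms(2,3))
  then show ?thesis by (simp add: matrix_matrix_mult_def)
qed

lemma subring_mat_vec_mult: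
  fixes M :: "'x \<Rightarrow> complex^'m^'p" and u :: "'x \<Rightarrow> complex^'m"
  assumes C: "function_subring C" and "\<And>i j. (\<lambda>x. M x $ i $ j) \<in> C" "\<And>i. (\<lambda>x. u x $ i) \<in> C"
  shows "(\<lambda>x. (M x *v u x) $ i) \<in> C"
proof -
  have "(\<lambda>x. \<Sum>k\<in>UNIV. M x $ i $ k * u x $ k) \<in> C"
    by (intro subring_sum[OF C] subring_mult[OF C] assms(2,3))
  then show ?thesis by (simp add: matrix_vector_mult_def)
qed

text \<open>The entry \<open>(i, j)\<close> of the adjugate, obtained as in Cramer's rule by
  replacing column \<open>i\<close> with the \<open>j\<close>-th unit vector.\<close>

definition cofactor :: "complex^'m^'m \<Rightarrow> 'm \<Rightarrow> 'm \<Rightarrow> complex" where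
  "cofactor M i j = det (\<chi> r c. if c = i then (if r = j then 1 else 0) else M $ r $ c)"

text \<open>Unlike \<^const>\<open>matrix_inv\<close>, this is a rational expression in the entries for every matrix.\<close>

definition cramer_inverse :: "complex^'m^'m \<Rightarrow> complex^'m^'m" where
  "cramer_inverse M = (\<chi> i j. inverse (det M) * cofactor M i j)"

lemma cramer_inverse:
  fixes M :: "complex^'m^'m"
  assumes "invertible M"
  shows "M ** cramer_inverse M = mat 1" "cramer_inverse M ** M = mat 1"
proof -
  have d: "det M \<noteq> 0" using assms invertible_det_nz by blast
  have "M *v (\<chi> i. cramer_inverse M $ i $ j) = axis j 1" for j
  proof -
    have "(\<chi> i. cramer_inverse M $ i $ j) =
        (\<chi> k. det (\<chi> r c. if c = k then axis j 1 $ r else M $ r $ c) / det M)"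
      by (simp add: cramer_inverse_def cofactor_def axis_def vec_eq_iff divide_inverse mult.commute
          if_distrib eq_commute cong: if_cong)
    then show ?thesis using cramer[OF d, of _ "axis j 1"] by blast
  qed
  then have "(M *v (\<chi> i. cramer_inverse M $ i $ j)) $ i = axis j 1 $ i" for i j by simp
  then show "M ** cramer_inverse M = mat 1"
    by (simp add: vec_eq_iff matrix_matrix_mult_def matrix_vector_mult_def mat_def axis_def)
  then show "cramer_inverse M ** M = mat 1" by (simp add: matrix_left_right_inverse)
qed

lemma subring_cramer_inverse:
  fixes M :: "'x \<Rightarrow> complex^'m^'m"
  assumes C: "function_subring C" and "\<And>i j. (\<lambda>x. M x $ i $ j) \<in> C"
    and "(\<lambda>x. inverse (det (M x))) \<in> C"
  shows "(\<lambda>x. cramer_inverse (M x) $ i $ j) \<in> C"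
proof -
  have "(\<lambda>x. (\<chi> r c. if c = i then (if r = j then 1 else 0) else M x $ r $ c) $ r $ c) \<in> C" for r c
    using assms(2)[of r c] subring_const[OF C] by (cases "c = i"; cases "r = j") auto
  then have "(\<lambda>x. cofactor (M x) i j) \<in> C"
    unfolding cofactor_def by (rule subring_det[OF C])
  then have "(\<lambda>x. inverse (det (M x)) * cofactor (M x) i j) \<in> C"
    by (intro subring_mult[OF C] assms(3))
  then show ?thesis by (simp add: cramer_inverse_def)
qed

lemma invertible_if_injective:
  fixes M :: "complex^'m^'m"
  assumes "\<And>u. M *v u = 0 \<Longrightarrow> u = 0"
  shows "invertible M"
  using assms matrix_left_invertible_ker[of M] invertible_left_inverse[of M] by blast

section \<open>Adjoints and the Hermitian form\<close>

definition adj :: "complex^'m^'n \<Rightarrow> complex^'n^'m" where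
  "adj M = (\<chi> i j. cnj (M $ j $ i))"

definition cip :: "complex^'m \<Rightarrow> complex^'m \<Rightarrow> complex" where
  "cip u v = pairing u (cnj_vec v)"

lemma cip_sum: "cip u v = (\<Sum>l\<in>UNIV. u $ l * cnj (v $ l))"
  by (simp add: cip_def pairing_def cnj_vec_def)

lemma Re_cip: "Re (cip u v) = u \<bullet> v"
  by (simp add: cip_sum inner_vec_def inner_complex_def)

lemma cip_self: "cip u u = complex_of_real (u \<bullet> u)"
  by (simp add: cip_sum inner_vec_def complex_eq_iff inner_complex_def)

lemma cip_add_left: "cip (u + u') v = cip u v + cip u' v"
  and cip_add_right: "cip u (v + v') = cip u v + cip u v'"
  and cip_scale_left: "cip (c *s u) v = c * cip u v"
  and cip_scale_right: "cip u (c *s v) = cnj c * cip u v"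
  by (simp_all add: cip_sum algebra_simps sum.distrib sum_distrib_left)

lemma cip_zero_left [simp]: "cip 0 v = 0" and cip_zero_right [simp]: "cip u 0 = 0"
  by (simp_all add: cip_sum)

lemma cip_sum_left: "cip (\<Sum>i\<in>I. f i) v = (\<Sum>i\<in>I. cip (f i) v)"
  by (induction I rule: infinite_finite_induct) (simp_all add: cip_add_left)

lemma cip_sum_right: "cip u (\<Sum>i\<in>I. f i) = (\<Sum>i\<in>I. cip u (f i))"
  by (induction I rule: infinite_finite_induct) (simp_all add: cip_add_right)

lemma cnj_cip: "cnj (cip u v) = cip v u"
  by (simp add: cip_sum mult.commute)

lemma cip_adj: "cip (M *v u) v = cip u (adj M *v v)"
proof -
  have "cip (M *v u) v = (\<Sum>i\<in>UNIV. \<Sum>j\<in>UNIV. M $ i $ j * u $ j * cnj (v $ i))"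
    by (simp add: cip_sum matrix_vector_mult_def sum_distrib_right)
  also have "\<dots> = (\<Sum>j\<in>UNIV. \<Sum>i\<in>UNIV. M $ i $ j * u $ j * cnj (v $ i))" by (rule sum.swap)
  also have "\<dots> = cip u (adj M *v v)"
    by (simp add: cip_sum matrix_vector_mult_def adj_def sum_distrib_left algebra_simps)
  finally show ?thesis .
qed

lemma inner_adj: "(M *v u) \<bullet> v = u \<bullet> (adj M *v v)"
  unfolding Re_cip[symmetric] cip_adj ..

lemma adj_adj [simp]: "adj (adj M) = M"
  and adj_add: "adj (M + N) = adj M + adj N"
  and adj_diff: "adj (M - N) = adj M - adj N"
  and adj_minus: "adj (- M) = - adj M"
  and adj_scaleR: "adj (r *\<^sub>R M) = r *\<^sub>R adj M"
  by (simp_all add: adj_def vec_eq_iff)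

lemma adj_mat_1 [simp]: "adj (mat 1) = mat 1"
  by (simp add: adj_def mat_def vec_eq_iff)

lemma adj_mult: "adj (M ** N) = adj N ** adj M"
  by (simp add: adj_def vec_eq_iff matrix_matrix_mult_def mult.commute)

lemma hermitian_iff_adj: "hermitian M \<longleftrightarrow> adj M = M"
  unfolding hermitian_def adj_def vec_eq_iff vec_lambda_beta by metis

lemma mat_vec_scale: "M *v (c *s u) = c *s (M *v (u :: complex^'m))"
  by (simp add: vec_eq_iff matrix_vector_mult_def sum_distrib_left algebra_simps)

lemma mat_vec_sum: "M *v (\<Sum>i\<in>I. f i) = (\<Sum>i\<in>I. M *v (f i :: complex^'m))"
  by (induction I rule: infinite_finite_induct) (simp_all add: matrix_vector_right_distrib)

lemma tendsto_mat_vec: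
  fixes M :: "nat \<Rightarrow> complex^'m^'n"
  assumes "\<And>i j. (\<lambda>n. M n $ i $ j) \<longlonglongrightarrow> N $ i $ j"
  shows "(\<lambda>n. M n *v u) \<longlonglongrightarrow> N *v u"
  by (intro vec_tendstoI) (simp add: matrix_vector_mult_def tendsto_sum tendsto_mult_right assms)

lemma tendsto_mat_vec_const:
  fixes M :: "complex^'m^'n"
  assumes "u \<longlonglongrightarrow> v"
  shows "(\<lambda>n. M *v u n) \<longlonglongrightarrow> M *v v"
  using assms by (intro vec_tendstoI) (simp add: matrix_vector_mult_def tendsto_sum tendsto_mult_left tendsto_vec_nth)

lemma mat_add_rdistrib: "(A + B) ** C = A ** C + B ** (C :: complex^'m^'n)"
  and mat_diff_ldistrib: "D ** (E - F) = D ** E - D ** (F :: complex^'m^'n)"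
  and mat_diff_rdistrib: "(A - B) ** C = A ** C - B ** (C :: complex^'m^'n)"
  and mat_minus_left: "(- A) ** C = - (A ** (C :: complex^'m^'n))"
  and mat_minus_right: "D ** (- E) = - (D ** (E :: complex^'m^'n))"
  and mat_scaleR_right: "D ** (r *\<^sub>R E) = r *\<^sub>R (D ** (E :: complex^'m^'n))"
  and mat_scaleR_left: "(r *\<^sub>R A) ** C = r *\<^sub>R (A ** (C :: complex^'m^'n))"
  and mat_zero_left: "0 ** C = (0 :: complex^'m^'p)"
  by (simp_all add: vec_eq_iff matrix_matrix_mult_def sum.distrib sum_subtractf sum_negf scaleR_sum_right algebra_simps)

lemma mat_vec_minus_left: "(- A) *v u = - (A *v (u :: complex^'m))"
  by (simp add: vec_eq_iff matrix_vector_mult_def sum_negf)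

lemma mat_vec_scaleR_right: "A *v (r *\<^sub>R u) = r *\<^sub>R (A *v (u :: complex^'m))"
  by (simp add: vec_eq_iff matrix_vector_mult_def scaleR_sum_right)

lemma mat_vec_scaleR_left: "(r *\<^sub>R A) *v u = r *\<^sub>R (A *v (u :: complex^'m))"
  by (simp add: vec_eq_iff matrix_vector_mult_def scaleR_sum_right)

lemma has_integral_Re:
  "(f has_integral I) S \<Longrightarrow> ((\<lambda>x. Re (f x)) has_integral Re I) S"
  using has_integral_linear[OF _ bounded_linear_Re, of f I S] by (simp add: o_def)

primrec matpow :: "complex^'m^'m \<Rightarrow> nat \<Rightarrow> complex^'m^'m" where
  "matpow X 0 = mat 1"
| "matpow X (Suc n) = X ** matpow X n"

lemma matpow_commute: "matpow X n ** X = X ** matpow X n"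
  by (induction n) (simp_all add: matrix_mul_assoc[symmetric])

section \<open>Integrals over one period of the circle\<close>

lemma has_vector_derivative_cis:
  "((\<lambda>\<theta>. cis (c * \<theta>)) has_vector_derivative \<i> * of_real c * cis (c * \<theta>)) (at \<theta> within S)"
proof -
  have "((\<lambda>z. exp (\<i> * of_real c * z)) has_field_derivative \<i> * of_real c * exp (\<i> * of_real c * of_real \<theta>)) (at (of_real \<theta>))"
    by (auto intro!: derivative_eq_intros)
  from has_vector_derivative_real_field[OF this, of S] show ?thesis
    unfolding cis_conv_exp by (simp add: mult.assoc)
qed

lemma has_integral_cis:
  "((\<lambda>\<theta>. cis (of_int k * \<theta>)) has_integral (if k = 0 then 2 * of_real pi else 0)) circle_range"
proof (cases "k = 0")
  case True
  then show ?thesis using has_integral_const_real[of "1::complex" 0 "2 * pi"] by (simp add: scaleR_conv_of_real)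
next
  case False
  have "((\<lambda>\<theta>. cis (of_int k * \<theta>) / (\<i> * of_int k)) has_vector_derivative cis (of_int k * \<theta>)) (at \<theta> within {0..2 * pi})" for \<theta>
    using has_vector_derivative_divide[OF has_vector_derivative_cis[of "of_int k" \<theta> "{0..2 * pi}"], of "\<i> * of_int k"] False by simp
  then have "((\<lambda>\<theta>. cis (of_int k * \<theta>)) has_integral
      (cis (of_int k * (2 * pi)) / (\<i> * of_int k) - cis (of_int k * 0) / (\<i> * of_int k))) {0..2 * pi}"
    by (intro fundamental_theorem_of_calculus) auto
  moreover have "cis (of_int k * (2 * pi)) = 1" using cis_multiple_2pi[of "of_int k"] by (simp add: mult.commute mult.left_commute)
  ultimately show ?thesis using False by simp
qed

definition C1_functions :: "(real \<Rightarrow> complex) set" where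
  "C1_functions = {f. \<exists>f'. continuous_on UNIV f' \<and> (\<forall>x. (f has_vector_derivative f' x) (at x))}"

lemma C1_continuous: "f \<in> C1_functions \<Longrightarrow> continuous_on S f"
  unfolding C1_functions_def
  by (blast intro: continuous_at_imp_continuous_on has_vector_derivative_continuous)

lemma C1_subring: "function_subring C1_functions"
  unfolding function_subring_def
proof (intro conjI allI ballI)
  show "(\<lambda>_. c) \<in> C1_functions" for c
    unfolding C1_functions_def by (auto intro!: exI[of _ "\<lambda>_. 0"])
  fix f g assume fg: "f \<in> C1_functions" "g \<in> C1_functions"
  then obtain f' g' where *: "continuous_on UNIV f'" "\<And>x. (f has_vector_derivative f' x) (at x)"
    "continuous_on UNIV g'" "\<And>x. (g has_vector_derivative g' x) (at x)"
    unfolding C1_functions_def by blast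
  show "(\<lambda>x. f x + g x) \<in> C1_functions"
    unfolding C1_functions_def using *
    by (auto intro!: exI[of _ "\<lambda>x. f' x + g' x"] continuous_on_add has_vector_derivative_add)
  show "(\<lambda>x. f x * g x) \<in> C1_functions"
    unfolding C1_functions_def using * C1_continuous[OF fg(1), of UNIV] C1_continuous[OF fg(2), of UNIV]
    by (auto intro!: exI[of _ "\<lambda>x. f x * g' x + f' x * g x"] continuous_on_add continuous_on_mult has_vector_derivative_mult)
qed

lemma C1_inverse:
  assumes "f \<in> C1_functions" "\<And>x. f x \<noteq> 0"
  shows "(\<lambda>x. inverse (f x)) \<in> C1_functions"
proof -
  obtain f' where *: "continuous_on UNIV f'" "\<And>x. (f has_vector_derivative f' x) (at x)"
    using assms(1) unfolding C1_functions_def by blast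
  have "((\<lambda>x. inverse (f x)) has_vector_derivative - (inverse (f x) * f' x * inverse (f x))) (at x)" for x
    using Deriv.has_derivative_inverse[OF assms(2) *(2)[unfolded has_vector_derivative_def]]
    by (simp add: has_vector_derivative_def)
  moreover have "continuous_on UNIV (\<lambda>x. - (inverse (f x) * f' x * inverse (f x)))"
    using C1_continuous[OF assms(1), of UNIV] *(1) assms(2) by (intro continuous_intros) auto
  ultimately show ?thesis unfolding C1_functions_def by blast
qed

lemma C1_cis: "(\<lambda>\<theta>. cis (c * \<theta>)) \<in> C1_functions"
proof -
  have "continuous_on UNIV (\<lambda>\<theta>. \<i> * of_real c * cis (c * \<theta>))"
    by (intro continuous_intros)
  then show ?thesis unfolding C1_functions_def using has_vector_derivative_cis[of c _ UNIV] by blast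
qed

text \<open>One integration by parts bounds the coefficient by a constant over \<open>n\<close>; the
  boundary terms cancel because \<open>f\<close> takes equal values at the ends of the
  period.\<close>

lemma fourier_coefficient_decay:
  assumes f: "f \<in> C1_functions" and per: "f (2 * pi) = f 0"
  shows "(\<lambda>n. integral circle_range (\<lambda>\<theta>. cis (- of_int (int n) * \<theta>) * f \<theta>)) \<longlonglongrightarrow> 0"
proof -
  obtain f' where f': "continuous_on UNIV f'" "\<And>x. (f has_vector_derivative f' x) (at x)"
    using f unfolding C1_functions_def by blast
  have "compact (f' ` circle_range)"
    by (intro compact_continuous_image continuous_on_subset[OF f'(1)]) auto
  then obtain B where B: "\<And>\<theta>. \<theta> \<in> circle_range \<Longrightarrow> norm (f' \<theta>) \<le> B"
    by (meson bounded_iff compact_imp_bounded image_eqI)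
  have bound: "norm (integral circle_range (\<lambda>\<theta>. cis (- of_int (int n) * \<theta>) * f \<theta>)) \<le> B * (2 * pi) / real n"
    if n: "n > 0" for n
  proof -
    let ?e = "\<lambda>\<theta>. cis (- of_int (int n) * \<theta>)"
    have de: "(?e has_vector_derivative - \<i> * of_nat n * ?e \<theta>) (at \<theta>)" for \<theta>
      using has_vector_derivative_cis[of "- of_int (int n)" \<theta> UNIV] by simp
    have cont: "continuous_on circle_range f" "continuous_on circle_range f'" "continuous_on circle_range ?e"
      using C1_continuous[OF f] continuous_on_subset[OF f'(1)] by (auto intro!: continuous_intros)
    have "((\<lambda>\<theta>. ?e \<theta> * f' \<theta> + - \<i> * of_nat n * ?e \<theta> * f \<theta>) has_integral (?e (2 * pi) * f (2 * pi) - ?e 0 * f 0)) {0..2 * pi}"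
      by (rule fundamental_theorem_of_calculus)
         (simp, rule has_vector_derivative_at_within[OF has_vector_derivative_mult[OF de f'(2)]])
    moreover have "?e (2 * pi) = 1"
      using cis_multiple_2pi[of "- of_int (int n)"] by (simp add: mult.commute mult.left_commute)
    ultimately have "((\<lambda>\<theta>. ?e \<theta> * f' \<theta> + - \<i> * of_nat n * (?e \<theta> * f \<theta>)) has_integral 0) circle_range"
      using per by (simp add: mult.assoc)
    then have "integral circle_range (\<lambda>\<theta>. ?e \<theta> * f' \<theta> + - \<i> * of_nat n * (?e \<theta> * f \<theta>)) = 0"
      by (rule integral_unique)
    moreover have "integral circle_range (\<lambda>\<theta>. ?e \<theta> * f' \<theta> + - \<i> * of_nat n * (?e \<theta> * f \<theta>)) =
      integral circle_range (\<lambda>\<theta>. ?e \<theta> * f' \<theta>) + - \<i> * of_nat n * integral circle_range (\<lambda>\<theta>. ?e \<theta> * f \<theta>)"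
      unfolding integral_mult_right[symmetric]
      by (intro Henstock_Kurzweil_Integration.integral_add integrable_continuous continuous_intros cont)
    ultimately have "integral circle_range (\<lambda>\<theta>. ?e \<theta> * f' \<theta>) = \<i> * of_nat n * integral circle_range (\<lambda>\<theta>. ?e \<theta> * f \<theta>)"
      by simp
    then have "real n * norm (integral circle_range (\<lambda>\<theta>. ?e \<theta> * f \<theta>)) = norm (integral circle_range (\<lambda>\<theta>. ?e \<theta> * f' \<theta>))"
      by (simp add: norm_mult)
    also have "\<dots> \<le> B * (2 * pi - 0)"
      using B by (intro integral_bound[of 0 "2 * pi", unfolded cbox_interval[symmetric]] continuous_intros cont)
        (auto simp: norm_mult)
    finally show ?thesis using n by (simp add: field_simps)
  qed
  have "(\<lambda>n. B * (2 * pi) / real n) \<longlonglongrightarrow> 0"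
    by (rule lim_const_over_n)
  then show ?thesis
    by (rule Lim_null_comparison[rotated]) (rule eventually_mono[OF eventually_gt_at_top[of 0]], rule bound)
qed

section \<open>Smooth dependence of period integrals on parameters\<close>

text \<open>Linearity of \<open>L\<close> is over the reals, so conjugates of parameters are
  generators too. The class is built to contain its directional derivatives, which is the form of
  smoothness that \<open>smooth_fun_on\<close> asks for, and to consist of functions that continue
  holomorphically along real lines.\<close>

inductive_set param_class :: "'a::euclidean_space set \<Rightarrow> ('a \<times> real \<Rightarrow> complex) set" for U where
  angle: "continuous_on UNIV a \<Longrightarrow> (\<lambda>p. a (snd p)) \<in> param_class U"
| lin: "bounded_linear L \<Longrightarrow> (\<lambda>p. L (fst p)) \<in> param_class U"
| add: "r \<in> param_class U \<Longrightarrow> r' \<in> param_class U \<Longrightarrow> (\<lambda>p. r p + r' p) \<in> param_class U"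
| mult: "r \<in> param_class U \<Longrightarrow> r' \<in> param_class U \<Longrightarrow> (\<lambda>p. r p * r' p) \<in> param_class U"
| inverse: "r \<in> param_class U \<Longrightarrow> (\<And>x \<theta>. x \<in> U \<Longrightarrow> \<theta> \<in> circle_range \<Longrightarrow> r (x, \<theta>) \<noteq> 0) \<Longrightarrow>
    (\<lambda>p. inverse (r p)) \<in> param_class U"

text \<open>Inverses occur because the solvent contains the inverse of the zeroth moment, conjugates
  because real inner products enter the Gram matrix.\<close>

inductive_set period_class :: "'a::euclidean_space set \<Rightarrow> ('a \<Rightarrow> complex) set" for U where
  int: "r \<in> param_class U \<Longrightarrow> (\<lambda>x. integral circle_range (\<lambda>\<theta>. r (x, \<theta>))) \<in> period_class U"
| add: "g \<in> period_class U \<Longrightarrow> g' \<in> period_class U \<Longrightarrow> (\<lambda>x. g x + g' x) \<in> period_class U"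
| mult: "g \<in> period_class U \<Longrightarrow> g' \<in> period_class U \<Longrightarrow> (\<lambda>x. g x * g' x) \<in> period_class U"
| inverse: "g \<in> period_class U \<Longrightarrow> (\<And>x. x \<in> U \<Longrightarrow> g x \<noteq> 0) \<Longrightarrow> (\<lambda>x. inverse (g x)) \<in> period_class U"
| cnj: "g \<in> period_class U \<Longrightarrow> (\<lambda>x. cnj (g x)) \<in> period_class U"

lemma param_class_const: "(\<lambda>p. c) \<in> param_class U"
  using param_class.angle[of "\<lambda>_. c" U] by simp

lemma period_class_const: "(\<lambda>x. c) \<in> period_class U"
  using period_class.int[OF param_class_const[of "c / (2 * pi)" U]] by (simp add: scaleR_conv_of_real)

text \<open>Joint continuity in parameter and angle is carried along for differentiation under the
  integral. Since each \<open>r' v\<close> stays in the class, the derivatives are jointly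
  continuous as well.\<close>

lemma param_class_deriv:
  assumes "open U" "r \<in> param_class U"
  shows "continuous_on (U \<times> circle_range) r \<and>
    (\<exists>r'. (\<forall>v. r' v \<in> param_class U) \<and> (\<forall>x\<in>U. \<forall>\<theta>\<in>circle_range.
       ((\<lambda>x. r (x, \<theta>)) has_derivative (\<lambda>v. r' v (x, \<theta>))) (at x)))"
  using assms(2)
proof (induction rule: param_class.induct)
  case (angle a)
  have "continuous_on (U \<times> circle_range) (\<lambda>p. a (snd p))"
    by (rule continuous_on_compose2[OF angle]) (auto intro: continuous_intros)
  then show ?case
    using param_class_const[of 0 U] by (intro conjI exI[of _ "\<lambda>v p. 0"]) auto
next
  case (lin L)
  have "continuous_on (U \<times> circle_range) (\<lambda>p. L (fst p))"
    by (intro bounded_linear.continuous_on[OF lin] continuous_intros)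
  moreover have "((\<lambda>x. L x) has_derivative (\<lambda>v. L v)) (at x)" for x
    using lin by (rule bounded_linear_imp_has_derivative)
  ultimately show ?case
    using param_class_const[of _ U] by (intro conjI exI[of _ "\<lambda>v p. L v"]) auto
next
  case (add r s)
  then obtain r' s' where rs: "\<And>v. r' v \<in> param_class U" "\<And>v. s' v \<in> param_class U"
    "\<And>x \<theta>. x \<in> U \<Longrightarrow> \<theta> \<in> circle_range \<Longrightarrow> ((\<lambda>x. r (x, \<theta>)) has_derivative (\<lambda>v. r' v (x, \<theta>))) (at x)"
    "\<And>x \<theta>. x \<in> U \<Longrightarrow> \<theta> \<in> circle_range \<Longrightarrow> ((\<lambda>x. s (x, \<theta>)) has_derivative (\<lambda>v. s' v (x, \<theta>))) (at x)"
    by blast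
  show ?case
    by (intro conjI exI[of _ "\<lambda>v p. r' v p + s' v p"] allI ballI param_class.add rs has_derivative_add
        continuous_intros conjunct1[OF add.IH(1)] conjunct1[OF add.IH(2)])
next
  case (mult r s)
  then obtain r' s' where rs: "\<And>v. r' v \<in> param_class U" "\<And>v. s' v \<in> param_class U"
    "\<And>x \<theta>. x \<in> U \<Longrightarrow> \<theta> \<in> circle_range \<Longrightarrow> ((\<lambda>x. r (x, \<theta>)) has_derivative (\<lambda>v. r' v (x, \<theta>))) (at x)"
    "\<And>x \<theta>. x \<in> U \<Longrightarrow> \<theta> \<in> circle_range \<Longrightarrow> ((\<lambda>x. s (x, \<theta>)) has_derivative (\<lambda>v. s' v (x, \<theta>))) (at x)"
    by blast
  show ?case
    by (intro conjI exI[of _ "\<lambda>v p. r p * s' v p + r' v p * s p"] allI ballI param_class.add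
        param_class.mult mult.hyps rs has_derivative_mult
        continuous_intros conjunct1[OF mult.IH(1)] conjunct1[OF mult.IH(2)])
next
  case (inverse r)
  then obtain r' where r: "\<And>v. r' v \<in> param_class U"
    "\<And>x \<theta>. x \<in> U \<Longrightarrow> \<theta> \<in> circle_range \<Longrightarrow> ((\<lambda>x. r (x, \<theta>)) has_derivative (\<lambda>v. r' v (x, \<theta>))) (at x)"
    by blast
  have "continuous_on (U \<times> circle_range) (\<lambda>p. inverse (r p))"
    using inverse.IH inverse.hyps(2) by (intro continuous_on_inverse) auto
  moreover have "((\<lambda>x. inverse (r (x, \<theta>))) has_derivative
      (\<lambda>v. - 1 * (inverse (r (x, \<theta>)) * r' v (x, \<theta>) * inverse (r (x, \<theta>))))) (at x)"
    if "x \<in> U" "\<theta> \<in> circle_range" for x \<theta>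
    using Deriv.has_derivative_inverse[where f = "\<lambda>x. r (x, \<theta>)", OF inverse.hyps(2)[OF that] r(2)[OF that]] by simp
  moreover have "(\<lambda>p. - 1 * (inverse (r p) * r' v p * inverse (r p))) \<in> param_class U" for v
    by (intro param_class.mult param_class_const param_class.inverse[OF inverse.hyps] r(1))
  ultimately show ?case
    by (intro conjI exI[of _ "\<lambda>v p. - 1 * (inverse (r p) * r' v p * inverse (r p))"]) auto
qed

lemma integrable_slice:
  fixes r :: "'a::topological_space \<times> real \<Rightarrow> complex"
  assumes "continuous_on (U \<times> circle_range) r" "x \<in> U"
  shows "(\<lambda>\<theta>. r (x, \<theta>)) integrable_on circle_range"
  by (intro integrable_continuous continuous_on_compose2[OF assms(1)] continuous_intros)
     (use assms(2) in auto)

lemma period_class_deriv: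
  assumes U: "open U" "convex U" and "g \<in> period_class U"
  shows "\<exists>g'. (\<forall>v. g' v \<in> period_class U) \<and> (\<forall>x\<in>U. (g has_derivative (\<lambda>v. g' v x)) (at x))"
  using assms(3)
proof (induction rule: period_class.induct)
  case (int r)
  from param_class_deriv[OF U(1) int] obtain r' where
    cr: "continuous_on (U \<times> circle_range) r" and r: "\<And>v. r' v \<in> param_class U"
    "\<And>x \<theta>. x \<in> U \<Longrightarrow> \<theta> \<in> circle_range \<Longrightarrow> ((\<lambda>x. r (x, \<theta>)) has_derivative (\<lambda>v. r' v (x, \<theta>))) (at x)"
    by blast
  \<comment> \<open>The Leibniz rule wants the derivative as an operator depending continuously on
    parameter and angle. In finite dimension this continuity can be tested on basis vectors, where
    it is that of \<open>r' i\<close>.\<close>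
  define B where "B x \<theta> = Blinfun (\<lambda>v. r' v (x, \<theta>))" for x \<theta>
  have B: "blinfun_apply (B x \<theta>) = (\<lambda>v. r' v (x, \<theta>))" if "x \<in> U" "\<theta> \<in> circle_range" for x \<theta>
    unfolding B_def using r(2)[OF that] by (intro bounded_linear_Blinfun_apply has_derivative_bounded_linear)
  have cB: "continuous_on (U \<times> circle_range) (\<lambda>(x, \<theta>). B x \<theta>)"
  proof (rule continuous_on_blinfun_componentwise)
    fix i :: 'a assume "i \<in> Basis"
    have "continuous_on (U \<times> circle_range) (r' i)"
      using param_class_deriv[OF U(1) r(1)] by blast
    then show "continuous_on (U \<times> circle_range) (\<lambda>p. blinfun_apply (case p of (x, \<theta>) \<Rightarrow> B x \<theta>) i)"
      by (rule continuous_on_eq) (auto simp: B)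
  qed
  have "((\<lambda>x. integral circle_range (\<lambda>\<theta>. r (x, \<theta>))) has_derivative
      (\<lambda>v. integral circle_range (\<lambda>\<theta>. r' v (x, \<theta>)))) (at x)" if x: "x \<in> U" for x
  proof -
    have *: "((\<lambda>x. integral circle_range (\<lambda>\<theta>. r (x, \<theta>))) has_derivative
        blinfun_apply (integral circle_range (B x))) (at x within U)"
    proof (rule leibniz_rule[OF _ _ cB x U(2)])
      show "((\<lambda>x. r (x, t)) has_derivative blinfun_apply (B x t)) (at x within U)"
        if "x \<in> U" "t \<in> circle_range" for x t
        unfolding B[OF that] by (rule has_derivative_at_withinI[OF r(2)[OF that]])
    qed (rule integrable_slice[OF cr])
    have "blinfun_apply (integral circle_range (B x)) v = integral circle_range (\<lambda>\<theta>. r' v (x, \<theta>))" for v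
    proof -
      have "continuous_on circle_range (B x)"
      proof -
        have "continuous_on circle_range (\<lambda>\<theta>. case (x, \<theta>) of (x, \<theta>) \<Rightarrow> B x \<theta>)"
          by (rule continuous_on_compose2[OF cB]) (use x in \<open>auto intro!: continuous_intros\<close>)
        then show ?thesis by simp
      qed
      then have "blinfun_apply (integral circle_range (B x)) v = integral circle_range (\<lambda>\<theta>. B x \<theta> v)"
        by (intro blinfun_apply_integral integrable_continuous)
      also have "\<dots> = integral circle_range (\<lambda>\<theta>. r' v (x, \<theta>))"
        by (intro integral_cong) (simp add: B[OF x])
      finally show ?thesis .
    qed
    then have "blinfun_apply (integral circle_range (B x)) = (\<lambda>v. integral circle_range (\<lambda>\<theta>. r' v (x, \<theta>)))"
      by (rule ext)
    then show ?thesis using * at_within_open[OF x U(1)] by metis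
  qed
  then show ?case
    using period_class.int[OF r(1)]
    by (intro exI[of _ "\<lambda>v x. integral circle_range (\<lambda>\<theta>. r' v (x, \<theta>))"]) blast
next
  case (add g h)
  then obtain g' h' where gh: "\<And>v. g' v \<in> period_class U" "\<And>v. h' v \<in> period_class U"
    "\<And>x. x \<in> U \<Longrightarrow> (g has_derivative (\<lambda>v. g' v x)) (at x)"
    "\<And>x. x \<in> U \<Longrightarrow> (h has_derivative (\<lambda>v. h' v x)) (at x)"
    by blast
  show ?case
    by (intro exI[of _ "\<lambda>v x. g' v x + h' v x"] conjI allI ballI period_class.add gh has_derivative_add)
next
  case (mult g h)
  then obtain g' h' where gh: "\<And>v. g' v \<in> period_class U" "\<And>v. h' v \<in> period_class U"
    "\<And>x. x \<in> U \<Longrightarrow> (g has_derivative (\<lambda>v. g' v x)) (at x)"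
    "\<And>x. x \<in> U \<Longrightarrow> (h has_derivative (\<lambda>v. h' v x)) (at x)"
    by blast
  show ?case
    by (intro exI[of _ "\<lambda>v x. g x * h' v x + g' v x * h x"] conjI allI ballI period_class.add
        period_class.mult mult.hyps gh has_derivative_mult)
next
  case (inverse g)
  then obtain g' where g: "\<And>v. g' v \<in> period_class U"
    "\<And>x. x \<in> U \<Longrightarrow> (g has_derivative (\<lambda>v. g' v x)) (at x)"
    by blast
  have "((\<lambda>x. inverse (g x)) has_derivative
      (\<lambda>v. - 1 * (inverse (g x) * g' v x * inverse (g x)))) (at x)" if "x \<in> U" for x
    using Deriv.has_derivative_inverse[where f = g, OF inverse.hyps(2)[OF that] g(2)[OF that]] by simp
  moreover have "(\<lambda>x. - 1 * (inverse (g x) * g' v x * inverse (g x))) \<in> period_class U" for v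
    by (intro period_class.mult period_class_const period_class.inverse[OF inverse.hyps] g(1))
  ultimately show ?case
    by (intro exI[of _ "\<lambda>v x. - 1 * (inverse (g x) * g' v x * inverse (g x))"]) auto
next
  case (cnj g)
  then obtain g' where g: "\<And>v. g' v \<in> period_class U"
    "\<And>x. x \<in> U \<Longrightarrow> (g has_derivative (\<lambda>v. g' v x)) (at x)"
    by blast
  show ?case
    by (intro exI[of _ "\<lambda>v x. cnj (g' v x)"] conjI allI ballI period_class.cnj g has_derivative_cnj)
qed

lemma period_class_linear:
  assumes "bounded_linear L"
  shows "L \<in> period_class U"
proof -
  have "(\<lambda>x. integral circle_range (\<lambda>\<theta>. inverse (2 * pi) * L (fst (x, \<theta>)))) \<in> period_class U"
    by (intro period_class.int param_class.mult param_class_const param_class.lin assms)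
  moreover have "integral circle_range (\<lambda>\<theta>. inverse (2 * pi) * L (fst (x, \<theta>))) = L x" for x
    by (simp add: scaleR_conv_of_real)
  ultimately show ?thesis by simp
qed

text \<open>The real parts of all members of the class form a single family that is closed under
  directional derivatives.\<close>

lemma period_class_smooth:
  assumes "open U" "convex U" "g \<in> period_class U"
  shows "smooth_fun_on U (\<lambda>x. Re (g x))"
  unfolding smooth_fun_on_def
proof (intro exI[of _ "(\<lambda>g x. Re (g x)) ` period_class U"] conjI ballI)
  fix h assume "h \<in> (\<lambda>g x. Re (g x)) ` period_class U"
  then obtain g where g: "g \<in> period_class U" "h = (\<lambda>x. Re (g x))" by blast
  obtain g' where "\<And>v. g' v \<in> period_class U" "\<And>x. x \<in> U \<Longrightarrow> (g has_derivative (\<lambda>v. g' v x)) (at x)"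
    using period_class_deriv[OF assms(1,2) g(1)] by blast
  then show "\<exists>h'. (\<forall>v. h' v \<in> (\<lambda>g x. Re (g x)) ` period_class U) \<and>
      (\<forall>x\<in>U. (h has_derivative (\<lambda>v. h' v x)) (at x))"
    unfolding g(2) by (intro exI[of _ "\<lambda>v x. Re (g' v x)"]) (auto intro: has_derivative_Re)
qed (use assms(3) in blast)

lemma smooth_fun_on_compose_linear:
  fixes L :: "'a::euclidean_space \<Rightarrow> 'b::euclidean_space"
  assumes "smooth_fun_on U f" "bounded_linear L" "\<And>x. x \<in> V \<Longrightarrow> L x \<in> U"
  shows "smooth_fun_on V (\<lambda>x. f (L x))"
proof -
  obtain F where F: "f \<in> F" "\<And>g. g \<in> F \<Longrightarrow> \<exists>g'. (\<forall>v. g' v \<in> F) \<and>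
      (\<forall>x\<in>U. (g has_derivative (\<lambda>v. g' v x)) (at x))"
    using assms(1) unfolding smooth_fun_on_def by blast
  show ?thesis
    unfolding smooth_fun_on_def
  proof (intro exI[of _ "(\<lambda>g x. g (L x)) ` F"] conjI ballI)
    fix h assume "h \<in> (\<lambda>g x. g (L x)) ` F"
    then obtain g where g: "g \<in> F" "h = (\<lambda>x. g (L x))" by blast
    obtain g' where g': "\<And>v. g' v \<in> F" "\<And>x. x \<in> U \<Longrightarrow> (g has_derivative (\<lambda>v. g' v x)) (at x)"
      using F(2)[OF g(1)] by blast
    have "((\<lambda>x. g (L x)) has_derivative (\<lambda>v. g' (L v) (L x))) (at x)" if "x \<in> V" for x
      using has_derivative_compose[OF bounded_linear_imp_has_derivative[OF assms(2)] g'(2)[OF assms(3)[OF that]]] .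
    then show "\<exists>h'. (\<forall>v. h' v \<in> (\<lambda>g x. g (L x)) ` F) \<and>
        (\<forall>x\<in>V. (h has_derivative (\<lambda>v. h' v x)) (at x))"
      unfolding g(2) using g'(1) by (intro exI[of _ "\<lambda>v x. g' (L v) (L x)"]) auto
  qed (use F(1) in blast)
qed

text \<open>Restrictions to real lines extend holomorphically, locally uniformly in the angle; hence an
  identity principle on convex sets.\<close>

lemma param_class_line:
  assumes "r \<in> param_class U" "x \<in> U"
  shows "\<exists>\<eta>>0. \<exists>F F'. continuous_on (ball 0 \<eta> \<times> circle_range) F \<and>
    continuous_on (ball 0 \<eta> \<times> circle_range) F' \<and>
    (\<forall>s\<in>ball 0 \<eta>. \<forall>\<theta>\<in>circle_range. ((\<lambda>s. F (s, \<theta>)) has_field_derivative F' (s, \<theta>)) (at s)) \<and>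
    (\<forall>t. \<bar>t\<bar> < \<eta> \<longrightarrow> (\<forall>\<theta>\<in>circle_range. F (of_real t, \<theta>) = r (x + t *\<^sub>R d, \<theta>)))"
  (is "\<exists>\<eta>>0. \<exists>F F'. ?P r \<eta> F F'")
  using assms(1)
proof (induction rule: param_class.induct)
  case (angle a)
  have "continuous_on (ball (0::complex) 1 \<times> circle_range) (\<lambda>p. a (snd p))"
    by (rule continuous_on_compose2[OF angle]) (auto intro: continuous_intros)
  then show ?case
    by (intro exI[of _ "1::real"] conjI exI[of _ "\<lambda>p. a (snd p)"] exI[of _ "\<lambda>p. 0"]) auto
next
  case (lin L)
  \<comment> \<open>Although \<open>L\<close> is only real-linear, along the fixed direction
    \<open>d\<close> it is affine in \<open>t\<close> and so extends to complex \<open>s\<close> as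
    \<open>L x + s * L d\<close>.\<close>
  have "L (x + t *\<^sub>R d) = L x + t * L d" for t
    using bounded_linear.linear[OF lin] by (simp add: linear_add linear_cmul scaleR_conv_of_real)
  then show ?case
    by (intro exI[of _ "1::real"] conjI exI[of _ "\<lambda>p. L x + fst p * L d"] exI[of _ "\<lambda>p. L d"])
       (auto intro!: continuous_intros derivative_eq_intros)
next
  case (add r s)
  from add.IH(1) obtain \<eta>1 F F' where F: "\<eta>1 > 0" "?P r \<eta>1 F F'" by blast
  from add.IH(2) obtain \<eta>2 G G' where G: "\<eta>2 > 0" "?P s \<eta>2 G G'" by blast
  define \<eta> where "\<eta> = min \<eta>1 \<eta>2"
  have sub: "ball 0 \<eta> \<times> circle_range \<subseteq> ball (0::complex) \<eta>1 \<times> circle_range"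
    "ball 0 \<eta> \<times> circle_range \<subseteq> ball (0::complex) \<eta>2 \<times> circle_range"
    and \<eta>: "\<eta> > 0" "\<eta> \<le> \<eta>1" "\<eta> \<le> \<eta>2" using F(1) G(1) by (auto simp: \<eta>_def)
  have cont: "continuous_on (ball 0 \<eta> \<times> circle_range) F" "continuous_on (ball 0 \<eta> \<times> circle_range) F'"
    "continuous_on (ball 0 \<eta> \<times> circle_range) G" "continuous_on (ball 0 \<eta> \<times> circle_range) G'"
    using F(2) G(2) continuous_on_subset[OF _ sub(1)] continuous_on_subset[OF _ sub(2)] by blast+
  have deriv: "((\<lambda>s. F (s, \<theta>)) has_field_derivative F' (s, \<theta>)) (at s)"
    "((\<lambda>s. G (s, \<theta>)) has_field_derivative G' (s, \<theta>)) (at s)"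
    if "s \<in> ball 0 \<eta>" "\<theta> \<in> circle_range" for s \<theta>
    using F(2) G(2) that sub by blast+
  have eq: "F (of_real t, \<theta>) = r (x + t *\<^sub>R d, \<theta>)" "G (of_real t, \<theta>) = s (x + t *\<^sub>R d, \<theta>)"
    if "\<bar>t\<bar> < \<eta>" "\<theta> \<in> circle_range" for t \<theta>
    using F(2) G(2) that \<eta> by (meson less_le_trans)+
  have "?P (\<lambda>p. r p + s p) \<eta> (\<lambda>p. F p + G p) (\<lambda>p. F' p + G' p)"
  proof (intro conjI ballI allI impI)
    show "((\<lambda>s. F (s, \<theta>) + G (s, \<theta>)) has_field_derivative F' (s, \<theta>) + G' (s, \<theta>)) (at s)"
      if "s \<in> ball 0 \<eta>" "\<theta> \<in> circle_range" for s \<theta>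
      by (rule DERIV_add[OF deriv(1)[OF that] deriv(2)[OF that]])
    show "F (of_real t, \<theta>) + G (of_real t, \<theta>) = r (x + t *\<^sub>R d, \<theta>) + s (x + t *\<^sub>R d, \<theta>)"
      if "\<bar>t\<bar> < \<eta>" "\<theta> \<in> circle_range" for t \<theta>
      by (simp only: eq[OF that])
  qed (intro continuous_intros cont)+
  then show ?case using \<eta>(1) by blast
next
  case (mult r s)
  from mult.IH(1) obtain \<eta>1 F F' where F: "\<eta>1 > 0" "?P r \<eta>1 F F'" by blast
  from mult.IH(2) obtain \<eta>2 G G' where G: "\<eta>2 > 0" "?P s \<eta>2 G G'" by blast
  define \<eta> where "\<eta> = min \<eta>1 \<eta>2"
  have sub: "ball 0 \<eta> \<times> circle_range \<subseteq> ball (0::complex) \<eta>1 \<times> circle_range"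
    "ball 0 \<eta> \<times> circle_range \<subseteq> ball (0::complex) \<eta>2 \<times> circle_range"
    and \<eta>: "\<eta> > 0" "\<eta> \<le> \<eta>1" "\<eta> \<le> \<eta>2" using F(1) G(1) by (auto simp: \<eta>_def)
  have cont: "continuous_on (ball 0 \<eta> \<times> circle_range) F" "continuous_on (ball 0 \<eta> \<times> circle_range) F'"
    "continuous_on (ball 0 \<eta> \<times> circle_range) G" "continuous_on (ball 0 \<eta> \<times> circle_range) G'"
    using F(2) G(2) continuous_on_subset[OF _ sub(1)] continuous_on_subset[OF _ sub(2)] by blast+
  have deriv: "((\<lambda>s. F (s, \<theta>)) has_field_derivative F' (s, \<theta>)) (at s)"
    "((\<lambda>s. G (s, \<theta>)) has_field_derivative G' (s, \<theta>)) (at s)"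
    if "s \<in> ball 0 \<eta>" "\<theta> \<in> circle_range" for s \<theta>
    using F(2) G(2) that sub by blast+
  have eq: "F (of_real t, \<theta>) = r (x + t *\<^sub>R d, \<theta>)" "G (of_real t, \<theta>) = s (x + t *\<^sub>R d, \<theta>)"
    if "\<bar>t\<bar> < \<eta>" "\<theta> \<in> circle_range" for t \<theta>
    using F(2) G(2) that \<eta> by (meson less_le_trans)+
  have "?P (\<lambda>p. r p * s p) \<eta> (\<lambda>p. F p * G p) (\<lambda>p. F' p * G p + G' p * F p)"
  proof (intro conjI ballI allI impI)
    show "((\<lambda>s. F (s, \<theta>) * G (s, \<theta>)) has_field_derivative F' (s, \<theta>) * G (s, \<theta>) + G' (s, \<theta>) * F (s, \<theta>)) (at s)"
      if "s \<in> ball 0 \<eta>" "\<theta> \<in> circle_range" for s \<theta>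
      by (rule DERIV_mult[OF deriv(1)[OF that] deriv(2)[OF that]])
    show "F (of_real t, \<theta>) * G (of_real t, \<theta>) = r (x + t *\<^sub>R d, \<theta>) * s (x + t *\<^sub>R d, \<theta>)"
      if "\<bar>t\<bar> < \<eta>" "\<theta> \<in> circle_range" for t \<theta>
      by (simp only: eq[OF that])
  qed (intro continuous_intros cont)+
  then show ?case using \<eta>(1) by blast
next
  case (inverse r)
  then obtain \<eta> F F' where F: "\<eta> > 0" "?P r \<eta> F F'" by blast
  have F0: "F (0, \<theta>) \<noteq> 0" if "\<theta> \<in> circle_range" for \<theta>
    using F that inverse.hyps(2)[OF assms(2)] by (auto dest!: spec[of _ 0])
  define F\<^sub>s where "F\<^sub>s = (\<lambda>p. F (snd p, fst p))"
  have "continuous_on (circle_range \<times> ball 0 \<eta>) F\<^sub>s"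
    unfolding F\<^sub>s_def
  proof (rule continuous_on_compose2[where g = F and t = "ball 0 \<eta> \<times> circle_range"])
    show "continuous_on (ball 0 \<eta> \<times> circle_range) F" using F(2) by blast
  qed (auto intro!: continuous_intros)
  then have op: "openin (top_of_set (circle_range \<times> ball 0 \<eta>)) ((circle_range \<times> ball 0 \<eta>) \<inter> F\<^sub>s -` (- {0}))"
    by (intro continuous_openin_preimage_gen) auto
  \<comment> \<open>Tube lemma: \<open>F\<close> has no zeros at parameter 0 over the compact range
    of angles, so one neighbourhood of 0 serves all angles. \<open>F\<^sub>s\<close> merely swaps
    the factors into the order used there.\<close>
  obtain W where W: "openin (top_of_set (ball 0 \<eta>)) W" "(0::complex) \<in> W"
      "circle_range \<times> W \<subseteq> (circle_range \<times> ball 0 \<eta>) \<inter> F\<^sub>s -` (- {0})"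
  proof -
    have "(\<lambda>\<theta>. (\<theta>, 0)) ` circle_range \<subseteq> (circle_range \<times> ball 0 \<eta>) \<inter> F\<^sub>s -` (- {0})"
      using F0 F(1) by (auto simp: F\<^sub>s_def)
    moreover have "circle_range \<noteq> {}" by auto
    ultimately show ?thesis
      using tube_lemma[OF compact_cbox _ _ op] that by blast
  qed
  have "open W" using W(1) by (simp add: openin_open_eq)
  then obtain \<delta> where \<delta>: "\<delta> > 0" "ball 0 \<delta> \<subseteq> W" using W(2) openE by blast
  have nz: "F p \<noteq> 0" if "p \<in> ball 0 (min \<eta> \<delta>) \<times> circle_range" for p 
  proof -
    have "(snd p, fst p) \<in> circle_range \<times> W" using that \<delta>(2) by auto
    then have "(snd p, fst p) \<in> F\<^sub>s -` (- {0})" using W(3) by blast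
    then show ?thesis by (simp add: F\<^sub>s_def)
  qed
  have sub: "ball 0 (min \<eta> \<delta>) \<times> circle_range \<subseteq> ball (0::complex) \<eta> \<times> circle_range" by auto
  have cont: "continuous_on (ball 0 (min \<eta> \<delta>) \<times> circle_range) F"
    "continuous_on (ball 0 (min \<eta> \<delta>) \<times> circle_range) F'"
    using F(2) continuous_on_subset[OF _ sub] by blast+
  have deriv: "((\<lambda>s. F (s, \<theta>)) has_field_derivative F' (s, \<theta>)) (at s)"
    if "s \<in> ball 0 (min \<eta> \<delta>)" "\<theta> \<in> circle_range" for s \<theta>
    using F(2) that sub by blast
  have "?P (\<lambda>p. inverse (r p)) (min \<eta> \<delta>) (\<lambda>p. inverse (F p)) (\<lambda>p. - (inverse (F p) * F' p * inverse (F p)))"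
  proof (intro conjI ballI allI impI)
    show "((\<lambda>s. inverse (F (s, \<theta>))) has_field_derivative
        - (inverse (F (s, \<theta>)) * F' (s, \<theta>) * inverse (F (s, \<theta>)))) (at s)"
      if "s \<in> ball 0 (min \<eta> \<delta>)" "\<theta> \<in> circle_range" for s \<theta>
      by (rule DERIV_inverse'[OF deriv[OF that] nz]) (use that in blast)
    show "inverse (F (of_real t, \<theta>)) = inverse (r (x + t *\<^sub>R d, \<theta>))"
      if "\<bar>t\<bar> < min \<eta> \<delta>" "\<theta> \<in> circle_range" for t \<theta>
      using F(2) that by simp
  qed (intro continuous_intros cont ballI nz; assumption)+
  moreover have "min \<eta> \<delta> > 0" using F(1) \<delta>(1) by simp
  ultimately show ?case by blast
qed

text \<open>The continuation of the integrand and its complex derivative are jointly continuous, so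
  the integral may be differentiated in the complex variable; the other constructors act on the
  continuations directly.\<close>

lemma period_class_line:
  assumes "g \<in> period_class U" "x \<in> U"
  shows "\<exists>\<eta>>0. \<exists>F. F holomorphic_on ball 0 \<eta> \<and> (\<forall>t. \<bar>t\<bar> < \<eta> \<longrightarrow> F (of_real t) = g (x + t *\<^sub>R d))"
  (is "\<exists>\<eta>>0. \<exists>F. ?P g \<eta> F")
  using assms(1)
proof (induction rule: period_class.induct)
  case (int r)
  obtain \<eta> F F' where F: "\<eta> > 0" "continuous_on (ball 0 \<eta> \<times> circle_range) F"
    "continuous_on (ball 0 \<eta> \<times> circle_range) F'"
    "\<And>s \<theta>. s \<in> ball 0 \<eta> \<Longrightarrow> \<theta> \<in> circle_range \<Longrightarrow> ((\<lambda>s. F (s, \<theta>)) has_field_derivative F' (s, \<theta>)) (at s)"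
    "\<And>t \<theta>. \<bar>t\<bar> < \<eta> \<Longrightarrow> \<theta> \<in> circle_range \<Longrightarrow> F (of_real t, \<theta>) = r (x + t *\<^sub>R d, \<theta>)"
    using param_class_line[OF int assms(2), of d] by blast
  have "((\<lambda>s. integral circle_range (\<lambda>\<theta>. F (s, \<theta>))) has_field_derivative
      integral circle_range (\<lambda>\<theta>. F' (s, \<theta>))) (at s within ball 0 \<eta>)" if "s \<in> ball 0 \<eta>" for s
  proof (rule leibniz_rule_field_derivative[OF _ _ _ that])
    show "((\<lambda>s. F (s, \<theta>)) has_field_derivative F' (s, \<theta>)) (at s within ball 0 \<eta>)"
      if "s \<in> ball 0 \<eta>" "\<theta> \<in> circle_range" for s \<theta>
      using F(4)[OF that] by (rule has_field_derivative_at_within)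
    show "continuous_on (ball 0 \<eta> \<times> circle_range) (\<lambda>(s, \<theta>). F' (s, \<theta>))"
      using F(3) by simp
  qed (rule integrable_slice[OF F(2)] convex_ball | assumption)+
  then have "(\<lambda>s. integral circle_range (\<lambda>\<theta>. F (s, \<theta>))) holomorphic_on ball 0 \<eta>"
    unfolding holomorphic_on_def field_differentiable_def by blast
  moreover have "integral circle_range (\<lambda>\<theta>. F (of_real t, \<theta>)) =
      integral circle_range (\<lambda>\<theta>. r (x + t *\<^sub>R d, \<theta>))" if "\<bar>t\<bar> < \<eta>" for t
    using F(5)[OF that] by (rule integral_cong)
  ultimately show ?case using F(1) by blast
next
  case (add g h)
  then obtain \<eta>1 F \<eta>2 G where FG: "\<eta>1 > 0" "?P g \<eta>1 F" "\<eta>2 > 0" "?P h \<eta>2 G" by blast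
  have "ball 0 (min \<eta>1 \<eta>2) \<subseteq> ball (0::complex) \<eta>1" "ball 0 (min \<eta>1 \<eta>2) \<subseteq> ball (0::complex) \<eta>2" by auto
  then have "?P (\<lambda>p. g p + h p) (min \<eta>1 \<eta>2) (\<lambda>p. F p + G p)"
    using FG by (auto intro!: holomorphic_on_add intro: holomorphic_on_subset)
  then show ?case using FG by (meson min_less_iff_conj)
next
  case (mult g h)
  then obtain \<eta>1 F \<eta>2 G where FG: "\<eta>1 > 0" "?P g \<eta>1 F" "\<eta>2 > 0" "?P h \<eta>2 G" by blast
  have "ball 0 (min \<eta>1 \<eta>2) \<subseteq> ball (0::complex) \<eta>1" "ball 0 (min \<eta>1 \<eta>2) \<subseteq> ball (0::complex) \<eta>2" by auto
  then have "?P (\<lambda>p. g p * h p) (min \<eta>1 \<eta>2) (\<lambda>p. F p * G p)"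
    using FG by (auto intro!: holomorphic_on_mult intro: holomorphic_on_subset)
  then show ?case using FG by (meson min_less_iff_conj)
next
  case (inverse g)
  then obtain \<eta> F where F: "\<eta> > 0" "?P g \<eta> F" by blast
  have "F 0 \<noteq> 0" using F inverse.hyps(2)[OF assms(2)] by (auto dest!: spec[of _ 0])
  moreover have "continuous_on (ball 0 \<eta>) F" using F(2) by (blast intro: holomorphic_on_imp_continuous_on)
  ultimately obtain \<delta> where \<delta>: "\<delta> > 0" "\<And>s. s \<in> ball 0 \<eta> \<Longrightarrow> dist s 0 < \<delta> \<Longrightarrow> F s \<noteq> 0"
    using continuous_on_avoid[of "ball 0 \<eta>" F 0 0] F(1) by (auto simp: dist_commute)
  have "ball 0 (min \<eta> \<delta>) \<subseteq> ball (0::complex) \<eta>" by auto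
  then have "?P (\<lambda>p. inverse (g p)) (min \<eta> \<delta>) (\<lambda>p. inverse (F p))"
    using F \<delta> by (auto intro!: holomorphic_on_inverse intro: holomorphic_on_subset)
  then show ?case using F \<delta> by (meson min_less_iff_conj)
next
  case (cnj g)
  then obtain \<eta> F where F: "\<eta> > 0" "?P g \<eta> F" by blast
  have "cnj ` ball 0 \<eta> = ball (0::complex) \<eta>"
  proof
    show "ball 0 \<eta> \<subseteq> cnj ` ball (0::complex) \<eta>"
    proof
      fix z :: complex assume "z \<in> ball 0 \<eta>"
      then show "z \<in> cnj ` ball 0 \<eta>" by (intro image_eqI[of _ _ "cnj z"]) auto
    qed
  qed auto
  \<comment> \<open>Conjugating both argument and value preserves holomorphy, and on the real axis
    it conjugates the value only.\<close>
  then have "(cnj \<circ> F \<circ> cnj) holomorphic_on ball 0 \<eta>"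
    using F(2) by (intro holomorphic_on_compose_cnj_cnj) auto
  moreover have "(cnj \<circ> F \<circ> cnj) (of_real t) = cnj (g (x + t *\<^sub>R d))" if "\<bar>t\<bar> < \<eta>" for t
    using F(2) that by simp
  ultimately show ?case using F(1) by blast
qed

text \<open>An interval of zeros inside the disc of the holomorphic continuation contains an
  accumulation point of zeros, so the continuation vanishes on the whole disc and in particular near
  the base point.\<close>

lemma period_class_zero_germ:
  assumes g: "g \<in> period_class U" and x: "x \<in> U"
    and acc: "\<And>\<epsilon>. \<epsilon> > 0 \<Longrightarrow> \<exists>t. t \<noteq> 0 \<and> \<bar>t\<bar> < \<epsilon> \<and> (\<exists>\<delta>>0. \<forall>t'. \<bar>t' - t\<bar> < \<delta> \<longrightarrow> g (x + t' *\<^sub>R d) = 0)"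
  shows "\<exists>\<eta>>0. \<forall>t. \<bar>t\<bar> < \<eta> \<longrightarrow> g (x + t *\<^sub>R d) = 0"
proof -
  obtain \<eta> F where F: "\<eta> > 0" "F holomorphic_on ball 0 \<eta>"
    "\<And>t. \<bar>t\<bar> < \<eta> \<Longrightarrow> F (of_real t) = g (x + t *\<^sub>R d)"
    using period_class_line[OF g x, of d] by blast
  obtain t \<delta> where t: "\<bar>t\<bar> < \<eta>" "\<delta> > 0" "\<And>t'. \<bar>t' - t\<bar> < \<delta> \<Longrightarrow> g (x + t' *\<^sub>R d) = 0"
    using acc[OF F(1)] by blast
  define Z where "Z = {s \<in> ball 0 \<eta>. F s = 0}"
  have lim: "of_real t islimpt Z"
    unfolding islimpt_approachable
  proof (intro allI impI)
    fix e :: real assume e: "e > 0"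
    have "0 < min e (min \<delta> (\<eta> - \<bar>t\<bar>))" using e t by simp
    then obtain h where "0 < h" "h < min e (min \<delta> (\<eta> - \<bar>t\<bar>))" using dense by blast
    then have h: "h > 0" "h < e" "h < \<delta>" "\<bar>t\<bar> + h < \<eta>" by auto
    have "F (of_real (t + h)) = 0" using h t(3)[of "t + h"] by (subst F(3)) auto
    then have "of_real (t + h) \<in> Z" unfolding Z_def using h by (auto simp: norm_of_real simp del: of_real_add)
    moreover have "dist (of_real (t + h) :: complex) (of_real t) = h" using h by (simp add: dist_norm)
    ultimately show "\<exists>z\<in>Z. z \<noteq> of_real t \<and> dist z (of_real t) < e"
      using h by (intro bexI[of _ "of_real (t + h)"]) (auto simp del: of_real_add)
  qed
  have "F s = 0" if "s \<in> ball 0 \<eta>" for s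
  proof (rule analytic_continuation[OF F(2) open_ball connected_ball _ _ _ _ that])
    show "Z \<subseteq> ball 0 \<eta>" "\<And>z. z \<in> Z \<Longrightarrow> F z = 0" by (auto simp: Z_def)
    show "of_real t \<in> ball (0::complex) \<eta>" using t(1) by simp
  qed (rule lim)
  then have "F (of_real t) = 0" if "\<bar>t\<bar> < \<eta>" for t using that by simp
  then have "\<forall>t. \<bar>t\<bar> < \<eta> \<longrightarrow> g (x + t *\<^sub>R d) = 0" using F(3) by metis
  then show ?thesis using F(1) by blast
qed

text \<open>The set \<open>T\<close> of times near which \<open>g\<close> vanishes is open by
  definition and closed relative to the unit interval by \<open>period_class_zero_germ\<close>;
  connectedness carries the zeros from one end to the other.\<close>

lemma period_class_zero_on_segment:
  assumes g: "g \<in> period_class U" and seg: "closed_segment x y \<subseteq> U"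
    and zero: "\<eta>0 > 0" "\<And>t. \<bar>t\<bar> < \<eta>0 \<Longrightarrow> g (x + t *\<^sub>R (y - x)) = 0"
  shows "g y = 0"
proof -
  define p where "p t = x + t *\<^sub>R (y - x)" for t
  have pU: "p t \<in> U" if "t \<in> {0..1}" for t
    using seg that unfolding closed_segment_def p_def by (force simp: algebra_simps)
  have shift: "p (t + t') = p t + t' *\<^sub>R (y - x)" for t t' by (simp add: p_def algebra_simps)
  define T where "T = {t. \<exists>\<eta>>0. \<forall>t'. \<bar>t' - t\<bar> < \<eta> \<longrightarrow> g (p t') = 0}"
  have 0: "0 \<in> T" unfolding T_def using zero by (auto simp: p_def)
  have "open T"
    unfolding open_dist
  proof
    fix t assume "t \<in> T"
    then obtain \<eta> where \<eta>: "\<eta> > 0" "\<And>t'. \<bar>t' - t\<bar> < \<eta> \<Longrightarrow> g (p t') = 0" unfolding T_def by blast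
    have "s \<in> T" if "dist s t < \<eta> / 2" for s
    proof -
      have "g (p t') = 0" if "\<bar>t' - s\<bar> < \<eta> / 2" for t'
        using that \<open>dist s t < \<eta> / 2\<close> unfolding dist_real_def by (intro \<eta>(2)) linarith
      then show ?thesis unfolding T_def using \<eta>(1) half_gt_zero by blast
    qed
    then show "\<exists>e>0. \<forall>s. dist s t < e \<longrightarrow> s \<in> T" using \<eta>(1) by (meson half_gt_zero)
  qed
  moreover have "s \<in> T" if s: "s \<in> {0..1}" and lim: "s islimpt T" for s
  proof -
    have "\<exists>\<eta>>0. \<forall>t. \<bar>t\<bar> < \<eta> \<longrightarrow> g (p s + t *\<^sub>R (y - x)) = 0"
    proof (rule period_class_zero_germ[OF g pU[OF s]])
      fix \<epsilon> :: real assume "\<epsilon> > 0"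
      then obtain t where t: "t \<in> T" "t \<noteq> s" "\<bar>t - s\<bar> < \<epsilon>"
        using lim unfolding islimpt_approachable dist_real_def by blast
      then obtain \<delta> where \<delta>: "\<delta> > 0" "\<And>t'. \<bar>t' - t\<bar> < \<delta> \<Longrightarrow> g (p t') = 0" unfolding T_def by blast
      have "g (p s + t' *\<^sub>R (y - x)) = 0" if "\<bar>t' - (t - s)\<bar> < \<delta>" for t'
        using \<delta>(2)[of "s + t'"] that unfolding shift by (simp add: algebra_simps)
      then show "\<exists>t. t \<noteq> 0 \<and> \<bar>t\<bar> < \<epsilon> \<and> (\<exists>\<delta>>0. \<forall>t'. \<bar>t' - t\<bar> < \<delta> \<longrightarrow> g (p s + t' *\<^sub>R (y - x)) = 0)"
        using t \<delta>(1) by (intro exI[of _ "t - s"]) auto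
    qed
    then obtain \<eta> where "\<eta> > 0" "\<And>t. \<bar>t\<bar> < \<eta> \<Longrightarrow> g (p (s + t)) = 0" unfolding shift by blast
    then have "\<forall>t'. \<bar>t' - s\<bar> < \<eta> \<longrightarrow> g (p t') = 0" by (metis add.commute diff_add_cancel)
    then show ?thesis unfolding T_def using \<open>\<eta> > 0\<close> by blast
  qed
  then have "closedin (top_of_set {0..1}) ({0..1} \<inter> T)"
    unfolding closedin_limpt by (auto dest: islimpt_subset[of _ "{0..1} \<inter> T" T])
  moreover have "openin (top_of_set {0..1}) ({0..1} \<inter> T)" using \<open>open T\<close> by (rule openin_open_Int)
  ultimately have "{0..1} \<inter> T = {0..1}"
    using 0 connected_clopen[of "{0..1::real}"] by (metis IntI atLeastAtMost_iff connected_Icc empty_iff order_refl zero_le_one)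
  then have "{0..1} \<subseteq> T" by blast
  then have "1 \<in> T" by (rule subsetD) simp
  then obtain \<eta> where "\<eta> > 0" "\<And>t'. \<bar>t' - 1\<bar> < \<eta> \<Longrightarrow> g (p t') = 0" unfolding T_def by blast
  then have "g (p 1) = 0" by simp
  then show ?thesis by (simp add: p_def)
qed

section \<open>Spectral factorization of positive matrix symbols\<close>

definition symbol :: "complex^'m^'m \<Rightarrow> complex^'m^'m \<Rightarrow> real \<Rightarrow> complex^'m^'m" where
  "symbol P H \<theta> = (\<chi> i j. cis \<theta> * P $ i $ j + cis (- \<theta>) * cnj (P $ j $ i) + H $ i $ j)"

text \<open>These are the Fourier coefficients of the inverse symbol times \<open>2 * pi\<close>.
  The factor cancels in \<open>solvent\<close> and reappears in
  \<open>moment_recurrence\<close>.\<close>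

definition moment :: "complex^'m^'m \<Rightarrow> complex^'m^'m \<Rightarrow> int \<Rightarrow> complex^'m^'m" where
  "moment P H n = (\<chi> i j. integral circle_range
     (\<lambda>\<theta>. cis (- of_int n * \<theta>) * cramer_inverse (symbol P H \<theta>) $ i $ j))"

text \<open>A quotient of moments instead of a chosen root of the quadratic matrix equation: smooth
  dependence on the coefficients is then visible from the formula, and the selection of the stable
  root is already made.\<close>

definition solvent :: "complex^'m^'m \<Rightarrow> complex^'m^'m \<Rightarrow> complex^'m^'m" where
  "solvent P H = moment P H 1 ** cramer_inverse (moment P H 0)"

lemma symbol_mult:
  "symbol P H \<theta> *v u = cis \<theta> *s (P *v u) + cis (- \<theta>) *s (adj P *v u) + H *v u"
  by (simp add: symbol_def vec_eq_iff matrix_vector_mult_def adj_def algebra_simps sum.distrib sum_distrib_left)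

locale positive_symbol =
  fixes P H :: "complex^'m^'m"
  assumes H_adj: "adj H = H"
    and positive: "\<And>\<theta> u. u \<noteq> 0 \<Longrightarrow> 0 < (symbol P H \<theta> *v u) \<bullet> u"
begin

abbreviation "J \<theta> \<equiv> cramer_inverse (symbol P H \<theta>)"
abbreviation "g \<equiv> moment P H"

lemma symbol_invertible: "invertible (symbol P H \<theta>)"
proof (rule invertible_if_injective)
  fix u assume "symbol P H \<theta> *v u = 0"
  then show "u = 0" using positive[of u \<theta>] by force
qed

lemma symbol_adj: "adj (symbol P H \<theta>) = symbol P H \<theta>"
proof -
  have "cnj (H $ j $ i) = H $ i $ j" for i j
    using H_adj by (simp add: adj_def vec_eq_iff)
  then show ?thesis by (simp add: adj_def symbol_def vec_eq_iff cis_cnj)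
qed

lemma J_right: "symbol P H \<theta> ** J \<theta> = mat 1" and J_left: "J \<theta> ** symbol P H \<theta> = mat 1"
  using cramer_inverse[OF symbol_invertible] by auto

lemma J_adj: "adj (J \<theta>) = J \<theta>"
proof -
  have "symbol P H \<theta> ** adj (J \<theta>) = mat 1"
    using arg_cong[OF J_left[of \<theta>], of adj] by (simp add: adj_mult symbol_adj)
  then have "J \<theta> ** (symbol P H \<theta> ** adj (J \<theta>)) = J \<theta>" by simp
  then show ?thesis by (simp add: matrix_mul_assoc J_left)
qed

lemma symbol_C1: "(\<lambda>\<theta>. symbol P H \<theta> $ i $ j) \<in> C1_functions"
proof -
  have "(\<lambda>\<theta>. cis \<theta> * P $ i $ j + cis (- \<theta>) * cnj (P $ j $ i) + H $ i $ j) \<in> C1_functions"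
    using C1_cis[of 1] C1_cis[of "-1"]
    by (intro subring_add[OF C1_subring] subring_mult[OF C1_subring] subring_const[OF C1_subring]) simp_all
  then show ?thesis by (simp add: symbol_def)
qed

lemma J_C1: "(\<lambda>\<theta>. J \<theta> $ i $ j) \<in> C1_functions"
proof (rule subring_cramer_inverse[OF C1_subring symbol_C1 C1_inverse])
  show "(\<lambda>\<theta>. det (symbol P H \<theta>)) \<in> C1_functions"
    by (rule subring_det[OF C1_subring symbol_C1])
  show "det (symbol P H \<theta>) \<noteq> 0" for \<theta>
    using symbol_invertible invertible_det_nz by blast
qed

lemma J_integrable:
  assumes "continuous_on circle_range f"
  shows "(\<lambda>\<theta>. f \<theta> * J \<theta> $ i $ j) integrable_on circle_range"
  by (intro integrable_continuous continuous_on_mult assms C1_continuous[OF J_C1])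

lemma moment_has_integral:
  "((\<lambda>\<theta>. cis (- of_int n * \<theta>) * J \<theta> $ i $ j) has_integral g n $ i $ j) circle_range"
  unfolding moment_def vec_lambda_beta
  by (intro integrable_integral J_integrable continuous_intros)

lemma matrix_moment_has_integral:
  "((\<lambda>\<theta>. \<Sum>l\<in>UNIV. A $ i $ l * (cis (- of_int n * \<theta>) * J \<theta> $ l $ j)) has_integral (A ** g n) $ i $ j) circle_range"
proof -
  have "((\<lambda>\<theta>. A $ i $ l * (cis (- of_int n * \<theta>) * J \<theta> $ l $ j)) has_integral A $ i $ l * g n $ l $ j) circle_range" for l
    by (rule has_integral_mult_right[OF moment_has_integral])
  then have "((\<lambda>\<theta>. \<Sum>l\<in>UNIV. A $ i $ l * (cis (- of_int n * \<theta>) * J \<theta> $ l $ j)) has_integral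
      (\<Sum>l\<in>UNIV. A $ i $ l * g n $ l $ j)) circle_range"
    by (intro has_integral_sum) simp_all
  then show ?thesis unfolding matrix_matrix_mult_def by simp
qed

text \<open>Fourier coefficient \<open>n\<close> of the identity
  \<open>symbol P H \<theta> ** J \<theta> = mat 1\<close>; the factors \<open>cis \<theta>\<close>
  and \<open>cis (- \<theta>)\<close> in the symbol shift the index by one.\<close>

lemma moment_recurrence:
  "P ** g (n - 1) + H ** g n + adj P ** g (n + 1) = (if n = 0 then (2 * pi) *\<^sub>R mat 1 else 0)"
proof -
  have "((\<lambda>\<theta>. (\<Sum>l\<in>UNIV. P $ i $ l * (cis (- of_int (n - 1) * \<theta>) * J \<theta> $ l $ j)) +
      (\<Sum>l\<in>UNIV. H $ i $ l * (cis (- of_int n * \<theta>) * J \<theta> $ l $ j)) +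
      (\<Sum>l\<in>UNIV. adj P $ i $ l * (cis (- of_int (n + 1) * \<theta>) * J \<theta> $ l $ j))) has_integral
      (P ** g (n - 1) + H ** g n + adj P ** g (n + 1)) $ i $ j) circle_range" for i j
    unfolding vector_add_component by (intro has_integral_add matrix_moment_has_integral)
  moreover have "(\<Sum>l\<in>UNIV. P $ i $ l * (cis (- of_int (n - 1) * \<theta>) * J \<theta> $ l $ j)) +
      (\<Sum>l\<in>UNIV. H $ i $ l * (cis (- of_int n * \<theta>) * J \<theta> $ l $ j)) +
      (\<Sum>l\<in>UNIV. adj P $ i $ l * (cis (- of_int (n + 1) * \<theta>) * J \<theta> $ l $ j)) =
      (if i = j then cis (of_int (- n) * \<theta>) else 0)" for i j \<theta>
  proof -
    have c: "cis (- of_int (n - 1) * \<theta>) = cis (- of_int n * \<theta>) * cis \<theta>"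
      "cis (- of_int (n + 1) * \<theta>) = cis (- of_int n * \<theta>) * cis (- \<theta>)"
      by (simp_all add: cis_mult algebra_simps)
    have "(\<Sum>l\<in>UNIV. P $ i $ l * (cis (- of_int (n - 1) * \<theta>) * J \<theta> $ l $ j)) +
      (\<Sum>l\<in>UNIV. H $ i $ l * (cis (- of_int n * \<theta>) * J \<theta> $ l $ j)) +
      (\<Sum>l\<in>UNIV. adj P $ i $ l * (cis (- of_int (n + 1) * \<theta>) * J \<theta> $ l $ j)) =
      cis (- of_int n * \<theta>) * (symbol P H \<theta> ** J \<theta>) $ i $ j"
      unfolding c by (simp add: symbol_def matrix_matrix_mult_def adj_def sum_distrib_left
          sum.distrib[symmetric] algebra_simps)
    then show ?thesis by (simp add: J_right mat_def)
  qed
  ultimately have int: "((\<lambda>\<theta>. if i = j then cis (of_int (- n) * \<theta>) else 0) has_integral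
      (P ** g (n - 1) + H ** g n + adj P ** g (n + 1)) $ i $ j) circle_range" for i j
    by simp
  have "(P ** g (n - 1) + H ** g n + adj P ** g (n + 1)) $ i $ j =
      (if n = 0 then (2 * pi) *\<^sub>R mat 1 else 0 :: complex^'m^'m) $ i $ j" for i j
  proof (cases "i = j")
    case True
    then have "(P ** g (n - 1) + H ** g n + adj P ** g (n + 1)) $ i $ j = (if - n = 0 then 2 * of_real pi else 0)"
      using has_integral_unique[OF int[of i j]] has_integral_cis[of "- n"] by simp
    moreover have "((2 * pi) *\<^sub>R mat 1 :: complex^'m^'m) $ i $ j = 2 * of_real pi"
      unfolding vector_scaleR_component using True by (simp add: mat_def scaleR_conv_of_real)
    ultimately show ?thesis by simp
  next
    case False
    then have "(P ** g (n - 1) + H ** g n + adj P ** g (n + 1)) $ i $ j = 0"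
      using has_integral_unique[OF int[of i j]] by (simp add: has_integral_0)
    then show ?thesis using False by (simp add: mat_def)
  qed
  then show ?thesis by (simp add: vec_eq_iff)
qed

lemma moment_adj: "adj (g n) = g (- n)"
proof -
  have "((\<lambda>\<theta>. cnj (cis (- of_int n * \<theta>) * J \<theta> $ j $ i)) has_integral cnj (g n $ j $ i)) circle_range" for i j
    using moment_has_integral[of n j i] by (subst (asm) has_integral_cnj[symmetric]) (simp add: o_def)
  moreover have "cnj (cis (- of_int n * \<theta>) * J \<theta> $ j $ i) = cis (- of_int (- n) * \<theta>) * J \<theta> $ i $ j" for i j \<theta>
  proof -
    have "cnj (J \<theta> $ j $ i) = J \<theta> $ i $ j"
      using J_adj[of \<theta>] by (simp add: adj_def vec_eq_iff)
    then show ?thesis by (simp add: cis_cnj)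
  qed
  ultimately have *: "((\<lambda>\<theta>. cis (- of_int (- n) * \<theta>) * J \<theta> $ i $ j) has_integral cnj (g n $ j $ i)) circle_range" for i j
    by (simp only:)
  have "cnj (g n $ j $ i) = g (- n) $ i $ j" for i j
    by (rule has_integral_unique[OF * moment_has_integral])
  then show ?thesis by (simp add: adj_def vec_eq_iff)
qed

text \<open>An integral of positive matrices: on a kernel vector the form would be a continuous
  positive function with integral zero.\<close>

lemma moment_0_invertible: "invertible (g 0)"
proof (rule invertible_if_injective, rule ccontr)
  fix u assume u: "g 0 *v u = 0" "u \<noteq> 0"
  have int: "((\<lambda>\<theta>. \<Sum>i\<in>UNIV. \<Sum>j\<in>UNIV. cis (- of_int 0 * \<theta>) * J \<theta> $ i $ j * (u $ j * cnj (u $ i))) has_integral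
      (\<Sum>i\<in>UNIV. \<Sum>j\<in>UNIV. g 0 $ i $ j * (u $ j * cnj (u $ i)))) circle_range"
    by (intro has_integral_sum has_integral_mult_left moment_has_integral) auto
  have e: "(\<Sum>i\<in>UNIV. \<Sum>j\<in>UNIV. M $ i $ j * (u $ j * cnj (u $ i))) = cip (M *v u) u" for M
    by (simp add: cip_sum matrix_vector_mult_def sum_distrib_right mult.assoc)
  have "((\<lambda>\<theta>. cip (J \<theta> *v u) u) has_integral cip (g 0 *v u) u) circle_range"
    using int by (simp add: e)
  then have "((\<lambda>\<theta>. Re (cip (J \<theta> *v u) u)) has_integral Re (cip (g 0 *v u) u)) circle_range"
    by (rule has_integral_Re)
  then have zero: "((\<lambda>\<theta>. (J \<theta> *v u) \<bullet> u) has_integral 0) circle_range"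
    by (simp add: Re_cip u(1))
  have pos: "(J \<theta> *v u) \<bullet> u > 0" for \<theta>
  proof -
    have "symbol P H \<theta> *v (J \<theta> *v u) = u" by (simp add: matrix_vector_mul_assoc J_right)
    then show ?thesis using positive[of "J \<theta> *v u" \<theta>] u(2) by (force simp: inner_commute)
  qed
  have "continuous_on circle_range (\<lambda>\<theta>. (J \<theta> *v u) \<bullet> u)"
    unfolding Re_cip[symmetric] e[symmetric]
    by (intro continuous_intros C1_continuous[OF J_C1])
  then have "(J 0 *v u) \<bullet> u = 0"
  proof (rule has_integral_0_cbox_imp_0)
    show "box 0 (2 * pi) \<noteq> {}" "0 \<in> circle_range" by (auto simp: not_le)
  qed (use zero pos in \<open>simp_all add: less_imp_le\<close>)
  then show False using pos[of 0] by simp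
qed

lemma moment_tendsto_0: "(\<lambda>n. g (int n) $ i $ j) \<longlonglongrightarrow> 0"
proof -
  have "symbol P H (2 * pi) = symbol P H 0" by (simp add: symbol_def vec_eq_iff flip: cis_inverse)
  then show ?thesis
    unfolding moment_def vec_lambda_beta by (intro fourier_coefficient_decay J_C1) simp
qed

text \<open>Compactness of angles times unit sphere makes positivity uniform, and homogeneity
  extends the bound to all vectors.\<close>

lemma coercive: "\<exists>\<epsilon>>0. \<forall>\<theta>\<in>circle_range. \<forall>u. \<epsilon> * (u \<bullet> u) \<le> (symbol P H \<theta> *v u) \<bullet> u"
proof -
  let ?F = "\<lambda>p :: real \<times> (complex^'m). (symbol P H (fst p) *v snd p) \<bullet> snd p"
  let ?C = "circle_range \<times> sphere (0::complex^'m) 1"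
  have e: "?F p = Re (\<Sum>i\<in>UNIV. \<Sum>j\<in>UNIV. symbol P H (fst p) $ i $ j * (snd p $ j * cnj (snd p $ i)))" for p
    unfolding Re_cip[symmetric] by (simp add: cip_sum matrix_vector_mult_def sum_distrib_right mult.assoc)
  have c: "continuous_on ?C (\<lambda>p. symbol P H (fst p) $ i $ j)" for i j
    by (rule continuous_on_compose2[OF C1_continuous[OF symbol_C1, of UNIV]]) (auto intro: continuous_intros)
  have "continuous_on ?C ?F" unfolding e by (intro continuous_intros c)
  moreover have "compact ?C" by (intro compact_Times) auto
  moreover have "?C \<noteq> {}" by (auto intro!: exI[of _ 0] vector_choose_size)
  ultimately have "\<exists>p\<in>?C. \<forall>q\<in>?C. ?F p \<le> ?F q"
    by (intro continuous_attains_inf)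
  then obtain p where p: "p \<in> ?C" "\<And>q. q \<in> ?C \<Longrightarrow> ?F p \<le> ?F q" by blast
  have "?F p > 0" using p(1) by (intro positive) auto
  moreover have "?F p * (u \<bullet> u) \<le> (symbol P H \<theta> *v u) \<bullet> u" if \<theta>: "\<theta> \<in> circle_range" for \<theta> u
  proof (cases "u = 0")
    case False
    define w where "w = (1 / norm u) *\<^sub>R u"
    have u: "u = norm u *\<^sub>R w" and w: "norm w = 1" using False by (simp_all add: w_def)
    have "?F p \<le> (symbol P H \<theta> *v w) \<bullet> w" using p(2)[of "(\<theta>, w)"] \<theta> w by auto
    moreover have "(symbol P H \<theta> *v u) \<bullet> u = (norm u)\<^sup>2 * ((symbol P H \<theta> *v w) \<bullet> w)"
      by (subst (1 2) u) (simp only: mat_vec_scaleR_right inner_scaleR_left inner_scaleR_right power2_eq_square mult.assoc)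
    ultimately show ?thesis by (simp add: power2_norm_eq_inner[symmetric] mult.commute mult_left_mono)
  qed simp
  ultimately show ?thesis by blast
qed

lemma has_integral_cip_cis:
  "((\<lambda>\<theta>. cip (cis (of_int a * \<theta>) *s x) (cis (of_int b * \<theta>) *s y)) has_integral
     (if a = b then 2 * pi * cip x y else 0)) circle_range"
proof -
  have "((\<lambda>\<theta>. cis (of_int (a - b) * \<theta>) * cip x y) has_integral
      ((if a - b = 0 then 2 * of_real pi else 0) * cip x y)) circle_range"
    by (intro has_integral_mult_left has_integral_cis)
  moreover have "cip (cis (of_int a * \<theta>) *s x) (cis (of_int b * \<theta>) *s y) = cis (of_int (a - b) * \<theta>) * cip x y" for \<theta>
    by (simp add: cip_scale_left cip_scale_right cis_cnj cis_mult algebra_simps)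
  ultimately have "((\<lambda>\<theta>. cip (cis (of_int a * \<theta>) *s x) (cis (of_int b * \<theta>) *s y)) has_integral
      ((if a - b = 0 then 2 * of_real pi else 0) * cip x y)) circle_range"
    by presburger
  then show ?thesis by (cases "a = b") simp_all
qed

text \<open>Pairing a truncation with its image under the Toeplitz operator leaves only the boundary term.\<close>

lemma decaying_solution_zero:
  assumes u0: "u 0 = 0"
    and rec: "\<And>n. P *v u n + H *v u (Suc n) + adj P *v u (Suc (Suc n)) = 0"
    and lim: "u \<longlonglongrightarrow> 0"
  shows "u n = 0"
proof -
  obtain \<epsilon> where \<epsilon>: "\<epsilon> > 0" "\<And>\<theta> u. \<theta> \<in> circle_range \<Longrightarrow> \<epsilon> * (u \<bullet> u) \<le> (symbol P H \<theta> *v u) \<bullet> u"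
    using coercive by blast
  \<comment> \<open>The generating polynomial of the truncated sequence. By orthogonality of
    characters its squared mean is the truncated sum of squares, and the mean of its symbol form is
    the truncated Toeplitz form.\<close>
  define U where "U N \<theta> = (\<Sum>n\<le>N. cis (of_int (int n) * \<theta>) *s u n)" for N \<theta>
  have int1: "((\<lambda>\<theta>. cip (U N \<theta>) (U N \<theta>)) has_integral
      (\<Sum>n\<le>N. \<Sum>m\<le>N. if int n = int m then 2 * pi * cip (u n) (u m) else 0)) circle_range" for N
    unfolding U_def cip_sum_left unfolding cip_sum_right
    by (intro has_integral_sum finite_atMost has_integral_cip_cis)
  have val1: "(\<Sum>n\<le>N. \<Sum>m\<le>N. if int n = int m then 2 * pi * cip (u n) (u m) else 0) =
      complex_of_real (2 * pi * (\<Sum>n\<le>N. u n \<bullet> u n))" for N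
    by (simp add: cip_self sum_distrib_left)
  have sym: "symbol P H \<theta> *v U N \<theta> = (\<Sum>n\<le>N. cis (of_int (int n + 1) * \<theta>) *s (P *v u n)) +
      (\<Sum>n\<le>N. cis (of_int (int n - 1) * \<theta>) *s (adj P *v u n)) +
      (\<Sum>n\<le>N. cis (of_int (int n) * \<theta>) *s (H *v u n))" for N \<theta>
    unfolding symbol_mult U_def
    by (simp add: mat_vec_sum mat_vec_scale vec.scale_sum_right cis_mult algebra_simps)
  have int2: "((\<lambda>\<theta>. cip (symbol P H \<theta> *v U N \<theta>) (U N \<theta>)) has_integral
      ((\<Sum>n\<le>N. \<Sum>m\<le>N. if int n + 1 = int m then 2 * pi * cip (P *v u n) (u m) else 0) +
       (\<Sum>n\<le>N. \<Sum>m\<le>N. if int n - 1 = int m then 2 * pi * cip (adj P *v u n) (u m) else 0) +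
       (\<Sum>n\<le>N. \<Sum>m\<le>N. if int n = int m then 2 * pi * cip (H *v u n) (u m) else 0))) circle_range" for N
    unfolding sym cip_add_left cip_sum_left unfolding U_def cip_sum_right
    by (intro has_integral_add has_integral_sum finite_atMost has_integral_cip_cis)
  \<comment> \<open>Each row of the recurrence, paired with the matching entry, cancels completely
    except the last, which lacks its \<open>adj P\<close> term; row 0 drops out because it is paired
    with \<open>u 0 = 0\<close>.\<close>
  have val2: "(\<Sum>n\<le>N. \<Sum>m\<le>N. if int n + 1 = int m then 2 * pi * cip (P *v u n) (u m) else 0) +
       (\<Sum>n\<le>N. \<Sum>m\<le>N. if int n - 1 = int m then 2 * pi * cip (adj P *v u n) (u m) else 0) +
       (\<Sum>n\<le>N. \<Sum>m\<le>N. if int n = int m then 2 * pi * cip (H *v u n) (u m) else 0) =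
       - (2 * pi * cip (adj P *v u (Suc N)) (u N))" for N
  proof (induction N)
    case 0
    then show ?case by (simp add: u0)
  next
    case (Suc N)
    have z: "cip (P *v u N) (u (Suc N)) + cip (H *v u (Suc N)) (u (Suc N)) +
        cip (adj P *v u (Suc (Suc N))) (u (Suc N)) = 0"
      unfolding cip_add_left[symmetric] rec by simp
    have *: "(\<Sum>n\<le>Suc N. \<Sum>m\<le>Suc N. if int n + 1 = int m then 2 * pi * cip (P *v u n) (u m) else 0) =
        (\<Sum>n\<le>N. \<Sum>m\<le>N. if int n + 1 = int m then 2 * pi * cip (P *v u n) (u m) else 0) +
        2 * pi * cip (P *v u N) (u (Suc N))"
      "(\<Sum>n\<le>Suc N. \<Sum>m\<le>Suc N. if int n - 1 = int m then 2 * pi * cip (adj P *v u n) (u m) else 0) =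
        (\<Sum>n\<le>N. \<Sum>m\<le>N. if int n - 1 = int m then 2 * pi * cip (adj P *v u n) (u m) else 0) +
        2 * pi * cip (adj P *v u (Suc N)) (u N)"
      "(\<Sum>n\<le>Suc N. \<Sum>m\<le>Suc N. if int n = int m then 2 * pi * cip (H *v u n) (u m) else 0) =
        (\<Sum>n\<le>N. \<Sum>m\<le>N. if int n = int m then 2 * pi * cip (H *v u n) (u m) else 0) +
        2 * pi * cip (H *v u (Suc N)) (u (Suc N))"
    proof -
      have s1: "(\<Sum>m\<le>Suc N. if int (Suc N) + 1 = int m then f m else 0) = 0" for f :: "nat \<Rightarrow> complex"
        by (intro sum.neutral) auto
      have s2: "(\<Sum>n\<le>N. if int n + 1 = int (Suc N) then f n else 0) = f N" for f :: "nat \<Rightarrow> complex"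
        using sum.delta[of "{..N}" N f] by simp
      have s3: "(\<Sum>m\<le>Suc N. if int (Suc N) - 1 = int m then f m else 0) = f N" for f :: "nat \<Rightarrow> complex"
        using sum.delta'[of "{..Suc N}" N f] by simp
      have s4: "(\<Sum>n\<le>N. if int n - 1 = int (Suc N) then f n else 0) = 0" for f :: "nat \<Rightarrow> complex"
        by (intro sum.neutral) auto
      have split: "(\<Sum>n\<le>Suc N. \<Sum>m\<le>Suc N. F n m) =
          (\<Sum>n\<le>N. \<Sum>m\<le>N. F n m) + (\<Sum>n\<le>N. F n (Suc N)) + (\<Sum>m\<le>Suc N. F (Suc N) m)"
        for F :: "nat \<Rightarrow> nat \<Rightarrow> complex"
        by (simp add: sum.distrib)
      show "(\<Sum>n\<le>Suc N. \<Sum>m\<le>Suc N. if int n + 1 = int m then 2 * pi * cip (P *v u n) (u m) else 0) =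
        (\<Sum>n\<le>N. \<Sum>m\<le>N. if int n + 1 = int m then 2 * pi * cip (P *v u n) (u m) else 0) +
        2 * pi * cip (P *v u N) (u (Suc N))"
        unfolding split s1 s2 by simp
      show "(\<Sum>n\<le>Suc N. \<Sum>m\<le>Suc N. if int n - 1 = int m then 2 * pi * cip (adj P *v u n) (u m) else 0) =
        (\<Sum>n\<le>N. \<Sum>m\<le>N. if int n - 1 = int m then 2 * pi * cip (adj P *v u n) (u m) else 0) +
        2 * pi * cip (adj P *v u (Suc N)) (u N)"
        unfolding split s3 s4 by simp
      show "(\<Sum>n\<le>Suc N. \<Sum>m\<le>Suc N. if int n = int m then 2 * pi * cip (H *v u n) (u m) else 0) =
        (\<Sum>n\<le>N. \<Sum>m\<le>N. if int n = int m then 2 * pi * cip (H *v u n) (u m) else 0) +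
        2 * pi * cip (H *v u (Suc N)) (u (Suc N))"
        by simp
    qed
    have "2 * pi * cip (P *v u N) (u (Suc N)) + 2 * pi * cip (H *v u (Suc N)) (u (Suc N)) =
        - (2 * pi * cip (adj P *v u (Suc (Suc N))) (u (Suc N)))"
    proof -
      have "2 * pi * cip (P *v u N) (u (Suc N)) + 2 * pi * cip (H *v u (Suc N)) (u (Suc N)) +
          2 * pi * cip (adj P *v u (Suc (Suc N))) (u (Suc N)) = 0"
        using arg_cong[OF z, of "\<lambda>t. 2 * pi * t"] by (simp only: distrib_left mult_zero_right)
      then show ?thesis by (simp only: eq_neg_iff_add_eq_0)
    qed
    then show ?case unfolding * using Suc.IH by (simp add: algebra_simps)
  qed
  \<comment> \<open>Coercivity integrated over the circle bounds the sum of squares by the boundary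
    term, which tends to 0 with the sequence.\<close>
  have bound: "\<epsilon> * (\<Sum>n\<le>N. u n \<bullet> u n) \<le> - ((adj P *v u (Suc N)) \<bullet> u N)" for N
  proof -
    have i1: "((\<lambda>\<theta>. \<epsilon> * (U N \<theta> \<bullet> U N \<theta>)) has_integral \<epsilon> * (2 * pi * (\<Sum>n\<le>N. u n \<bullet> u n))) circle_range"
      using has_integral_mult_right[OF has_integral_Re[OF int1[of N, unfolded val1]], of \<epsilon>] by (simp add: Re_cip)
    have i2: "((\<lambda>\<theta>. (symbol P H \<theta> *v U N \<theta>) \<bullet> U N \<theta>) has_integral - (2 * pi * ((adj P *v u (Suc N)) \<bullet> u N))) circle_range"
      using has_integral_Re[OF int2[of N, unfolded val2]] by (simp add: Re_cip)
    have "\<epsilon> * (2 * pi * (\<Sum>n\<le>N. u n \<bullet> u n)) \<le> - (2 * pi * ((adj P *v u (Suc N)) \<bullet> u N))"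
      using \<epsilon>(2) by (rule has_integral_le[OF i1 i2])
    then have "(2 * pi) * (\<epsilon> * (\<Sum>n\<le>N. u n \<bullet> u n)) \<le> (2 * pi) * - ((adj P *v u (Suc N)) \<bullet> u N)"
      by (simp only: mult.left_commute[of "2 * pi" \<epsilon>] mult_minus_right)
    then show ?thesis by (rule mult_left_le_imp_le) simp
  qed
  have "(\<lambda>N. - ((adj P *v u (Suc N)) \<bullet> u N)) \<longlonglongrightarrow> - ((adj P *v 0) \<bullet> 0)"
    by (intro tendsto_minus tendsto_inner tendsto_mat_vec_const LIMSEQ_Suc lim)
  then have l: "(\<lambda>N. - ((adj P *v u (Suc N)) \<bullet> u N)) \<longlonglongrightarrow> 0" by simp
  have "\<epsilon> * (u n \<bullet> u n) \<le> 0"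
  proof (rule tendsto_lowerbound[OF l])
    have "\<epsilon> * (u n \<bullet> u n) \<le> - ((adj P *v u (Suc N)) \<bullet> u N)" if "N \<ge> n" for N
    proof -
      have "u n \<bullet> u n \<le> (\<Sum>n\<le>N. u n \<bullet> u n)" using that by (intro member_le_sum) auto
      then have "\<epsilon> * (u n \<bullet> u n) \<le> \<epsilon> * (\<Sum>n\<le>N. u n \<bullet> u n)" using \<epsilon>(1) by simp
      then show ?thesis using bound[of N] by linarith
    qed
    then show "\<forall>\<^sub>F N in sequentially. \<epsilon> * (u n \<bullet> u n) \<le> - ((adj P *v u (Suc N)) \<bullet> u N)"
      unfolding eventually_sequentially by blast
  qed simp
  then have "u n \<bullet> u n \<le> 0" using \<epsilon>(1) by (simp add: mult_le_0_iff)
  then show ?thesis using inner_ge_zero[of "u n"] inner_eq_zero_iff[of "u n"] by linarith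
qed

abbreviation "X \<equiv> solvent P H"

text \<open>A decaying solution of the three-term recurrence is determined by its initial value.
  Both \<open>h (Suc n)\<close> and \<open>h n ** X\<close> are such solutions with the same start,
  so shifting the index amounts to multiplication by \<open>X\<close>.\<close>

lemma moment_eq_matpow: "g (int n) ** cramer_inverse (g 0) = matpow X n"
proof -
  define h where "h n = g (int n) ** cramer_inverse (g 0)" for n
  have h0: "h 0 = mat 1" unfolding h_def using cramer_inverse[OF moment_0_invertible] by simp
  have h1: "h (Suc 0) = X" by (simp add: h_def solvent_def)
  have rec: "P ** h n + H ** h (Suc n) + adj P ** h (Suc (Suc n)) = 0" for n
  proof -
    have "P ** g (int n) + H ** g (int n + 1) + adj P ** g (int n + 2) = 0"
      using moment_recurrence[of "int n + 1"] by (simp add: add.commute)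
    then have "(P ** g (int n) + H ** g (int n + 1) + adj P ** g (int n + 2)) ** cramer_inverse (g 0) = 0"
      by (simp add: mat_zero_left)
    then show ?thesis
      unfolding h_def by (simp add: mat_add_rdistrib matrix_mul_assoc add.commute)
  qed
  have hlim: "(\<lambda>n. h n *v y) \<longlonglongrightarrow> 0" for y
  proof -
    have "(\<lambda>n. g (int n) *v (cramer_inverse (g 0) *v y)) \<longlonglongrightarrow> 0 *v (cramer_inverse (g 0) *v y)"
      by (rule tendsto_mat_vec) (simp add: moment_tendsto_0)
    then show ?thesis by (simp add: h_def matrix_vector_mul_assoc)
  qed
  have "h (Suc n) *v y - h n *v (X *v y) = 0" for n y
  proof (rule decaying_solution_zero)
    show "h (Suc 0) *v y - h 0 *v (X *v y) = 0" by (simp add: h0 h1)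
    show "P *v (h (Suc n) *v y - h n *v (X *v y)) + H *v (h (Suc (Suc n)) *v y - h (Suc n) *v (X *v y)) +
        adj P *v (h (Suc (Suc (Suc n))) *v y - h (Suc (Suc n)) *v (X *v y)) = 0" for n
    proof -
      have r: "P *v (h n *v z) + H *v (h (Suc n) *v z) + adj P *v (h (Suc (Suc n)) *v z) = 0" for n z
        using arg_cong[OF rec[of n], of "\<lambda>M. M *v z"]
        by (simp add: matrix_vector_mult_add_rdistrib matrix_vector_mul_assoc)
      have "P *v (h (Suc n) *v y - h n *v (X *v y)) + H *v (h (Suc (Suc n)) *v y - h (Suc n) *v (X *v y)) +
          adj P *v (h (Suc (Suc (Suc n))) *v y - h (Suc (Suc n)) *v (X *v y)) =
        (P *v (h (Suc n) *v y) + H *v (h (Suc (Suc n)) *v y) + adj P *v (h (Suc (Suc (Suc n))) *v y)) -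
        (P *v (h n *v (X *v y)) + H *v (h (Suc n) *v (X *v y)) + adj P *v (h (Suc (Suc n)) *v (X *v y)))"
        by (simp only: matrix_vector_mult_diff_distrib add_diff_add)
      then show ?thesis unfolding r by simp
    qed
    show "(\<lambda>n. h (Suc n) *v y - h n *v (X *v y)) \<longlonglongrightarrow> 0"
      using tendsto_diff[OF LIMSEQ_Suc[OF hlim[of y]] hlim[of "X *v y"]] by simp
  qed
  then have "h (Suc n) *v y = (h n ** X) *v y" for n y by (simp add: matrix_vector_mul_assoc)
  then have step: "h (Suc n) = h n ** X" for n by (simp add: matrix_eq)
  have "h n = matpow X n"
    by (induction n) (simp_all add: h0 step matpow_commute)
  then show ?thesis by (simp add: h_def)
qed

text \<open>The statement that the spectrum lies in the open disc, expressed as decay of all orbits.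
  In this form it is read off from the decay of the moments, without eigenvalues.\<close>

lemma solvent_stable: "(\<lambda>n. matpow X n *v y) \<longlonglongrightarrow> 0"
proof -
  have "(\<lambda>n. g (int n) *v (cramer_inverse (g 0) *v y)) \<longlonglongrightarrow> 0 *v (cramer_inverse (g 0) *v y)"
    by (rule tendsto_mat_vec) (simp add: moment_tendsto_0)
  then show ?thesis by (simp add: matrix_vector_mul_assoc moment_eq_matpow)
qed

text \<open>On the circle, this says that \<open>symbol P H = (1 - \<zeta> X)\<^sup>* K (1 - \<zeta> X)\<close>.\<close>

lemma factorization:
  obtains K where "adj K = K" "invertible K" "P = - (K ** X)" "H = K + adj X ** K ** X"
proof -
  \<comment> \<open>Forced by the desired identities: \<open>P = - (K ** X)\<close> with Hermitian
    \<open>K\<close> turns \<open>adj X ** K ** X\<close> into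
    \<open>- (adj P ** X)\<close>.\<close>
  define K where "K = H + adj P ** X"
  have mg: "matpow X n ** g 0 = g (int n)" for n
  proof -
    have "matpow X n ** g 0 = g (int n) ** (cramer_inverse (g 0) ** g 0)"
      by (simp add: moment_eq_matpow[symmetric] matrix_mul_assoc)
    then show ?thesis using cramer_inverse[OF moment_0_invertible] by simp
  qed
  have Xg: "X ** g 0 = g 1" "X ** g 1 = g 2"
    using mg[of 1] mg[of 2] by (simp_all add: numeral_2_eq_2 matrix_mul_assoc[symmetric])
  have "(P + K ** X) ** g 0 = P ** g 0 + H ** g 1 + adj P ** g 2"
    by (simp add: K_def mat_add_rdistrib matrix_mul_assoc[symmetric] Xg)
  also have "\<dots> = 0" using moment_recurrence[of 1] by simp
  finally have "(P + K ** X) ** g 0 ** cramer_inverse (g 0) = 0" by (simp add: mat_zero_left)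
  then have "P + K ** X = 0"
    using cramer_inverse[OF moment_0_invertible] by (simp add: matrix_mul_assoc[symmetric])
  then have P: "P = - (K ** X)" by (simp add: add_eq_0_iff2)
  \<comment> \<open>\<open>N\<close> turns out to be \<open>2 * pi\<close> times the inverse of
    \<open>K\<close>. It is the Schur complement of \<open>g 0\<close> in the block matrix of the
    moments \<open>g 0\<close>, \<open>g 1\<close>, \<open>g (- 1)\<close>, hence Hermitian, and
    this is where the symmetry of \<open>K\<close> comes from.\<close>
  define N where "N = g 0 - X ** g (- 1)"
  have "K ** N = P ** g (- 1) + H ** g 0 + adj P ** g 1"
  proof -
    have "K ** N = K ** g 0 - K ** X ** g (- 1)"
      by (simp add: N_def mat_diff_ldistrib matrix_mul_assoc)
    also have "K ** X = - P" using arg_cong[OF P, of uminus] by simp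
    also have "K ** g 0 = H ** g 0 + adj P ** g 1"
      by (simp add: K_def mat_add_rdistrib matrix_mul_assoc[symmetric] Xg)
    finally show ?thesis by (simp add: mat_minus_left)
  qed
  then have KN: "K ** N = (2 * pi) *\<^sub>R mat 1" using moment_recurrence[of 0] by simp
  have "N = g 0 - g 1 ** cramer_inverse (g 0) ** adj (g 1)"
    by (simp add: N_def solvent_def moment_adj)
  moreover have "adj (cramer_inverse (g 0)) = cramer_inverse (g 0)"
  proof -
    have "g 0 ** adj (cramer_inverse (g 0)) = mat 1"
      using arg_cong[OF cramer_inverse(2)[OF moment_0_invertible], of adj] by (simp add: adj_mult moment_adj)
    then have "cramer_inverse (g 0) ** (g 0 ** adj (cramer_inverse (g 0))) = cramer_inverse (g 0)" by simp
    then show ?thesis using cramer_inverse[OF moment_0_invertible] by (simp add: matrix_mul_assoc)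
  qed
  ultimately have Nadj: "adj N = N"
    by (simp add: adj_diff adj_mult moment_adj matrix_mul_assoc)
  define N' where "N' = (1 / (2 * pi)) *\<^sub>R N"
  have KN': "K ** N' = mat 1" by (simp add: N'_def KN mat_scaleR_right)
  then have "invertible K" using invertible_right_inverse by blast
  have N'K: "N' ** K = mat 1" using KN' by (simp add: matrix_left_right_inverse)
  have "N' ** adj K = mat 1"
    using arg_cong[OF KN', of adj] by (simp add: adj_mult N'_def adj_scaleR Nadj)
  then have "K ** (N' ** adj K) = K" by simp
  then have Kadj: "adj K = K" by (simp add: matrix_mul_assoc KN')
  have aP: "adj P = - (adj X ** K)"
    using arg_cong[OF P, of adj] by (simp only: adj_minus adj_mult Kadj)
  have "H + adj P ** X = H - adj X ** K ** X" unfolding aP mat_minus_left by simp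
  with K_def have "K = H - adj X ** K ** X" by (rule trans)
  then have "H = K + adj X ** K ** X" by (metis diff_add_cancel)
  then show ?thesis using that Kadj \<open>invertible K\<close> P by blast
qed

end

section \<open>Discs and conormals of the quadric\<close>

definition disc_algebra :: "(complex \<Rightarrow> complex) set" where
  "disc_algebra = {f. continuous_on (cball 0 1) f \<and> f holomorphic_on ball 0 1}"

lemma disc_algebra_subring: "function_subring disc_algebra"
  unfolding function_subring_def disc_algebra_def
  by (auto intro: continuous_intros holomorphic_intros)

lemma disc_algebra_id: "(\<lambda>\<zeta>. \<zeta>) \<in> disc_algebra"
  by (auto simp: disc_algebra_def intro: continuous_intros holomorphic_intros)

lemmas disc_algebra_intros =
  disc_algebra_id subring_const[OF disc_algebra_subring] subring_add[OF disc_algebra_subring]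
  subring_mult[OF disc_algebra_subring] subring_sum[OF disc_algebra_subring]

lemma disc_algebra_diff: "f \<in> disc_algebra \<Longrightarrow> g \<in> disc_algebra \<Longrightarrow> (\<lambda>\<zeta>. f \<zeta> - g \<zeta>) \<in> disc_algebra"
  unfolding disc_algebra_def by (auto intro: continuous_intros holomorphic_intros)

lemma disc_algebra_minus: "f \<in> disc_algebra \<Longrightarrow> (\<lambda>\<zeta>. - f \<zeta>) \<in> disc_algebra"
  unfolding disc_algebra_def by (auto intro: continuous_intros holomorphic_intros)

text \<open>Serves to turn the coefficients of a lift, or of \<open>\<zeta>\<close> times a lift,
  into elements of the disc algebra once the singularity at 0 is removable.\<close>

lemma disc_algebra_glue:
  assumes f: "continuous_on (cball 0 1 - {0}) f" and g: "g holomorphic_on ball 0 1"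
    and eq: "\<And>\<zeta>. \<zeta> \<in> ball 0 1 - {0} \<Longrightarrow> g \<zeta> = f \<zeta>"
  shows "(\<lambda>\<zeta>. if \<zeta> = 0 then g 0 else f \<zeta>) \<in> disc_algebra"
proof -
  let ?h = "\<lambda>\<zeta>. if \<zeta> = 0 then g 0 else f \<zeta>"
  have hg: "?h \<zeta> = g \<zeta>" if "\<zeta> \<in> ball 0 1" for \<zeta> using eq[of \<zeta>] that by auto
  have hol: "?h holomorphic_on ball 0 1"
    using g by (rule holomorphic_transform) (simp add: hg)
  have un: "(cball 0 1 - {0}) \<union> ball 0 1 = cball (0::complex) 1" by auto
  have "continuous_on ((cball 0 1 - {0}) \<union> ball 0 1) ?h"
  proof (rule continuous_on_Un_local_open)
    show "openin (top_of_set (cball 0 1 - {0} \<union> ball 0 1)) (cball 0 1 - {0::complex})"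
      unfolding un openin_open by (intro exI[of _ "- {0}"]) auto
    show "openin (top_of_set (cball 0 1 - {0} \<union> ball 0 1)) (ball (0::complex) 1)"
      unfolding un openin_open by (intro exI[of _ "ball 0 1"]) auto
    show "continuous_on (cball 0 1 - {0}) ?h"
      using f by (rule continuous_on_eq) auto
    show "continuous_on (ball 0 1) ?h" using hol by (rule holomorphic_on_imp_continuous_on)
  qed
  then show ?thesis using hol un by (simp add: disc_algebra_def)
qed

lemma disc_algebra_constant:
  assumes f: "f \<in> disc_algebra" and "\<And>\<zeta>. \<zeta> \<in> ball 0 1 \<Longrightarrow> f \<zeta> = c" and "\<zeta> \<in> cball 0 1"
  shows "f \<zeta> = c"
proof -
  have "closure (ball (0::complex) 1) = cball 0 1" by simp
  then show ?thesis
    using continuous_constant_on_closure[of "ball 0 1" f c \<zeta>] assms by (simp add: disc_algebra_def)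
qed

text \<open>The maximum principle for both signs of the imaginary part makes \<open>f\<close> real
  inside; a nonconstant holomorphic function is open and cannot take values in a line.\<close>

lemma real_boundary_values_constant:
  assumes f: "f \<in> disc_algebra" and real: "\<And>\<zeta>. \<zeta> \<in> sphere 0 1 \<Longrightarrow> Im (f \<zeta>) = 0"
  shows "\<exists>c. \<forall>\<zeta>\<in>cball 0 1. f \<zeta> = c"
proof -
  have max: "Re (g \<zeta>) \<le> 0" if "g \<in> disc_algebra" "\<And>\<zeta>. \<zeta> \<in> sphere 0 1 \<Longrightarrow> Re (g \<zeta>) = 0" "\<zeta> \<in> cball 0 1" for g \<zeta>
  proof (rule maximum_real_frontier[of g "cball 0 1"])
    show "g holomorphic_on interior (cball 0 1)" "continuous_on (closure (cball 0 1)) g"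
      using that(1) by (simp_all add: disc_algebra_def)
    show "Re (g z) \<le> 0" if "z \<in> frontier (cball 0 1)" for z
      using that \<open>\<And>\<zeta>. \<zeta> \<in> sphere 0 1 \<Longrightarrow> Re (g \<zeta>) = 0\<close>[of z] by simp
  qed (use that in simp_all)
  have "Im (f \<zeta>) = 0" if z: "\<zeta> \<in> cball 0 1" for \<zeta>
  proof -
    have m: "(\<lambda>\<zeta>. c * f \<zeta>) \<in> disc_algebra" for c by (rule disc_algebra_intros(4)[OF disc_algebra_intros(2) f])
    have "Re (\<i> * f \<zeta>) \<le> 0" "Re (- \<i> * f \<zeta>) \<le> 0"
      by (rule max[OF m _ z], simp add: real)+
    then show ?thesis by simp
  qed
  then have sub: "f ` ball 0 1 \<subseteq> {z. Im z = 0}" by auto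
  have "f constant_on ball 0 1"
  proof (rule ccontr)
    assume "\<not> f constant_on ball 0 1"
    then have "open (f ` ball 0 1)"
      using f by (intro open_mapping_thm[of f "ball 0 1" "ball 0 1"]) (auto simp: disc_algebra_def)
    moreover have "f 0 \<in> f ` ball 0 1" by simp
    ultimately obtain e where e: "e > 0" "ball (f 0) e \<subseteq> f ` ball 0 1"
      unfolding open_contains_ball by blast
    have "f 0 + \<i> * (e / 2) \<in> ball (f 0) e" using e(1) by (simp add: dist_norm norm_mult)
    then have "f 0 + \<i> * (e / 2) \<in> {z. Im z = 0}" "f 0 \<in> {z. Im z = 0}"
      using e(2) sub \<open>f 0 \<in> f ` ball 0 1\<close> by blast+
    then show False using e(1) by simp
  qed
  then obtain c where "\<And>\<zeta>. \<zeta> \<in> ball 0 1 \<Longrightarrow> f \<zeta> = c" by (auto simp: constant_on_def)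
  then show ?thesis using disc_algebra_constant[OF f] by blast
qed

lemma disc_algebra_boundary_unique:
  assumes "f \<in> disc_algebra" "g \<in> disc_algebra" "\<And>\<zeta>. \<zeta> \<in> sphere 0 1 \<Longrightarrow> f \<zeta> = g \<zeta>" "\<zeta> \<in> cball 0 1"
  shows "f \<zeta> = g \<zeta>"
proof -
  obtain c where c: "\<forall>\<zeta>\<in>cball 0 1. f \<zeta> - g \<zeta> = c"
    using real_boundary_values_constant[OF disc_algebra_diff[OF assms(1,2)]] assms(3) by auto
  have "c = f 1 - g 1" using c by auto
  then have "c = 0" using assms(3)[of 1] by simp
  then show ?thesis using c assms(4) by simp
qed

text \<open>On the circle both \<open>f + g\<close> and \<open>\<i> * (f - g)\<close> are real, and
  \<open>f\<close> is a combination of the two.\<close>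

lemma conjugate_boundary_values_constant:
  assumes f: "f \<in> disc_algebra" and g: "g \<in> disc_algebra"
    and eq: "\<And>\<zeta>. \<zeta> \<in> sphere 0 1 \<Longrightarrow> f \<zeta> = cnj (g \<zeta>)"
  shows "\<exists>c. \<forall>\<zeta>\<in>cball 0 1. f \<zeta> = c"
proof -
  obtain a where a: "\<forall>\<zeta>\<in>cball 0 1. f \<zeta> + g \<zeta> = a"
    using real_boundary_values_constant[of "\<lambda>\<zeta>. f \<zeta> + g \<zeta>"] f g eq by (auto intro: disc_algebra_intros)
  obtain b where b: "\<forall>\<zeta>\<in>cball 0 1. \<i> * (f \<zeta> - g \<zeta>) = b"
  proof -
    have "(\<lambda>\<zeta>. \<i> * (f \<zeta> - g \<zeta>)) \<in> disc_algebra"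
      by (rule disc_algebra_intros(4)[OF disc_algebra_intros(2) disc_algebra_diff[OF f g]])
    from real_boundary_values_constant[OF this] show ?thesis using that eq by auto
  qed
  have "f \<zeta> = (a - \<i> * b) / 2" if "\<zeta> \<in> cball 0 1" for \<zeta>
    unfolding a[rule_format, OF that, symmetric] b[rule_format, OF that, symmetric]
    by (simp add: complex_eq_iff)
  then show ?thesis by blast
qed

text \<open>Reflection in the circle would continue \<open>f\<close> to the sphere with at most a
  simple pole at infinity. Concretely, removing the contribution of \<open>g 0\<close> leaves
  \<open>f - \<zeta> * cnj (g 0)\<close> as the conjugate of the difference quotient of
  \<open>g\<close> at 0.\<close>

lemma conjugate_pole_boundary_values_affine:
  assumes f: "f \<in> disc_algebra" and g: "g \<in> disc_algebra"
    and eq: "\<And>\<zeta>. \<zeta> \<in> sphere 0 1 \<Longrightarrow> f \<zeta> = \<zeta> * cnj (g \<zeta>)"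
  shows "\<exists>a b. \<forall>\<zeta>\<in>cball 0 1. f \<zeta> = a + \<zeta> * b"
proof -
  define G where "G = (\<lambda>\<zeta>. if \<zeta> = 0 then deriv g 0 else (g \<zeta> - g 0) / \<zeta>)"
  have hol: "G holomorphic_on ball 0 1"
    using pole_lemma_open[of g "ball 0 1" 0] g unfolding G_def disc_algebra_def diff_zero by blast
  have "(\<lambda>\<zeta>. if \<zeta> = 0 then G 0 else (g \<zeta> - g 0) / \<zeta>) \<in> disc_algebra"
  proof (rule disc_algebra_glue[OF _ hol])
    show "continuous_on (cball 0 1 - {0}) (\<lambda>\<zeta>. (g \<zeta> - g 0) / \<zeta>)"
    proof -
      have "continuous_on (cball 0 1 - {0}) g"
        using g continuous_on_subset[of "cball 0 1" g "cball 0 1 - {0}"] by (auto simp: disc_algebra_def)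
      then show ?thesis by (intro continuous_intros) auto
    qed
  qed (simp add: G_def)
  moreover have "(\<lambda>\<zeta>. if \<zeta> = 0 then G 0 else (g \<zeta> - g 0) / \<zeta>) = G" by (auto simp: G_def)
  ultimately have G: "G \<in> disc_algebra" by simp
  have F: "(\<lambda>\<zeta>. f \<zeta> - \<zeta> * cnj (g 0)) \<in> disc_algebra"
    by (rule disc_algebra_diff[OF f disc_algebra_intros(4)[OF disc_algebra_id disc_algebra_intros(2)]])
  have E: "f \<zeta> - \<zeta> * cnj (g 0) = cnj (G \<zeta>)" if "\<zeta> \<in> sphere 0 1" for \<zeta>
  proof -
    have z: "\<zeta> * cnj \<zeta> = 1" "\<zeta> \<noteq> 0"
      using that by (auto simp: complex_norm_square[symmetric])
    then have "inverse (cnj \<zeta>) = \<zeta>" by (simp add: inverse_unique mult.commute)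
    then show ?thesis
      using z(2) eq[OF that] by (simp add: G_def divide_inverse algebra_simps)
  qed
  obtain c where "\<forall>\<zeta>\<in>cball 0 1. f \<zeta> - \<zeta> * cnj (g 0) = c"
    using conjugate_boundary_values_constant[OF F G E] by blast
  then have "\<forall>\<zeta>\<in>cball 0 1. f \<zeta> = c + \<zeta> * cnj (g 0)" by (auto simp: algebra_simps)
  then show ?thesis by blast
qed

section \<open>Tangent vectors and conormals of the quadric\<close>

lemma sum_UNIV_sum_type:
  "(\<Sum>l\<in>(UNIV :: ('k::finite + 'm::finite) set). f l) = (\<Sum>j\<in>UNIV. f (Inl j)) + (\<Sum>l\<in>UNIV. f (Inr l))"
  by (subst UNIV_Plus_UNIV[symmetric], subst sum.Plus) (simp_all add: o_def)

lemma w_part_nth [simp]: "w_part p $ l = p $ Inr l"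
  by (simp add: w_part_def)

lemma quadric_rho_eq: "quadric_rho A j p = Re (p $ Inl j) - (A j *v w_part p) \<bullet> w_part p"
  by (simp add: quadric_rho_def flip: cip_def Re_cip)

lemma bounded_linear_w_part: "bounded_linear w_part"
  by (rule linear_conv_bounded_linear[THEN iffD1], rule linearI) (simp_all add: vec_eq_iff)

lemma bounded_linear_mat_vec: "bounded_linear (\<lambda>u. M *v (u :: complex^'m))"
  by (rule linear_conv_bounded_linear[THEN iffD1], rule linearI)
     (simp_all add: matrix_vector_right_distrib mat_vec_scaleR_right)

context
  fixes A :: "'k::finite \<Rightarrow> complex^'m::finite^'m"
  assumes A_herm: "\<And>j. hermitian (A j)"
begin

lemma A_adj: "adj (A j) = A j"
  using A_herm hermitian_iff_adj by blast

lemma quadric_rho_has_derivative: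
  "(quadric_rho A j has_derivative (\<lambda>h. Re (h $ Inl j) - 2 * ((A j *v w_part p) \<bullet> w_part h))) (at p within S)"
proof -
  have w: "(w_part has_derivative w_part) (at p within S)"
    by (rule bounded_linear_imp_has_derivative[OF bounded_linear_w_part])
  have "((\<lambda>p. (A j *v w_part p) \<bullet> w_part p) has_derivative
      (\<lambda>h. (A j *v w_part p) \<bullet> w_part h + (A j *v w_part h) \<bullet> w_part p)) (at p within S)"
    by (rule has_derivative_inner[OF bounded_linear.has_derivative[OF bounded_linear_mat_vec w] w])
  moreover have "(A j *v w_part h) \<bullet> w_part p = (A j *v w_part p) \<bullet> w_part h" for h
    using inner_adj[of "A j" "w_part h" "w_part p"] by (simp only: A_adj inner_commute)
  then have "(\<lambda>h. (A j *v w_part p) \<bullet> w_part h + (A j *v w_part h) \<bullet> w_part p) =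
      (\<lambda>h. 2 * ((A j *v w_part p) \<bullet> w_part h))"
    by (intro ext) simp
  ultimately have "((\<lambda>p. (A j *v w_part p) \<bullet> w_part p) has_derivative
      (\<lambda>h. 2 * ((A j *v w_part p) \<bullet> w_part h))) (at p within S)"
    by (rule has_derivative_eq_rhs)
  moreover have "((\<lambda>p. Re (p $ Inl j)) has_derivative (\<lambda>h. Re (h $ Inl j))) (at p within S)"
    by (rule bounded_linear_imp_has_derivative)
       (intro bounded_linear_compose[OF bounded_linear_Re] bounded_linear_vec_nth)
  ultimately show ?thesis
    unfolding quadric_rho_eq[abs_def] by (rule has_derivative_diff[rotated])
qed

lemma del_form_quadric_rho:
  "del_form (quadric_rho A j) p $ Inl i = (if i = j then 1 / 2 else 0)"
  "del_form (quadric_rho A j) p $ Inr l = - cnj ((A j *v w_part p) $ l)"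
proof -
  have D: "frechet_derivative (quadric_rho A j) (at p) =
      (\<lambda>h. Re (h $ Inl j) - 2 * ((A j *v w_part p) \<bullet> w_part h))"
    using frechet_derivative_at[OF quadric_rho_has_derivative[of j p UNIV]] by simp
  have wl: "w_part (axis (Inl i) c :: complex^('k + 'm)) = 0" for i c
    by (simp add: vec_eq_iff axis_def)
  have wr: "w_part (axis (Inr l) c :: complex^('k + 'm)) = axis l c" for l c
    by (auto simp: vec_eq_iff axis_def)
  show "del_form (quadric_rho A j) p $ Inl i = (if i = j then 1 / 2 else 0)"
    by (simp add: del_form_def D wl) (simp add: axis_def)
  show "del_form (quadric_rho A j) p $ Inr l = - cnj ((A j *v w_part p) $ l)"
    by (simp add: del_form_def D wr inner_axis complex_eq_iff inner_complex_def) (simp add: axis_def)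
qed

text \<open>Explicit parabolas in the quadric provide enough tangent vectors, with \<open>y\<close>
  and \<open>\<eta>\<close> free: varying \<open>y\<close> makes the \<open>z\<close>-coefficients
  real, varying \<open>\<eta>\<close> determines the \<open>w\<close>-coefficients from them.
  Conversely, differentiating \<open>quadric_rho\<close> along a curve in the quadric determines the
  real \<open>z\<close>-part of its velocity.\<close>

lemma quadric_conormal_iff:
  assumes p: "p \<in> quadric A"
  shows "\<omega> \<in> conormal_space (quadric A) p \<longleftrightarrow>
    (\<forall>j. Im (\<omega> $ Inl j) = 0) \<and>
    (\<forall>l. \<omega> $ Inr l = - 2 * (\<Sum>j\<in>UNIV. \<omega> $ Inl j * cnj ((A j *v w_part p) $ l)))"
proof
  have pairing_split: "Re (pairing \<omega> X) = (\<Sum>j\<in>UNIV. Re (\<omega> $ Inl j * X $ Inl j)) + (\<Sum>l\<in>UNIV. Re (\<omega> $ Inr l * X $ Inr l))" for X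
    by (simp add: pairing_def sum_UNIV_sum_type)
  {
    assume \<omega>: "\<omega> \<in> conormal_space (quadric A) p"
    have tangent: "(\<Sum>j\<in>UNIV. Re (\<omega> $ Inl j * (\<i> * of_real (y j) + of_real (2 * ((A j *v w_part p) \<bullet> \<eta>))))) +
        (\<Sum>l\<in>UNIV. Re (\<omega> $ Inr l * \<eta> $ l)) = 0" for y :: "'k \<Rightarrow> real" and \<eta>
    proof -
      define X :: "complex^('k + 'm)" where "X = (\<chi> l. case l of
          Inl j \<Rightarrow> \<i> * of_real (y j) + of_real (2 * ((A j *v w_part p) \<bullet> \<eta>)) | Inr l \<Rightarrow> \<eta> $ l)"
      define Y :: "complex^('k + 'm)" where "Y = (\<chi> l. case l of
          Inl j \<Rightarrow> of_real ((A j *v \<eta>) \<bullet> \<eta>) | Inr l \<Rightarrow> 0)"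
      \<comment> \<open>The term \<open>Y\<close> compensates the second-order part of the quadratic
        form, so that the curve lies exactly on the quadric.\<close>
      define \<gamma> where "\<gamma> t = p + t *\<^sub>R X + t\<^sup>2 *\<^sub>R Y" for t
      have "\<gamma> t \<in> quadric A" for t
      proof -
        have w: "w_part (\<gamma> t) = w_part p + t *\<^sub>R \<eta>"
          by (simp add: vec_eq_iff \<gamma>_def X_def Y_def)
        have "(A j *v w_part p) \<bullet> \<eta> = (A j *v \<eta>) \<bullet> w_part p" for j
          unfolding inner_adj[of "A j" \<eta>] A_adj by (rule inner_commute)
        then have "(A j *v w_part (\<gamma> t)) \<bullet> w_part (\<gamma> t) =
            (A j *v w_part p) \<bullet> w_part p + t * (2 * ((A j *v w_part p) \<bullet> \<eta>)) + t\<^sup>2 * ((A j *v \<eta>) \<bullet> \<eta>)" for j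
          unfolding w by (simp add: matrix_vector_right_distrib mat_vec_scaleR_right inner_add_left
              inner_add_right power2_eq_square algebra_simps)
        moreover have "Re (\<gamma> t $ Inl j) = Re (p $ Inl j) + t * (2 * ((A j *v w_part p) \<bullet> \<eta>)) + t\<^sup>2 * ((A j *v \<eta>) \<bullet> \<eta>)" for j
          by (simp add: \<gamma>_def X_def Y_def)
        moreover have "Re (p $ Inl j) = (A j *v w_part p) \<bullet> w_part p" for j
          using p by (simp add: quadric_def quadric_rho_eq)
        ultimately show ?thesis by (simp add: quadric_def quadric_rho_eq)
      qed
      moreover have "(\<gamma> has_vector_derivative X) (at 0)"
      proof -
        have "(\<gamma> has_vector_derivative (0 + (0 *\<^sub>R 0 + 1 *\<^sub>R X) + (0\<^sup>2 *\<^sub>R 0 + (2 * 0) *\<^sub>R Y))) (at 0)"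
          unfolding \<gamma>_def[abs_def]
          by (intro has_vector_derivative_add has_vector_derivative_scaleR has_vector_derivative_const)
             (auto intro!: derivative_eq_intros)
        then show ?thesis by simp
      qed
      ultimately have "X \<in> tangent_vectors (quadric A) p"
        unfolding tangent_vectors_def by (auto intro!: exI[of _ \<gamma>] simp: \<gamma>_def)
      then have "Re (pairing \<omega> X) = 0" using \<omega> by (simp add: conormal_space_def)
      then show ?thesis unfolding pairing_split X_def by simp
    qed
    have im: "Im (\<omega> $ Inl j) = 0" for j
    proof -
      have "(\<Sum>i\<in>UNIV. Re (\<omega> $ Inl i * (\<i> * of_real (if i = j then 1 else 0)))) = 0"
        using tangent[of "\<lambda>i. if i = j then 1 else 0" 0] by simp
      moreover have "Re (\<omega> $ Inl i * (\<i> * of_real (if i = j then 1 else 0))) = (if i = j then - Im (\<omega> $ Inl j) else 0)" for i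
        by simp
      ultimately show ?thesis by simp
    qed
    moreover have "\<omega> $ Inr l = - 2 * (\<Sum>j\<in>UNIV. \<omega> $ Inl j * cnj ((A j *v w_part p) $ l))" for l
    proof -
      define s where "s = (\<Sum>j\<in>UNIV. \<omega> $ Inl j * cnj ((A j *v w_part p) $ l))"
      have "Re ((2 * s + \<omega> $ Inr l) * c) = 0" for c
      proof -
        have "(A j *v w_part p) \<bullet> axis l c = Re (cnj ((A j *v w_part p) $ l) * c)" for j
          by (simp add: inner_axis inner_complex_def)
        then have "(\<Sum>j\<in>UNIV. Re (\<omega> $ Inl j) * (2 * Re (cnj ((A j *v w_part p) $ l) * c))) +
            (\<Sum>i\<in>UNIV. Re (\<omega> $ Inr i * axis l c $ i)) = 0"
          using tangent[of "\<lambda>_. 0" "axis l c"] by simp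
        moreover have "(\<Sum>i\<in>UNIV. Re (\<omega> $ Inr i * axis l c $ i)) = Re (\<omega> $ Inr l * c)"
        proof -
          have "Re (\<omega> $ Inr i * axis l c $ i) = (if i = l then Re (\<omega> $ Inr l * c) else 0)" for i
            by (simp add: axis_def)
          then show ?thesis by simp
        qed
        moreover have "(\<Sum>j\<in>UNIV. Re (\<omega> $ Inl j) * (2 * Re (cnj ((A j *v w_part p) $ l) * c))) = Re (2 * s * c)"
        proof -
          have "Re (\<omega> $ Inl j) * (2 * Re (cnj ((A j *v w_part p) $ l) * c)) =
              Re (2 * (\<omega> $ Inl j * cnj ((A j *v w_part p) $ l)) * c)" for j
            using im[of j] by (simp add: algebra_simps)
          then have "(\<Sum>j\<in>UNIV. Re (\<omega> $ Inl j) * (2 * Re (cnj ((A j *v w_part p) $ l) * c))) =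
              Re (\<Sum>j\<in>UNIV. 2 * (\<omega> $ Inl j * cnj ((A j *v w_part p) $ l)) * c)"
            by (simp only: Re_sum)
          also have "(\<Sum>j\<in>UNIV. 2 * (\<omega> $ Inl j * cnj ((A j *v w_part p) $ l)) * c) = 2 * s * c"
            by (simp only: s_def sum_distrib_left sum_distrib_right)
          finally show ?thesis .
        qed
        ultimately show ?thesis by (simp only: distrib_right plus_complex.sel)
      qed
      from this[of 1] this[of \<i>] have "2 * s + \<omega> $ Inr l = 0" by (simp add: complex_eq_iff)
      then have "\<omega> $ Inr l = - (2 * s)" by (rule add_eq_0_iff[THEN iffD1])
      then show ?thesis unfolding s_def by (simp only: mult_minus_left)
    qed
    ultimately show "(\<forall>j. Im (\<omega> $ Inl j) = 0) \<and>
      (\<forall>l. \<omega> $ Inr l = - 2 * (\<Sum>j\<in>UNIV. \<omega> $ Inl j * cnj ((A j *v w_part p) $ l)))" by blast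
  }
  assume \<omega>: "(\<forall>j. Im (\<omega> $ Inl j) = 0) \<and>
    (\<forall>l. \<omega> $ Inr l = - 2 * (\<Sum>j\<in>UNIV. \<omega> $ Inl j * cnj ((A j *v w_part p) $ l)))"
  show "\<omega> \<in> conormal_space (quadric A) p"
    unfolding conormal_space_def
  proof (intro CollectI ballI)
    fix X assume "X \<in> tangent_vectors (quadric A) p"
    then obtain \<gamma> where \<gamma>: "\<gamma> 0 = p" "\<And>t. \<gamma> t \<in> quadric A" "(\<gamma> has_vector_derivative X) (at 0)"
      unfolding tangent_vectors_def by blast
    have X: "Re (X $ Inl j) = 2 * ((A j *v w_part p) \<bullet> w_part X)" for j
    proof -
      have "((\<lambda>t. quadric_rho A j (\<gamma> t)) has_derivative
          (\<lambda>h. Re ((h *\<^sub>R X) $ Inl j) - 2 * ((A j *v w_part p) \<bullet> w_part (h *\<^sub>R X)))) (at 0)"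
        using has_derivative_compose[OF \<gamma>(3)[unfolded has_vector_derivative_def] quadric_rho_has_derivative[of j "\<gamma> 0" UNIV]]
        by (simp add: \<gamma>(1))
      moreover have "((\<lambda>t. quadric_rho A j (\<gamma> t)) has_derivative (\<lambda>h. 0)) (at 0)"
        using \<gamma>(2) by (simp add: quadric_def)
      ultimately have "(\<lambda>h. Re ((h *\<^sub>R X) $ Inl j) - 2 * ((A j *v w_part p) \<bullet> w_part (h *\<^sub>R X))) = (\<lambda>h. 0)"
        by (rule has_derivative_unique)
      from fun_cong[OF this, of 1] show ?thesis by simp
    qed
    have "Re (\<omega> $ Inr l * X $ Inr l) = - (\<Sum>j\<in>UNIV. 2 * Re (\<omega> $ Inl j) * Re (cnj ((A j *v w_part p) $ l) * X $ Inr l))" for l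
    proof -
      have "\<omega> $ Inr l * X $ Inr l = - (\<Sum>j\<in>UNIV. 2 * (\<omega> $ Inl j * (cnj ((A j *v w_part p) $ l) * X $ Inr l)))"
        using \<omega> by (simp add: sum_distrib_left sum_distrib_right sum_negf mult.assoc)
      moreover have "Re (2 * (\<omega> $ Inl j * z)) = 2 * Re (\<omega> $ Inl j) * Re z" for j z
        using \<omega> by simp
      ultimately show ?thesis by (simp only: uminus_complex.sel Re_sum)
    qed
    then have "(\<Sum>l\<in>UNIV. Re (\<omega> $ Inr l * X $ Inr l)) =
        - (\<Sum>l\<in>UNIV. \<Sum>j\<in>UNIV. 2 * Re (\<omega> $ Inl j) * Re (cnj ((A j *v w_part p) $ l) * X $ Inr l))"
      by (simp only: sum_negf)
    also have "(\<Sum>l\<in>UNIV. \<Sum>j\<in>UNIV. 2 * Re (\<omega> $ Inl j) * Re (cnj ((A j *v w_part p) $ l) * X $ Inr l)) =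
        (\<Sum>j\<in>UNIV. \<Sum>l\<in>UNIV. 2 * Re (\<omega> $ Inl j) * Re (cnj ((A j *v w_part p) $ l) * X $ Inr l))"
      by (rule sum.swap)
    also have "\<dots> = (\<Sum>j\<in>UNIV. 2 * Re (\<omega> $ Inl j) * ((A j *v w_part p) \<bullet> w_part X))"
      by (simp add: inner_vec_def inner_complex_def sum_distrib_left)
    also have "\<dots> = (\<Sum>j\<in>UNIV. Re (\<omega> $ Inl j * X $ Inl j))"
      using \<omega> by (intro sum.cong) (simp_all add: X)
    finally show "Re (pairing \<omega> X) = 0" by (simp add: pairing_split)
  qed
qed

end

section \<open>Stationary discs from a stable factorization\<close>

lemma pencil_affine:
  fixes X :: "complex^'m^'m"
  shows "(u + c *s r) - \<zeta> *s (X *v (u + c *s r)) = u - \<zeta> *s (X *v u) + c *s (r - \<zeta> *s (X *v r))"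
  unfolding matrix_vector_right_distrib mat_vec_scale by (simp add: vec_eq_iff algebra_simps)

text \<open>The discs depend on the solvent only through these identities and the decay of its
  powers; how it arises from the moments is irrelevant here.\<close>

locale stable_factorization =
  fixes P H K X :: "complex^'m::finite^'m"
  assumes K_adj: "adj K = K" and K_inv: "invertible K"
    and P_eq: "P = - (K ** X)" and H_eq: "H = K + adj X ** K ** X"
    and stable: "\<And>u. (\<lambda>n. matpow X n *v u) \<longlonglongrightarrow> 0"
begin

text \<open>Iteration gives \<open>u = \<zeta> ^ n *s (matpow X n *v u)\<close> for all
  \<open>n\<close>, where the scalar is bounded by 1 and the orbit decays. Thus
  \<open>1 - \<zeta> X\<close> is injective on the whole closed disc.\<close>

lemma no_unimodular_fixed_vector:
  assumes "norm \<zeta> \<le> 1" "u = \<zeta> *s (X *v u)"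
  shows "u = 0"
proof -
  have iter: "u = \<zeta> ^ n *s (matpow X n *v u)" for n
  proof (induction n)
    case (Suc n)
    have "u = \<zeta> *s (X *v u)" by (fact assms(2))
    also have "\<dots> = \<zeta> *s (X *v (\<zeta> ^ n *s (matpow X n *v u)))" using Suc.IH by simp
    also have "\<dots> = \<zeta> ^ Suc n *s (matpow X (Suc n) *v u)"
      by (simp add: mat_vec_scale matrix_vector_mul_assoc)
    finally show ?case .
  qed simp
  have "norm (u $ i) \<le> norm ((matpow X n *v u) $ i)" for n i
  proof -
    have "norm (u $ i) = norm \<zeta> ^ n * norm ((matpow X n *v u) $ i)"
      by (subst iter[of n]) (simp add: norm_mult norm_power)
    also have "\<dots> \<le> 1 * norm ((matpow X n *v u) $ i)"
      using assms(1) by (intro mult_right_mono power_le_one) auto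
    finally show ?thesis by simp
  qed
  then have ev: "\<forall>\<^sub>F n in sequentially. norm (u $ i) \<le> norm ((matpow X n *v u) $ i)" for i
    by (intro always_eventually allI)
  have lim: "(\<lambda>n. norm ((matpow X n *v u) $ i)) \<longlonglongrightarrow> 0" for i
    using tendsto_norm[OF tendsto_vec_nth[OF stable[of u], of i]] by simp
  have "norm (u $ i) \<le> 0" for i
    by (rule tendsto_lowerbound[OF lim ev]) simp
  then show ?thesis by (simp add: vec_eq_iff)
qed

definition pencil :: "complex \<Rightarrow> complex^'m^'m" where
  "pencil \<zeta> = (\<chi> i j. (if i = j then 1 else 0) - \<zeta> * X $ i $ j)"

lemma pencil_mult: "pencil \<zeta> *v u = u - \<zeta> *s (X *v u)"
  by (simp add: vec_eq_iff pencil_def matrix_vector_mult_def left_diff_distrib sum_subtractf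
      sum_distrib_left mult.assoc if_distrib[of "\<lambda>t. t * _"] cong: if_cong)

lemma pencil_invertible: "norm \<zeta> \<le> 1 \<Longrightarrow> invertible (pencil \<zeta>)"
  by (rule invertible_if_injective, rule no_unimodular_fixed_vector) (simp_all add: pencil_mult)

definition res :: "complex \<Rightarrow> complex^'m^'m" where
  "res \<zeta> = cramer_inverse (pencil \<zeta>)"

lemma res_eq:
  assumes "norm \<zeta> \<le> 1"
  shows "res \<zeta> *v u = u + \<zeta> *s (X *v (res \<zeta> *v u))"
proof -
  have "pencil \<zeta> *v (res \<zeta> *v u) = u"
    unfolding res_def by (simp add: matrix_vector_mul_assoc cramer_inverse(1)[OF pencil_invertible[OF assms]])
  then show ?thesis by (simp add: pencil_mult algebra_simps)
qed

lemma res_unique: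
  assumes "norm \<zeta> \<le> 1" "q - \<zeta> *s (X *v q) = u"
  shows "q = res \<zeta> *v u"
proof -
  have "res \<zeta> *v (pencil \<zeta> *v q) = q"
    unfolding res_def by (simp add: matrix_vector_mul_assoc cramer_inverse(2)[OF pencil_invertible[OF assms(1)]])
  then show ?thesis using assms(2) by (simp add: pencil_mult)
qed

lemma res_commute:
  assumes "norm \<zeta> \<le> 1"
  shows "res \<zeta> *v (X *v u) = X *v (res \<zeta> *v u)"
proof (rule res_unique[OF assms, symmetric])
  have "X *v (res \<zeta> *v u) - \<zeta> *s (X *v (X *v (res \<zeta> *v u))) =
      X *v (res \<zeta> *v u - \<zeta> *s (X *v (res \<zeta> *v u)))"
    by (simp add: matrix_vector_mult_diff_distrib mat_vec_scale)
  also have "res \<zeta> *v u - \<zeta> *s (X *v (res \<zeta> *v u)) = u"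
    using res_eq[OF assms, of u] by (metis add_diff_cancel_right')
  finally show "X *v (res \<zeta> *v u) - \<zeta> *s (X *v (X *v (res \<zeta> *v u))) = X *v u" .
qed

definition res_domain :: "complex set" where
  "res_domain = {\<zeta>. det (pencil \<zeta>) \<noteq> 0}"

lemma holomorphic_subring: "function_subring {f. f holomorphic_on S}"
  unfolding function_subring_def by (auto intro: holomorphic_intros)

lemma pencil_holomorphic: "(\<lambda>\<zeta>. pencil \<zeta> $ i $ j) holomorphic_on S"
  unfolding pencil_def vec_lambda_beta by (intro holomorphic_intros)

lemma det_pencil_holomorphic: "(\<lambda>\<zeta>. det (pencil \<zeta>)) holomorphic_on S"
  using subring_det[OF holomorphic_subring[of S], of pencil] pencil_holomorphic by simp

text \<open>Invertibility of the pencil is an open condition, so the resolvent is holomorphic across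
  the circle. This provides the derivative of \<open>w\<close> at the boundary point 1.\<close>

lemma res_domain: "open res_domain" "cball 0 1 \<subseteq> res_domain"
proof -
  show "open res_domain"
    unfolding res_domain_def
    by (intro open_Collect_neq holomorphic_on_imp_continuous_on[OF det_pencil_holomorphic] continuous_on_const)
  show "cball 0 1 \<subseteq> res_domain"
    unfolding res_domain_def using pencil_invertible invertible_det_nz by fastforce
qed

lemma res_entry_holomorphic: "(\<lambda>\<zeta>. res \<zeta> $ i $ j) holomorphic_on res_domain"
proof -
  have "(\<lambda>\<zeta>. inverse (det (pencil \<zeta>))) holomorphic_on res_domain"
    by (intro holomorphic_on_inverse det_pencil_holomorphic) (simp add: res_domain_def)
  then show ?thesis
    using subring_cramer_inverse[OF holomorphic_subring[of res_domain], of pencil] pencil_holomorphic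
    unfolding res_def by simp
qed

lemma res_holomorphic: "(\<lambda>\<zeta>. (res \<zeta> *v u) $ i) holomorphic_on res_domain"
  using subring_mat_vec_mult[OF holomorphic_subring[of res_domain], of res "\<lambda>_. u" i] res_entry_holomorphic
  by simp

lemma res_disc_algebra: "(\<lambda>\<zeta>. (res \<zeta> *v u) $ i) \<in> disc_algebra"
proof -
  have "ball 0 1 \<subseteq> res_domain" using res_domain(2) ball_subset_cball by blast
  then show ?thesis
    unfolding disc_algebra_def using res_holomorphic[of u i] res_domain(2)
    by (auto intro: holomorphic_on_imp_continuous_on holomorphic_on_subset)
qed

lemma res_entry_disc_algebra: "(\<lambda>\<zeta>. res \<zeta> $ i $ j) \<in> disc_algebra"
proof -
  have "ball 0 1 \<subseteq> res_domain" using res_domain(2) ball_subset_cball by blast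
  then show ?thesis
    unfolding disc_algebra_def using res_entry_holomorphic[of i j] res_domain(2)
    by (auto intro: holomorphic_on_imp_continuous_on holomorphic_on_subset)
qed

lemma cip_res_disc_algebra: "(\<lambda>\<zeta>. cip (M *v (res \<zeta> *v u)) q) \<in> disc_algebra"
  unfolding cip_sum matrix_vector_mult_def[of M] vec_lambda_beta
  by (rule disc_algebra_intros(5), rule disc_algebra_intros(4), rule disc_algebra_intros(5),
      rule disc_algebra_intros(4)) (rule disc_algebra_intros(2) res_disc_algebra)+

lemma adj_P: "adj P = - (adj X ** K)"
  by (simp only: P_eq adj_minus adj_mult K_adj)

lemma symbol_factor:
  assumes "norm \<zeta> = 1"
  shows "\<zeta> *s (P *v u) + cnj \<zeta> *s (adj P *v u) + H *v u =
    K *v (u - \<zeta> *s (X *v u)) - cnj \<zeta> *s (adj X *v (K *v (u - \<zeta> *s (X *v u))))"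
proof -
  have z: "cnj \<zeta> * \<zeta> = 1" using assms by (simp add: mult.commute complex_norm_square[symmetric])
  have e: "cnj \<zeta> *s (\<zeta> *s q) = q" for q :: "complex^'m" by (simp add: z)
  show ?thesis
    unfolding adj_P unfolding P_eq H_eq
    by (simp only: mat_vec_minus_left matrix_vector_mult_add_rdistrib matrix_vector_mult_diff_distrib
        mat_vec_scale matrix_vector_mul_assoc[symmetric] vec.scale_right_diff_distrib e
        vec.scale_minus_right) (simp add: algebra_simps)
qed

text \<open>A solution of the homogeneous equation satisfies
  \<open>(S *v u) \<bullet> w = (S *v (X *v u)) \<bullet> (X *v w)\<close>, and both arguments decay
  under iteration.\<close>

lemma stein_operator_injective:
  assumes "S - adj X ** S ** X = 0"
  shows "S = 0"
proof -
  have step: "(S *v u) \<bullet> w = (S *v (X *v u)) \<bullet> (X *v w)" for u w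
  proof -
    have "S = adj X ** S ** X" using assms by simp
    from arg_cong[OF this, of "\<lambda>M. M *v u"] have "S *v u = adj X *v (S *v (X *v u))"
      by (simp add: matrix_vector_mul_assoc matrix_mul_assoc)
    then show ?thesis using inner_adj[of "adj X" "S *v (X *v u)" w] by simp
  qed
  have iter: "(S *v u) \<bullet> w = (S *v (matpow X n *v u)) \<bullet> (matpow X n *v w)" for u w n
  proof (induction n)
    case (Suc n)
    then show ?case using step[of "matpow X n *v u" "matpow X n *v w"] by (simp add: matrix_vector_mul_assoc)
  qed simp
  have "(\<lambda>n. (S *v (matpow X n *v u)) \<bullet> (matpow X n *v w)) \<longlonglongrightarrow> (S *v 0) \<bullet> 0" for u w
    by (intro tendsto_inner tendsto_mat_vec_const stable)
  then have "(\<lambda>n. (S *v u) \<bullet> w) \<longlonglongrightarrow> 0" for u w unfolding iter[symmetric] by simp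
  then have "(S *v u) \<bullet> w = 0" for u w by (simp add: LIMSEQ_const_iff)
  then have "S *v u = 0" for u using inner_eq_zero_iff by blast
  then show ?thesis by (simp add: matrix_eq)
qed

text \<open>An injective linear endomorphism of a finite-dimensional space is surjective. The
  adjoint of a solution solves the same equation, so uniqueness makes it Hermitian.\<close>

lemma stein_equation:
  assumes "adj B = B"
  obtains S where "adj S = S" "S - adj X ** S ** X = B"
proof -
  let ?T = "\<lambda>S. S - adj X ** S ** X"
  have lin: "linear ?T"
    by (rule linearI)
       (simp_all add: mat_add_rdistrib matrix_add_ldistrib mat_scaleR_left mat_scaleR_right scaleR_diff_right)
  have inj: "inj ?T"
    using stein_operator_injective by (simp add: linear_injective_0[OF lin])
  then have "surj ?T" by (rule linear_injective_imp_surjective[OF lin]) simp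
  then obtain S where S: "B = ?T S" unfolding surj_def by blast
  have "?T (adj S) = adj (?T S)"
    by (simp add: adj_diff adj_mult matrix_mul_assoc)
  also have "\<dots> = ?T S" using assms unfolding S .
  finally have "adj S = S" using inj unfolding inj_def by blast
  then show ?thesis using that[of S] S by metis
qed

text \<open>With \<open>r = (1 - \<zeta> X)\<^sup>-\<^sup>1 y\<close>, the Stein equation turns \<open>\<langle>B r, r\<rangle>\<close> into the real part of a holomorphic
  function of \<open>\<zeta>\<close> on the circle.\<close>

lemma quadratic_boundary_value:
  assumes S: "adj S = S" "S - adj X ** S ** X = B" and B: "adj B = B" and z: "norm \<zeta> = 1"
    and r: "r = y + \<zeta> *s (X *v r)"
  shows "(B *v (w0 + (\<zeta> - 1) *s r)) \<bullet> (w0 + (\<zeta> - 1) *s r) =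
    Re (cip (B *v w0) w0 + 2 * (\<zeta> - 1) * cip (B *v r) w0 +
      (2 * ((2 - \<zeta>) * cip (S *v r) y - cip ((S ** X) *v r) y) - 2 * cip (S *v y) y))"
proof -
  define a where "a = X *v r"
  define h where "h = cip (S *v r) y"
  define k where "k = cip (S *v a) y"
  define s where "s = (S *v y) \<bullet> y"
  have sym: "(S *v p) \<bullet> q = (S *v q) \<bullet> p" for p q
    using inner_adj[of S p q] S(1) by (simp add: inner_commute)
  have Bsym: "(B *v p) \<bullet> q = (B *v q) \<bullet> p" for p q
    using inner_adj[of B p q] B by (simp add: inner_commute)
  have zz: "cnj \<zeta> * \<zeta> = 1" using z by (simp add: mult.commute complex_norm_square[symmetric])
  have scal: "(M *v (c *s p)) \<bullet> (c *s q) = (norm c)\<^sup>2 * ((M *v p) \<bullet> q)" for M and p q :: "complex^'m" and c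
  proof -
    have "cip (M *v (c *s p)) (c *s q) = (c * cnj c) * cip (M *v p) q"
      by (simp add: mat_vec_scale cip_scale_left cip_scale_right)
    also have "c * cnj c = of_real ((norm c)\<^sup>2)" by (rule complex_norm_square[symmetric])
    finally show ?thesis by (simp add: Re_cip[symmetric])
  qed
  have ry: "\<zeta> *s a = r - y" using r by (simp add: a_def algebra_simps)
  have "cip (S *v y) y = of_real s"
  proof -
    have "cnj (cip (S *v y) y) = cip (S *v y) y"
      unfolding cnj_cip using cip_adj[of S y y] S(1) by simp
    then have "Im (cip (S *v y) y) = 0" by (simp add: complex_eq_iff)
    then show ?thesis by (simp add: s_def complex_eq_iff Re_cip)
  qed
  note sy = this
  have "h = of_real s + \<zeta> * k"
  proof -
    have "S *v r = S *v y + \<zeta> *s (S *v a)"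
      using arg_cong[OF r, of "\<lambda>t. S *v t"] by (simp add: a_def matrix_vector_right_distrib mat_vec_scale)
    then show ?thesis by (simp add: h_def k_def cip_add_left cip_scale_left sy)
  qed
  \<comment> \<open>\<open>k\<close> is holomorphic in \<open>\<zeta>\<close>, being
    \<open>cip ((S ** X) *v r) y\<close>. This identity therefore absorbs the factor
    \<open>cnj \<zeta>\<close> that comes from \<open>(norm (\<zeta> - 1))\<^sup>2\<close>.\<close>
  then have k: "k = cnj \<zeta> * (h - of_real s)" using zz by (simp add: mult.assoc[symmetric])
  have "(B *v r) \<bullet> r = (S *v r) \<bullet> r - (S *v a) \<bullet> a"
  proof -
    have "B *v r = S *v r - adj X *v (S *v a)"
      using S(2) by (auto simp: a_def matrix_vector_mult_diff_rdistrib matrix_vector_mul_assoc matrix_mul_assoc)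
    moreover have "(adj X *v (S *v a)) \<bullet> r = (S *v a) \<bullet> a"
      using inner_adj[of "adj X" "S *v a" r] by (simp add: a_def)
    ultimately show ?thesis by (simp add: inner_diff_left)
  qed
  \<comment> \<open>As \<open>\<zeta>\<close> is unimodular, the form of \<open>S\<close> has the
    same value at \<open>a\<close> and at \<open>\<zeta> *s a = r - y\<close>; the terms quadratic
    in \<open>r\<close> then cancel and only real parts of holomorphic terms remain.\<close>
  also have "(S *v a) \<bullet> a = (S *v (r - y)) \<bullet> (r - y)"
    unfolding ry[symmetric] scal using z by simp
  also have "(S *v r) \<bullet> r - (S *v (r - y)) \<bullet> (r - y) = 2 * Re h - s"
    using sym[of y r] by (simp add: h_def s_def Re_cip matrix_vector_mult_diff_distrib inner_diff_left inner_diff_right)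
  finally have Br: "(B *v r) \<bullet> r = 2 * Re h - s" .
  have n: "(norm (\<zeta> - 1))\<^sup>2 = 2 - 2 * Re \<zeta>"
  proof -
    have "(Re \<zeta>)\<^sup>2 + (Im \<zeta>)\<^sup>2 = 1" using z by (simp add: cmod_def)
    then show ?thesis unfolding cmod_power2 by (simp add: power2_eq_square algebra_simps)
  qed
  have "(B *v (w0 + (\<zeta> - 1) *s r)) \<bullet> (w0 + (\<zeta> - 1) *s r) =
      (B *v w0) \<bullet> w0 + 2 * ((B *v ((\<zeta> - 1) *s r)) \<bullet> w0) + (B *v ((\<zeta> - 1) *s r)) \<bullet> ((\<zeta> - 1) *s r)"
    using Bsym[of w0 "(\<zeta> - 1) *s r"] by (simp add: matrix_vector_right_distrib inner_add_left inner_add_right)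
  also have "(B *v ((\<zeta> - 1) *s r)) \<bullet> ((\<zeta> - 1) *s r) = (2 - 2 * Re \<zeta>) * (2 * Re h - s)"
    unfolding scal n Br ..
  also have "\<dots> = Re (2 * ((2 - \<zeta>) * h - k) - 2 * of_real s)"
    unfolding k by (simp add: algebra_simps)
  also have "(B *v w0) \<bullet> w0 = Re (cip (B *v w0) w0)" by (simp add: Re_cip)
  also have "2 * ((B *v ((\<zeta> - 1) *s r)) \<bullet> w0) = Re (2 * (\<zeta> - 1) * cip (B *v r) w0)"
  proof -
    have "(B *v ((\<zeta> - 1) *s r)) \<bullet> w0 = Re ((\<zeta> - 1) * cip (B *v r) w0)"
      by (simp only: Re_cip[symmetric] mat_vec_scale cip_scale_left)
    moreover have "Re (2 * (\<zeta> - 1) * q) = 2 * Re ((\<zeta> - 1) * q)" for q by (simp add: algebra_simps)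
    ultimately show ?thesis by simp
  qed
  finally show ?thesis
    by (simp add: h_def k_def a_def sy matrix_vector_mul_assoc)
qed

text \<open>The Taylor coefficients of the resolvent are extracted one at a time: subtracting the
  value at 0 and dividing by \<open>\<zeta>\<close> replaces a vector \<open>q\<close> by
  \<open>X *v q\<close>, and continuity recovers the value at 0.\<close>

lemma krylov_annihilated_if_resolvent:
  fixes M :: "complex^'m^'m"
  assumes "\<And>\<zeta>. \<zeta> \<in> ball 0 1 \<Longrightarrow> M *v (res \<zeta> *v y) = 0"
  shows "M *v (matpow X n *v y) = 0"
proof -
  have "\<forall>\<zeta>\<in>ball 0 1. M *v (res \<zeta> *v (matpow X n *v y)) = 0" for n
  proof (induction n)
    case 0
    then show ?case using assms by simp
  next
    case (Suc n)
    let ?q = "matpow X n *v y"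
    let ?f = "\<lambda>\<zeta>. M *v (res \<zeta> *v (X *v ?q))"
    have "res 0 *v ?q = ?q" using res_eq[of 0 ?q] by simp
    then have Mq: "M *v ?q = 0" using Suc.IH by (metis centre_in_ball zero_less_one)
    have nz: "?f \<zeta> = 0" if "\<zeta> \<in> ball 0 1" "\<zeta> \<noteq> 0" for \<zeta>
    proof -
      have "\<zeta> *s ?f \<zeta> = M *v (res \<zeta> *v ?q) - M *v ?q"
        using res_eq[of \<zeta> ?q] res_commute[of \<zeta> ?q] that(1)
        by (metis add_diff_cancel_left' dist_0_norm less_imp_le mat_vec_scale matrix_vector_mult_diff_distrib mem_ball)
      then have "\<zeta> *s ?f \<zeta> = 0" using Suc.IH that(1) Mq by simp
      then show ?thesis using that(2) by (simp add: vec_eq_iff)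
    qed
    have "?f 0 $ i = 0" for i
    proof -
      have cont: "continuous_on (ball 0 1) (\<lambda>\<zeta>. ?f \<zeta> $ i)"
      proof -
        have "continuous_on (ball 0 1) (\<lambda>\<zeta>. (res \<zeta> *v (X *v ?q)) $ j)" for j
          using res_disc_algebra[of "X *v ?q" j] unfolding disc_algebra_def
          by (auto intro: holomorphic_on_imp_continuous_on)
        then show ?thesis unfolding matrix_vector_mult_def[of M] vec_lambda_beta
          by (intro continuous_on_sum continuous_on_mult_left)
      qed
      have "((\<lambda>\<zeta>. ?f \<zeta> $ i) \<longlongrightarrow> ?f 0 $ i) (at 0)"
        using cont by (simp add: continuous_on_eq_continuous_at isCont_def)
      moreover have "((\<lambda>\<zeta>. ?f \<zeta> $ i) \<longlongrightarrow> 0) (at 0)"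
      proof (rule tendsto_eventually)
        have "\<forall>\<^sub>F \<zeta> in at 0. \<zeta> \<in> ball 0 1 - {0::complex}"
          by (rule eventually_at_in_open) auto
        then show "\<forall>\<^sub>F \<zeta> in at 0. ?f \<zeta> $ i = 0"
          by (rule eventually_mono) (use nz in auto)
      qed
      ultimately show ?thesis by (rule tendsto_unique[rotated]) simp
    qed
    then have "?f 0 = 0" by (simp add: vec_eq_iff)
    then have "\<forall>\<zeta>\<in>ball 0 1. ?f \<zeta> = 0" using nz by blast
    then show ?case by (simp add: matrix_vector_mul_assoc)
  qed
  from bspec[OF this, of 0 n] have "M *v (res 0 *v (matpow X n *v y)) = 0" by simp
  moreover have "res 0 *v (matpow X n *v y) = matpow X n *v y" using res_eq[of 0 "matpow X n *v y"] by simp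
  ultimately show ?thesis by simp
qed

text \<open>The resolvent identity is iterated finitely often and the remainder decays by stability.
  This treats points of the unit circle together with the interior, without a Neumann
  series.\<close>

lemma resolvent_annihilated_if_krylov:
  fixes M :: "complex^'m^'m"
  assumes "\<And>n. M *v (matpow X n *v y) = 0" and z: "norm \<zeta> \<le> 1"
  shows "M *v (res \<zeta> *v y) = 0"
proof -
  let ?r = "res \<zeta> *v y"
  have iter: "M *v ?r = \<zeta> ^ n *s (M *v (matpow X n *v ?r))" for n
  proof (induction n)
    case (Suc n)
    have "matpow X n *v ?r = matpow X n *v y + \<zeta> *s (matpow X (Suc n) *v ?r)"
      using arg_cong[OF res_eq[OF z, of y], of "\<lambda>t. matpow X n *v t"]
      by (simp add: matrix_vector_right_distrib mat_vec_scale matrix_vector_mul_assoc matrix_mul_assoc matpow_commute)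
    then have "M *v (matpow X n *v ?r) = \<zeta> *s (M *v (matpow X (Suc n) *v ?r))"
      by (simp only: matrix_vector_right_distrib assms(1) mat_vec_scale add_0)
    with Suc.IH show ?case by (simp add: mult.commute)
  qed simp
  have "norm ((M *v ?r) $ i) \<le> 0" for i
  proof (rule tendsto_lowerbound)
    show "(\<lambda>n. norm ((M *v (matpow X n *v ?r)) $ i)) \<longlonglongrightarrow> 0"
      using tendsto_norm[OF tendsto_vec_nth[OF tendsto_mat_vec_const[OF stable[of ?r], of M], of i]] by simp
    have "norm ((M *v ?r) $ i) \<le> norm ((M *v (matpow X n *v ?r)) $ i)" for n
    proof -
      have "norm ((M *v ?r) $ i) = norm \<zeta> ^ n * norm ((M *v (matpow X n *v ?r)) $ i)"
        by (subst iter[of n]) (simp add: norm_mult norm_power)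
      also have "\<dots> \<le> 1 * norm ((M *v (matpow X n *v ?r)) $ i)"
        using z by (intro mult_right_mono power_le_one) auto
      finally show ?thesis by simp
    qed
    then show "\<forall>\<^sub>F n in sequentially. norm ((M *v ?r) $ i) \<le> norm ((M *v (matpow X n *v ?r)) $ i)"
      by (intro always_eventually allI)
  qed simp
  then show ?thesis by (simp add: vec_eq_iff)
qed

text \<open>The formula for \<open>w\<close> contains \<open>v - X *v v\<close>, the parameters
  contain \<open>v\<close>. If the differences vanish, the sequence
  \<open>M *v (matpow X n *v v)\<close> is constant, and it tends to 0.\<close>

lemma krylov_annihilated_shift:
  fixes M :: "complex^'m^'m"
  shows "(\<forall>n. M *v (matpow X n *v (v - X *v v)) = 0) \<longleftrightarrow> (\<forall>n. M *v (matpow X n *v v) = 0)"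
proof -
  have d: "M *v (matpow X n *v (v - X *v v)) = M *v (matpow X n *v v) - M *v (matpow X (Suc n) *v v)" for n
    by (simp add: matrix_vector_mult_diff_distrib matrix_vector_mul_assoc matpow_commute)
  show ?thesis
  proof
    assume "\<forall>n. M *v (matpow X n *v (v - X *v v)) = 0"
    then have "M *v (matpow X (Suc n) *v v) = M *v (matpow X n *v v)" for n using d by simp
    then have const: "M *v (matpow X n *v v) = M *v v" for n
      by (induction n) (simp_all del: matpow.simps(2))
    have "(\<lambda>n. M *v (matpow X n *v v)) \<longlonglongrightarrow> M *v 0"
      by (intro tendsto_mat_vec_const stable)
    then have "M *v v = 0" unfolding const by (simp add: LIMSEQ_const_iff)
    then show "\<forall>n. M *v (matpow X n *v v) = 0" using const by simp
  qed (simp add: d del: matpow.simps(2))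
qed

end

section \<open>Symbols attached to the parameters and the shape of stationary discs\<close>

definition lam_matrix :: "('k::finite \<Rightarrow> complex^'m::finite^'m) \<Rightarrow> complex^'k \<Rightarrow> complex^'m^'m" where
  "lam_matrix A lam = (\<Sum>j\<in>UNIV. \<chi> r s. lam $ j * A j $ r $ s)"

definition c_matrix :: "('k::finite \<Rightarrow> complex^'m::finite^'m) \<Rightarrow> real^'k \<Rightarrow> complex^'m^'m" where
  "c_matrix A c = (\<Sum>j\<in>UNIV. c $ j *\<^sub>R A j)"

definition circle_form :: "('k::finite \<Rightarrow> complex^'m::finite^'m) \<Rightarrow> complex^'k \<Rightarrow> real^'k \<Rightarrow> complex \<Rightarrow> complex^'m^'m" where
  "circle_form A lam c \<zeta> = (\<Sum>j\<in>UNIV. Re (lam $ j * \<zeta> + of_real (c $ j)) *\<^sub>R A j)"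

text \<open>The condition on \<open>(lam, c)\<close> in \<open>param_region\<close> stripped of its
  margin; compactness of the circle recovers a margin in
  \<open>positive_in_param_space\<close>.\<close>

definition positive_on_circle :: "('k::finite \<Rightarrow> complex^'m::finite^'m) \<Rightarrow> complex^'k \<Rightarrow> real^'k \<Rightarrow> bool" where
  "positive_on_circle A lam c \<longleftrightarrow> (\<forall>\<zeta>\<in>sphere 0 1. \<forall>u. u \<noteq> 0 \<longrightarrow> 0 < (circle_form A lam c \<zeta> *v u) \<bullet> u)"

lemmas scaleR_complex = scaleR_conv_of_real[where 'a = complex]

lemma mat_sum_vec: "(\<Sum>i\<in>I. M i) *v u = (\<Sum>i\<in>I. M i *v (u :: complex^'m))"
  by (induction I rule: infinite_finite_induct) (simp_all add: matrix_vector_mult_add_rdistrib)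

lemma adj_sum: "adj (\<Sum>i\<in>I. M i) = (\<Sum>i\<in>I. adj (M i))"
  by (induction I rule: infinite_finite_induct) (simp_all add: adj_add, simp_all add: adj_def vec_eq_iff)

lemma lam_matrix_mult: "lam_matrix A lam *v u = (\<Sum>j\<in>UNIV. lam $ j *s (A j *v u))"
proof -
  have "(\<chi> r s. lam $ j * A j $ r $ s) *v u = lam $ j *s (A j *v u)" for j
    by (simp add: vec_eq_iff matrix_vector_mult_def sum_distrib_left mult.assoc)
  then show ?thesis by (simp add: lam_matrix_def mat_sum_vec)
qed

lemma disc_algebra_component:
  assumes "attached_disc M \<phi>"
  shows "(\<lambda>\<zeta>. \<phi> \<zeta> $ i) \<in> disc_algebra"
  using assms unfolding attached_disc_def vec_holomorphic_on_def disc_algebra_def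
  by (auto intro: bounded_linear.continuous_on[OF bounded_linear_vec_nth])

lemma disc_algebra_mat_vec:
  assumes "\<And>i. (\<lambda>\<zeta>. u \<zeta> $ i) \<in> disc_algebra"
  shows "(\<lambda>\<zeta>. (M *v u \<zeta>) $ i) \<in> disc_algebra"
  using subring_mat_vec_mult[OF disc_algebra_subring, of "\<lambda>_. M" u i] assms
    subring_const[OF disc_algebra_subring] by blast

context
  fixes A :: "'k::finite \<Rightarrow> complex^'m::finite^'m"
  assumes A_herm: "\<And>j. hermitian (A j)"
begin

lemma A_self_adj: "adj (A j) = A j"
  using A_herm hermitian_iff_adj by blast

lemma adj_lam_matrix_mult: "adj (lam_matrix A lam) *v u = (\<Sum>j\<in>UNIV. cnj (lam $ j) *s (A j *v u))"
proof -
  have "adj (\<chi> r s. lam $ j * A j $ r $ s) = (\<chi> r s. cnj (lam $ j) * A j $ r $ s)" for j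
    using A_self_adj[of j] by (simp add: adj_def vec_eq_iff)
  then have "adj (lam_matrix A lam) = lam_matrix A (\<chi> j. cnj (lam $ j))"
    by (simp add: lam_matrix_def adj_sum)
  then show ?thesis by (simp add: lam_matrix_mult)
qed

lemma adj_c_matrix: "adj (c_matrix A c) = c_matrix A c"
  by (simp add: c_matrix_def adj_sum adj_scaleR A_self_adj)

lemma circle_form_mult: "circle_form A lam c \<zeta> *v u = (\<Sum>j\<in>UNIV. Re (lam $ j * \<zeta> + of_real (c $ j)) *\<^sub>R (A j *v u))"
  by (simp add: circle_form_def mat_sum_vec mat_vec_scaleR_left)

text \<open>The real part is half the sum of a number and its conjugate, which is the origin of the
  factor 2 in front of \<open>c_matrix\<close> in all symbols.\<close>

lemma symbol_circle_form:
  "\<zeta> *s (lam_matrix A lam *v u) + cnj \<zeta> *s (adj (lam_matrix A lam) *v u) + (2 *\<^sub>R c_matrix A c) *v u =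
    2 *\<^sub>R (circle_form A lam c \<zeta> *v u)"
proof -
  have "(\<zeta> * lam $ j + cnj \<zeta> * cnj (lam $ j) + of_real (2 * c $ j)) * t =
      of_real (2 * Re (lam $ j * \<zeta> + of_real (c $ j))) * t" for j t
  proof -
    have "\<zeta> * lam $ j + cnj \<zeta> * cnj (lam $ j) + of_real (2 * c $ j) = of_real (2 * Re (lam $ j * \<zeta> + of_real (c $ j)))"
      by (simp add: complex_eq_iff algebra_simps)
    then show ?thesis by simp
  qed
  note e = this
  show ?thesis
    unfolding lam_matrix_mult adj_lam_matrix_mult circle_form_mult c_matrix_def vec_eq_iff
  proof
    fix i
    have "(\<zeta> *s (\<Sum>j\<in>UNIV. lam $ j *s (A j *v u)) + cnj \<zeta> *s (\<Sum>j\<in>UNIV. cnj (lam $ j) *s (A j *v u)) +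
        (2 *\<^sub>R (\<Sum>j\<in>UNIV. c $ j *\<^sub>R A j)) *v u) $ i =
      (\<Sum>j\<in>UNIV. (\<zeta> * lam $ j + cnj \<zeta> * cnj (lam $ j) + of_real (2 * c $ j)) * (A j *v u) $ i)"
      by (simp add: mat_vec_scaleR_left mat_sum_vec sum_distrib_left sum.distrib distrib_right mult.assoc
          scaleR_complex)
    also have "\<dots> = (\<Sum>j\<in>UNIV. of_real (2 * Re (lam $ j * \<zeta> + of_real (c $ j))) * (A j *v u) $ i)"
      by (simp only: e)
    also have "\<dots> = (2 *\<^sub>R (\<Sum>j\<in>UNIV. Re (lam $ j * \<zeta> + of_real (c $ j)) *\<^sub>R (A j *v u))) $ i"
    proof -
      have "(\<Sum>j\<in>UNIV. of_real (2 * t j) * (A j *v u) $ i) = (2 *\<^sub>R (\<Sum>j\<in>UNIV. t j *\<^sub>R (A j *v u))) $ i" for t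
        by (simp add: sum_distrib_left scaleR_complex mult.assoc)
      then show ?thesis .
    qed
    finally show "(\<zeta> *s (\<Sum>j\<in>UNIV. lam $ j *s (A j *v u)) + cnj \<zeta> *s (\<Sum>j\<in>UNIV. cnj (lam $ j) *s (A j *v u)) +
        (2 *\<^sub>R (\<Sum>j\<in>UNIV. c $ j *\<^sub>R A j)) *v u) $ i =
      (2 *\<^sub>R (\<Sum>j\<in>UNIV. Re (lam $ j * \<zeta> + of_real (c $ j)) *\<^sub>R (A j *v u))) $ i" .
  qed
qed

lemma positive_on_circle_symbol:
  assumes "positive_on_circle A lam c"
  shows "positive_symbol (lam_matrix A lam) (2 *\<^sub>R c_matrix A c)"
proof
  show "adj (2 *\<^sub>R c_matrix A c) = 2 *\<^sub>R c_matrix A c" by (simp add: adj_scaleR adj_c_matrix)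
  fix \<theta> and u :: "complex^'m" assume "u \<noteq> 0"
  then have "0 < (circle_form A lam c (cis \<theta>) *v u) \<bullet> u"
    using assms by (simp add: positive_on_circle_def)
  moreover have "symbol (lam_matrix A lam) (2 *\<^sub>R c_matrix A c) \<theta> *v u = 2 *\<^sub>R (circle_form A lam c (cis \<theta>) *v u)"
    using symbol_circle_form[of "cis \<theta>" lam u c] by (simp add: symbol_mult cis_cnj)
  ultimately show "0 < (symbol (lam_matrix A lam) (2 *\<^sub>R c_matrix A c) \<theta> *v u) \<bullet> u" by simp
qed

abbreviation "disc_solvent lam c \<equiv> solvent (lam_matrix A lam) (2 *\<^sub>R c_matrix A c)"

lemma positive_on_circle_factorization:
  assumes "positive_on_circle A lam c"
  shows "\<exists>K. stable_factorization (lam_matrix A lam) (2 *\<^sub>R c_matrix A c) K (disc_solvent lam c)"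
proof -
  interpret positive_symbol "lam_matrix A lam" "2 *\<^sub>R c_matrix A c"
    using assms by (rule positive_on_circle_symbol)
  obtain K where "adj K = K" "invertible K" "lam_matrix A lam = - (K ** X)" "2 *\<^sub>R c_matrix A c = K + adj X ** K ** X"
    by (rule factorization)
  then show ?thesis by (intro exI[of _ K] stable_factorization.intro solvent_stable)
qed

lemma sum_del_form:
  "(\<Sum>j\<in>UNIV. a j *\<^sub>R del_form (quadric_rho A j) p) $ Inl i = of_real (a i / 2)"
  "(\<Sum>j\<in>UNIV. a j *\<^sub>R del_form (quadric_rho A j) p) $ Inr l =
     - cnj (((\<Sum>j\<in>UNIV. a j *\<^sub>R A j) *v w_part p) $ l)"
proof -
  have "(\<Sum>j\<in>UNIV. a j *\<^sub>R del_form (quadric_rho A j) p) $ Inl i = (\<Sum>j\<in>UNIV. if j = i then of_real (a i / 2) else 0)"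
    unfolding sum_component
    by (intro sum.cong) (auto simp: del_form_quadric_rho[OF A_herm] scaleR_complex)
  then show "(\<Sum>j\<in>UNIV. a j *\<^sub>R del_form (quadric_rho A j) p) $ Inl i = of_real (a i / 2)" by simp
  show "(\<Sum>j\<in>UNIV. a j *\<^sub>R del_form (quadric_rho A j) p) $ Inr l =
     - cnj (((\<Sum>j\<in>UNIV. a j *\<^sub>R A j) *v w_part p) $ l)"
    by (simp add: del_form_quadric_rho[OF A_herm] mat_sum_vec mat_vec_scaleR_left sum_negf scaleR_complex)
qed

lemma sum_del_form_conormal:
  assumes "p \<in> quadric A"
  shows "(\<Sum>j\<in>UNIV. a j *\<^sub>R del_form (quadric_rho A j) p) \<in> conormal_space (quadric A) p"
  unfolding quadric_conormal_iff[OF A_herm assms] sum_del_form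
  by (simp add: mat_sum_vec mat_vec_scaleR_left scaleR_complex sum_distrib_left sum_negf)

text \<open>On the circle the \<open>w\<close>-coefficients of the lift are the negative conjugates
  of \<open>circle_form\<close> applied to \<open>w\<close>. Through the factorization, cancelling
  the outer factor exhibits \<open>e = (1 - \<zeta> X) w\<close> as \<open>\<zeta>\<close> times a
  conjugate of disc algebra functions, where the power of \<open>\<zeta>\<close> reflects the
  permitted pole. Hence \<open>e\<close> is affine in \<open>\<zeta>\<close>, and value and
  derivative at 1 determine its two coefficients.\<close>

lemma stationary_w_part:
  assumes fact: "stable_factorization (lam_matrix A lam) (2 *\<^sub>R c_matrix A c) K X"
    and data: "stationary_data A (lam, c, w0, y0, v) \<phi> \<omega>" and \<zeta>: "\<zeta> \<in> cball 0 1"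
  shows "w_part (\<phi> \<zeta>) = w0 + (\<zeta> - 1) *s (stable_factorization.res X \<zeta> *v (v - X *v v))"
proof -
  interpret stable_factorization "lam_matrix A lam" "2 *\<^sub>R c_matrix A c" K X by (fact fact)
  let ?P = "lam_matrix A lam" and ?H = "2 *\<^sub>R c_matrix A c"
  have att: "attached_disc (quadric A) \<phi>" and lift: "is_lift (quadric A) \<phi> \<omega>"
    and w1: "w_part (\<phi> 1) = w0"
    and der: "((\<lambda>\<zeta>. w_part (\<phi> \<zeta>)) has_derivative (\<lambda>h. h *s v)) (at 1 within cball 0 1)"
    and bd: "\<And>\<zeta>. \<zeta> \<in> sphere 0 1 \<Longrightarrow> \<omega> \<zeta> = (\<Sum>j\<in>UNIV. Re (lam $ j * \<zeta> + of_real (c $ j)) *\<^sub>R del_form (quadric_rho A j) (\<phi> \<zeta>))"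
    using data unfolding stationary_data_def by auto
  define w where "w \<zeta> = w_part (\<phi> \<zeta>)" for \<zeta>
  have wDA: "(\<lambda>\<zeta>. w \<zeta> $ i) \<in> disc_algebra" for i
    unfolding w_def w_part_nth by (rule disc_algebra_component[OF att])
  obtain g where g: "vec_holomorphic_on g (ball 0 1)" "\<And>\<zeta>. \<zeta> \<in> ball 0 1 - {0} \<Longrightarrow> g \<zeta> = \<zeta> *s \<omega> \<zeta>"
    using lift unfolding is_lift_def extends_holomorphically_def by blast
  define \<Omega> where "\<Omega> i \<zeta> = (if \<zeta> = 0 then g 0 $ i else \<zeta> * \<omega> \<zeta> $ i)" for i \<zeta>
  have \<Omega>DA: "\<Omega> i \<in> disc_algebra" for i
    unfolding \<Omega>_def[abs_def]
  proof (rule disc_algebra_glue)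
    show "continuous_on (cball 0 1 - {0}) (\<lambda>\<zeta>. \<zeta> * \<omega> \<zeta> $ i)"
      using lift unfolding is_lift_def by (intro continuous_intros) auto
    show "(\<lambda>\<zeta>. g \<zeta> $ i) holomorphic_on ball 0 1" using g(1) by (simp add: vec_holomorphic_on_def)
  qed (simp add: g(2))
  define e where "e \<zeta> = w \<zeta> - \<zeta> *s (X *v w \<zeta>)" for \<zeta>
  have eDA: "(\<lambda>\<zeta>. e \<zeta> $ i) \<in> disc_algebra" for i
  proof -
    have "(\<lambda>\<zeta>. w \<zeta> $ i - \<zeta> * (X *v w \<zeta>) $ i) \<in> disc_algebra"
      by (rule disc_algebra_diff[OF wDA disc_algebra_intros(4)[OF disc_algebra_id disc_algebra_mat_vec[OF wDA]]])
    then show ?thesis by (simp add: e_def)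
  qed
  obtain K' where K': "K' ** K = mat 1" using K_inv invertible_left_inverse by blast
  \<comment> \<open>The conjugate of the adjoint pencil is the transposed pencil, which is
    holomorphic in \<open>\<zeta>\<close>. It is inverted by the transposed resolvent, so cancelling
    it does not leave the disc algebra.\<close>
  define E where "E l \<zeta> = (\<Sum>s\<in>UNIV. res \<zeta> $ s $ l * (- 2 * \<Omega> (Inr s) \<zeta>))" for l \<zeta>
  have EDA: "E l \<in> disc_algebra" for l
    unfolding E_def[abs_def]
    by (rule disc_algebra_intros(5), rule disc_algebra_intros(4)[OF res_entry_disc_algebra],
        rule disc_algebra_intros(4)[OF disc_algebra_intros(2) \<Omega>DA])
  have aff: "\<exists>a b. \<forall>\<zeta>\<in>cball 0 1. e \<zeta> $ i = a + \<zeta> * b" for i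
  proof (rule conjugate_pole_boundary_values_affine[OF eDA])
    show "(\<lambda>\<zeta>. \<Sum>l\<in>UNIV. cnj (K' $ i $ l) * E l \<zeta>) \<in> disc_algebra"
      by (rule disc_algebra_intros(5), rule disc_algebra_intros(4)[OF disc_algebra_intros(2) EDA])
    fix \<zeta> :: complex assume z: "\<zeta> \<in> sphere 0 1"
    then have zz: "\<zeta> * cnj \<zeta> = 1" "\<zeta> \<noteq> 0" "norm \<zeta> \<le> 1" by (auto simp: complex_norm_square[symmetric])
    define q where "q = K *v e \<zeta>"
    have "2 *\<^sub>R (circle_form A lam c \<zeta> *v w \<zeta>) = q - cnj \<zeta> *s (adj X *v q)"
      using symbol_factor[of \<zeta> "w \<zeta>"] z unfolding symbol_circle_form q_def e_def by simp
    then have e1: "(2 *\<^sub>R (circle_form A lam c \<zeta> *v w \<zeta>)) $ s = q $ s - cnj \<zeta> * (\<Sum>t\<in>UNIV. cnj (X $ t $ s) * q $ t)" for s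
      by (simp add: matrix_vector_mult_def adj_def)
    have e2: "\<omega> \<zeta> $ Inr s = - cnj ((circle_form A lam c \<zeta> *v w \<zeta>) $ s)" for s
      unfolding bd[OF z] sum_del_form circle_form_def w_def ..
    have om: "- 2 * \<omega> \<zeta> $ Inr s = cnj (q $ s - cnj \<zeta> * (\<Sum>t\<in>UNIV. cnj (X $ t $ s) * q $ t))" for s
      unfolding e1[symmetric] e2 by (simp add: scaleR_complex)
    have qE: "q $ l = \<zeta> * cnj (E l \<zeta>)" for l
    proof -
      have "(\<Sum>s\<in>UNIV. pencil \<zeta> $ t $ s * res \<zeta> $ s $ l) = (if t = l then 1 else 0)" for t
      proof -
        have "pencil \<zeta> ** res \<zeta> = mat 1"
          unfolding res_def using cramer_inverse(1)[OF pencil_invertible[OF zz(3)]] .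
        then have "(pencil \<zeta> ** res \<zeta>) $ t $ l = mat 1 $ t $ l" by simp
        then show ?thesis by (simp add: matrix_matrix_mult_def mat_def)
      qed
      note inv = this
      have "(\<Sum>s\<in>UNIV. res \<zeta> $ s $ l * (- 2 * \<omega> \<zeta> $ Inr s)) =
          (\<Sum>s\<in>UNIV. res \<zeta> $ s $ l * (\<Sum>t\<in>UNIV. pencil \<zeta> $ t $ s * cnj (q $ t)))"
      proof (intro sum.cong refl)
        fix s
        have "(\<Sum>t\<in>UNIV. pencil \<zeta> $ t $ s * cnj (q $ t)) = cnj (q $ s) - \<zeta> * (\<Sum>t\<in>UNIV. X $ t $ s * cnj (q $ t))"
          by (simp add: pencil_def left_diff_distrib sum_subtractf sum_distrib_left mult.assoc
              if_distrib[of "\<lambda>t. t * _"] cong: if_cong)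
        then show "res \<zeta> $ s $ l * (- 2 * \<omega> \<zeta> $ Inr s) = res \<zeta> $ s $ l * (\<Sum>t\<in>UNIV. pencil \<zeta> $ t $ s * cnj (q $ t))"
          unfolding om by simp
      qed
      also have "\<dots> = (\<Sum>s\<in>UNIV. \<Sum>t\<in>UNIV. pencil \<zeta> $ t $ s * res \<zeta> $ s $ l * cnj (q $ t))"
        by (simp add: sum_distrib_left algebra_simps)
      also have "\<dots> = (\<Sum>t\<in>UNIV. \<Sum>s\<in>UNIV. pencil \<zeta> $ t $ s * res \<zeta> $ s $ l * cnj (q $ t))"
        by (rule sum.swap)
      also have "\<dots> = (\<Sum>t\<in>UNIV. (if t = l then 1 else 0) * cnj (q $ t))"
        by (simp only: sum_distrib_right[symmetric] inv)
      also have "\<dots> = cnj (q $ l)" by (simp add: if_distrib[of "\<lambda>t. t * _"] cong: if_cong)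
      finally have "cnj (q $ l) = (\<Sum>s\<in>UNIV. res \<zeta> $ s $ l * (- 2 * \<omega> \<zeta> $ Inr s))" ..
      moreover have "E l \<zeta> = \<zeta> * (\<Sum>s\<in>UNIV. res \<zeta> $ s $ l * (- 2 * \<omega> \<zeta> $ Inr s))"
        unfolding E_def \<Omega>_def using zz(2) by (simp add: sum_distrib_left algebra_simps)
      ultimately have "E l \<zeta> = \<zeta> * cnj (q $ l)" by simp
      then have "\<zeta> * cnj (E l \<zeta>) = (\<zeta> * cnj \<zeta>) * q $ l" by simp
      then show ?thesis using zz(1) by simp
    qed
    have "e \<zeta> = K' *v q" by (simp add: q_def matrix_vector_mul_assoc K')
    then show "e \<zeta> $ i = \<zeta> * cnj (\<Sum>l\<in>UNIV. cnj (K' $ i $ l) * E l \<zeta>)"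
      by (simp add: matrix_vector_mult_def qE sum_distrib_left mult.left_commute)
  qed
  then obtain a b where ab: "\<And>i \<zeta>. \<zeta> \<in> cball 0 1 \<Longrightarrow> e \<zeta> $ i = a i + \<zeta> * b i" by metis
  have b: "b i = (v - X *v v - X *v w0) $ i" for i
  proof -
    \<comment> \<open>The derivative at 1 is given only within the closed disc, so it is evaluated
      along the inward radius.\<close>
    define \<gamma> where "\<gamma> t = complex_of_real (1 - t)" for t
    have \<gamma>: "\<gamma> ` {0..1} \<subseteq> cball 0 1" by (auto simp: \<gamma>_def simp del: of_real_diff)
    have d\<gamma>: "(\<gamma> has_derivative (\<lambda>h. - of_real h)) (at 0 within {0..1})"
      unfolding \<gamma>_def[abs_def] by (auto intro!: derivative_eq_intros)
    have "((\<lambda>t. w (\<gamma> t)) has_derivative (\<lambda>h. (- of_real h) *s v)) (at 0 within {0..1})"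
    proof (rule has_derivative_in_compose[OF d\<gamma>])
      have "((\<lambda>\<zeta>. w \<zeta>) has_derivative (\<lambda>h. h *s v)) (at 1 within \<gamma> ` {0..1})"
        using der \<gamma> unfolding w_def by (rule has_derivative_subset)
      then show "((\<lambda>\<zeta>. w \<zeta>) has_derivative (\<lambda>h. h *s v)) (at (\<gamma> 0) within \<gamma> ` {0..1})"
        by (simp add: \<gamma>_def)
    qed
    from bounded_linear.has_derivative[OF bounded_linear_vec_nth this]
    have dw: "((\<lambda>t. w (\<gamma> t) $ j) has_vector_derivative - v $ j) (at 0 within {0..1})" for j
      unfolding has_vector_derivative_def by (simp add: scaleR_complex)
    have dX: "((\<lambda>t. (X *v w (\<gamma> t)) $ i) has_vector_derivative - (X *v v) $ i) (at 0 within {0..1})"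
    proof -
      have "((\<lambda>t. \<Sum>j\<in>UNIV. X $ i $ j * w (\<gamma> t) $ j) has_vector_derivative (\<Sum>j\<in>UNIV. X $ i $ j * - v $ j)) (at 0 within {0..1})"
        by (intro has_vector_derivative_sum has_vector_derivative_mult_right dw)
      then show ?thesis by (simp add: matrix_vector_mult_def sum_negf)
    qed
    have d\<gamma>': "(\<gamma> has_vector_derivative -1) (at 0 within {0..1})"
      using d\<gamma> by (simp add: has_vector_derivative_def scaleR_complex)
    have "((\<lambda>t. w (\<gamma> t) $ i - \<gamma> t * (X *v w (\<gamma> t)) $ i) has_vector_derivative
        (- v $ i - (\<gamma> 0 * (- (X *v v) $ i) + (-1) * (X *v w (\<gamma> 0)) $ i))) (at 0 within {0..1})"
      by (intro has_vector_derivative_diff has_vector_derivative_mult dw dX d\<gamma>')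
    then have 1: "((\<lambda>t. e (\<gamma> t) $ i) has_vector_derivative
        (- v $ i - (\<gamma> 0 * (- (X *v v) $ i) + (-1) * (X *v w (\<gamma> 0)) $ i))) (at 0 within {0..1})"
      by (simp only: e_def vector_minus_component vector_smult_component)
    have "((\<lambda>t. a i + \<gamma> t * b i) has_vector_derivative (0 + -1 * b i)) (at 0 within {0..1})"
      by (intro has_vector_derivative_add has_vector_derivative_const has_vector_derivative_mult_left d\<gamma>')
    then have d0: "((\<lambda>t. a i + \<gamma> t * b i) has_vector_derivative - b i) (at 0 within {0..1})" by simp
    have 2: "((\<lambda>t. e (\<gamma> t) $ i) has_vector_derivative - b i) (at 0 within {0..1})"
    proof (rule has_vector_derivative_transform[OF _ _ d0])
      show "e (\<gamma> t) $ i = a i + \<gamma> t * b i" if "t \<in> {0..1}" for t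
        using ab \<gamma> that by blast
    qed simp
    have "- b i = - v $ i - (\<gamma> 0 * (- (X *v v) $ i) + (-1) * (X *v w (\<gamma> 0)) $ i)"
      by (rule vector_derivative_unique_within_closed_interval[OF _ _ 2[folded cbox_interval] 1[folded cbox_interval]]) auto
    also have "\<dots> = - (v - X *v v - X *v w0) $ i" by (simp add: \<gamma>_def w_def w1)
    finally show ?thesis by (simp only: neg_equal_iff_equal)
  qed
  have a: "a i = (w0 - v + X *v v) $ i" for i
  proof -
    have "(w0 - X *v w0) $ i = a i + b i"
      using ab[of 1 i] by (simp add: e_def w_def w1)
    then have "a i = (w0 - X *v w0) $ i - b i" by simp
    then show ?thesis unfolding b by simp
  qed
  define r where "r = res \<zeta> *v (v - X *v v)"
  define w' where "w' = w0 + (\<zeta> - 1) *s r"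
  have nz: "norm \<zeta> \<le> 1" using \<zeta> by simp
  have ez: "e \<zeta> = (w0 - v + X *v v) + \<zeta> *s (v - X *v v - X *v w0)"
    using ab[OF \<zeta>] a b by (simp add: vec_eq_iff right_diff_distrib)
  have rr: "r - \<zeta> *s (X *v r) = v - X *v v"
    using res_eq[OF nz, of "v - X *v v"] unfolding r_def by (metis add_diff_cancel_right')
  have "w' - \<zeta> *s (X *v w') = w0 - \<zeta> *s (X *v w0) + (\<zeta> - 1) *s (r - \<zeta> *s (X *v r))"
    unfolding w'_def by (rule pencil_affine)
  also have "\<dots> = e \<zeta>"
    unfolding rr ez by (simp add: vec_eq_iff algebra_simps)
  finally have "w \<zeta> - \<zeta> *s (X *v w \<zeta>) = w' - \<zeta> *s (X *v w')" by (simp add: e_def)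
  then have "w \<zeta> - w' = \<zeta> *s (X *v (w \<zeta> - w'))"
    by (simp add: matrix_vector_mult_diff_distrib vec.scale_right_diff_distrib algebra_simps)
  then have "w \<zeta> - w' = 0" by (rule no_unimodular_fixed_vector[OF nz])
  then show ?thesis by (simp add: w_def w'_def r_def)
qed

end

context
  fixes A :: "'k::finite \<Rightarrow> complex^'m::finite^'m"
  assumes A_herm: "\<And>j. hermitian (A j)"
begin

text \<open>For the forced \<open>w\<close>, the vector \<open>(1 - \<zeta> X) w\<close> is affine
  in \<open>\<zeta>\<close>; by the factorization the symbol applied to \<open>w\<close> is then a
  Laurent polynomial on the circle, and its conjugate continues to a lift with at most a simple pole
  at 0. Stein matrices provide functions \<open>z\<close> with the real boundary values prescribed
  by the quadric.\<close>

lemma stationary_data_exists: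
  assumes fact: "stable_factorization (lam_matrix A lam) (2 *\<^sub>R c_matrix A c) K X"
    and pos: "positive_on_circle A lam c"
  shows "\<exists>\<phi> \<omega>. stationary_data A (lam, c, w0, y0, v) \<phi> \<omega>"
proof -
  interpret stable_factorization "lam_matrix A lam" "2 *\<^sub>R c_matrix A c" K X by (fact fact)
  let ?P = "lam_matrix A lam" and ?H = "2 *\<^sub>R c_matrix A c"
  define y where "y = v - X *v v"
  define r where "r \<zeta> = res \<zeta> *v y" for \<zeta>
  define w where "w \<zeta> = w0 + (\<zeta> - 1) *s r \<zeta>" for \<zeta>
  have "\<exists>S. adj S = S \<and> S - adj X ** S ** X = A j" for j
    using stein_equation[OF A_self_adj[where A = A, OF A_herm]] by metis
  then obtain S where S: "\<And>j. adj (S j) = S j" "\<And>j. S j - adj X ** S j ** X = A j" by metis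
  define z0 where "z0 j \<zeta> = cip (A j *v w0) w0 + 2 * (\<zeta> - 1) * cip (A j *v r \<zeta>) w0 +
      (2 * ((2 - \<zeta>) * cip (S j *v r \<zeta>) y - cip ((S j ** X) *v r \<zeta>) y) - 2 * cip (S j *v y) y)" for j \<zeta>
  \<comment> \<open>The real boundary values leave an imaginary constant free, which is spent on the
    condition at 1.\<close>
  define z where "z j \<zeta> = z0 j \<zeta> + \<i> * of_real (y0 $ j - Im (z0 j 1))" for j \<zeta>
  define \<phi> :: "complex \<Rightarrow> complex^('k + 'm)" where
    "\<phi> \<zeta> = (\<chi> l. case l of Inl j \<Rightarrow> z j \<zeta> | Inr l \<Rightarrow> w \<zeta> $ l)" for \<zeta>
  \<comment> \<open>\<open>\<alpha>\<close>, \<open>\<beta>\<close> and \<open>\<gamma>\<close> are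
    the coefficients of \<open>\<zeta>\<close>, 1 and \<open>cnj \<zeta>\<close> in twice
    \<open>circle_form\<close> applied to \<open>w\<close>, for \<open>\<zeta>\<close> on the
    circle.\<close>
  define \<alpha> where "\<alpha> = ?P *v w0 + K *v y"
  define \<beta> where "\<beta> = ?H *v w0 - K *v y - adj X *v (K *v y)"
  define \<gamma> where "\<gamma> = adj ?P *v w0 + adj X *v (K *v y)"
  define \<omega> :: "complex \<Rightarrow> complex^('k + 'm)" where
    "\<omega> \<zeta> = (\<chi> l. case l of Inl j \<Rightarrow> (lam $ j * \<zeta> + cnj (lam $ j) / \<zeta>) / 4 + of_real (c $ j / 2)
      | Inr l \<Rightarrow> - (1 / 2) * (cnj (\<alpha> $ l) / \<zeta> + cnj (\<beta> $ l) + cnj (\<gamma> $ l) * \<zeta>))" for \<zeta>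
  have w_part: "w_part (\<phi> \<zeta>) = w \<zeta>" for \<zeta> by (simp add: vec_eq_iff \<phi>_def)
  have req: "r \<zeta> = y + \<zeta> *s (X *v r \<zeta>)" if "norm \<zeta> \<le> 1" for \<zeta>
    unfolding r_def by (rule res_eq[OF that])
  have r1: "r 1 = v"
    unfolding r_def by (rule res_unique[symmetric]) (simp_all add: y_def)
  have cipDA: "(\<lambda>\<zeta>. cip (M *v r \<zeta>) q) \<in> disc_algebra" for M q
    unfolding r_def by (rule cip_res_disc_algebra)
  have zDA: "z j \<in> disc_algebra" for j
    unfolding z_def[abs_def] z0_def
    by (intro disc_algebra_intros(3) disc_algebra_diff disc_algebra_intros(4) disc_algebra_intros(2) disc_algebra_id cipDA)
  have wDA: "(\<lambda>\<zeta>. w \<zeta> $ l) \<in> disc_algebra" for l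
  proof -
    have "(\<lambda>\<zeta>. w0 $ l + (\<zeta> - 1) * (res \<zeta> *v y) $ l) \<in> disc_algebra"
      by (rule disc_algebra_intros(3)[OF disc_algebra_intros(2) disc_algebra_intros(4)[OF
            disc_algebra_diff[OF disc_algebra_id disc_algebra_intros(2)] res_disc_algebra]])
    then show ?thesis by (simp only: w_def r_def vector_add_component vector_smult_component)
  qed
  have \<phi>DA: "(\<lambda>\<zeta>. \<phi> \<zeta> $ l) \<in> disc_algebra" for l
    by (cases l) (simp_all add: \<phi>_def zDA wDA)
  have on_quadric: "\<phi> \<zeta> \<in> quadric A" if "\<zeta> \<in> sphere 0 1" for \<zeta>
  proof -
    have n: "norm \<zeta> = 1" using that by simp
    have "(A j *v w \<zeta>) \<bullet> w \<zeta> = Re (z0 j \<zeta>)" for j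
      unfolding w_def z0_def
      by (rule quadratic_boundary_value[OF S A_self_adj[where A = A, OF A_herm] n req]) (simp add: n)
    then show ?thesis by (simp add: quadric_def quadric_rho_eq w_part) (simp add: \<phi>_def z_def)
  qed
  have att: "attached_disc (quadric A) \<phi>"
    unfolding attached_disc_def vec_holomorphic_on_def
  proof (intro conjI allI)
    have "continuous_on (cball 0 1) (\<lambda>\<zeta>. \<chi> l. \<phi> \<zeta> $ l)"
      using \<phi>DA by (intro continuous_on_vec_lambda) (simp add: disc_algebra_def)
    then show "continuous_on (cball 0 1) \<phi>" by simp
    show "(\<lambda>\<zeta>. \<phi> \<zeta> $ l) holomorphic_on ball 0 1" for l using \<phi>DA by (simp add: disc_algebra_def)
  qed (use on_quadric in blast)
  have om_hol: "(\<lambda>\<zeta>. \<omega> \<zeta> $ l) holomorphic_on - {0}" for l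
    by (cases l) (auto simp: \<omega>_def intro!: holomorphic_intros)
  have boundary: "\<omega> \<zeta> = (\<Sum>j\<in>UNIV. Re (lam $ j * \<zeta> + of_real (c $ j)) *\<^sub>R del_form (quadric_rho A j) (\<phi> \<zeta>))"
    if "\<zeta> \<in> sphere 0 1" for \<zeta>
  proof -
    have n: "norm \<zeta> = 1" using that by simp
    then have zz: "\<zeta> * cnj \<zeta> = 1" "\<zeta> \<noteq> 0" by (auto simp: complex_norm_square[symmetric])
    then have inv: "1 / \<zeta> = cnj \<zeta>" by (simp add: divide_eq_eq mult.commute)
    have cd: "t / \<zeta> = t * cnj \<zeta>" for t using inv by (metis divide_inverse inverse_eq_divide)
    have "\<omega> \<zeta> $ Inl i = of_real (Re (lam $ i * \<zeta> + of_real (c $ i)) / 2)" for i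
      unfolding \<omega>_def vec_lambda_beta cd by (simp add: complex_eq_iff field_simps)
    moreover have "\<omega> \<zeta> $ Inr l = - cnj ((circle_form A lam c \<zeta> *v w \<zeta>) $ l)" for l
    proof -
      have lin: "w \<zeta> - \<zeta> *s (X *v w \<zeta>) = w0 - \<zeta> *s (X *v w0) + (\<zeta> - 1) *s y"
      proof -
        have "w \<zeta> - \<zeta> *s (X *v w \<zeta>) = w0 - \<zeta> *s (X *v w0) + (\<zeta> - 1) *s (r \<zeta> - \<zeta> *s (X *v r \<zeta>))"
          unfolding w_def by (rule pencil_affine)
        also have "r \<zeta> - \<zeta> *s (X *v r \<zeta>) = y"
          using req[of \<zeta>] n by (metis add_diff_cancel_right' order_refl)
        finally show ?thesis .
      qed
      have "2 *\<^sub>R (circle_form A lam c \<zeta> *v w \<zeta>) =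
          (K *v (w0 - \<zeta> *s (X *v w0)) - cnj \<zeta> *s (adj X *v (K *v (w0 - \<zeta> *s (X *v w0))))) +
          (K *v ((\<zeta> - 1) *s y) - cnj \<zeta> *s (adj X *v (K *v ((\<zeta> - 1) *s y))))"
        unfolding symbol_circle_form[where A = A, OF A_herm, symmetric] symbol_factor[OF n] lin
        by (simp only: matrix_vector_right_distrib vec.scale_right_distrib add_diff_add)
      also have "K *v (w0 - \<zeta> *s (X *v w0)) - cnj \<zeta> *s (adj X *v (K *v (w0 - \<zeta> *s (X *v w0)))) =
          \<zeta> *s (?P *v w0) + cnj \<zeta> *s (adj ?P *v w0) + ?H *v w0"
        by (rule symbol_factor[OF n, symmetric])
      also have "K *v ((\<zeta> - 1) *s y) - cnj \<zeta> *s (adj X *v (K *v ((\<zeta> - 1) *s y))) =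
          (\<zeta> - 1) *s (K *v y) - (1 - cnj \<zeta>) *s (adj X *v (K *v y))"
      proof -
        have "cnj \<zeta> * (\<zeta> - 1) = 1 - cnj \<zeta>" using zz(1) by (simp add: algebra_simps)
        then show ?thesis by (simp only: mat_vec_scale vec.scale_scale)
      qed
      finally have "2 * (circle_form A lam c \<zeta> *v w \<zeta>) $ l = \<zeta> * \<alpha> $ l + \<beta> $ l + cnj \<zeta> * \<gamma> $ l"
        by (simp add: vec_eq_iff scaleR_complex \<alpha>_def \<beta>_def \<gamma>_def algebra_simps)
      from this[symmetric] have "(circle_form A lam c \<zeta> *v w \<zeta>) $ l = (1 / 2) * (\<zeta> * \<alpha> $ l + \<beta> $ l + cnj \<zeta> * \<gamma> $ l)"
        by simp
      then show ?thesis unfolding \<omega>_def vec_lambda_beta cd by (simp add: algebra_simps)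
    qed
    ultimately have "\<omega> \<zeta> $ l = (\<Sum>j\<in>UNIV. Re (lam $ j * \<zeta> + of_real (c $ j)) *\<^sub>R del_form (quadric_rho A j) (\<phi> \<zeta>)) $ l" for l
      by (cases l) (simp_all only: sum_del_form[where A = A, OF A_herm] circle_form_def w_part)
    then show ?thesis by (simp add: vec_eq_iff)
  qed
  have "is_lift (quadric A) \<phi> \<omega>"
    unfolding is_lift_def vec_holomorphic_on_def
  proof (intro conjI allI ballI)
    have "continuous_on (cball 0 1 - {0}) (\<lambda>\<zeta>. \<chi> l. \<omega> \<zeta> $ l)"
    proof (rule continuous_on_vec_lambda)
      show "continuous_on (cball 0 1 - {0}) (\<lambda>\<zeta>. \<omega> \<zeta> $ l)" for l
        using holomorphic_on_imp_continuous_on[OF om_hol[of l]] by (rule continuous_on_subset) auto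
    qed
    then show "continuous_on (cball 0 1 - {0}) \<omega>" by simp
    show "(\<lambda>\<zeta>. \<omega> \<zeta> $ l) holomorphic_on ball 0 1 - {0}" for l
      using om_hol[of l] by (rule holomorphic_on_subset) auto
    show "\<exists>\<zeta>\<in>cball 0 1 - {0}. \<omega> \<zeta> \<noteq> 0"
    proof (rule ccontr)
      assume "\<not> ?thesis"
      \<comment> \<open>Vanishing at 1 would make all real coefficients of the boundary values
        vanish there, and with them \<open>circle_form\<close>, against positivity.\<close>
      then have zero: "\<omega> 1 = 0" by auto
      have one: "1 \<in> sphere (0::complex) 1" by simp
      have "\<omega> 1 $ Inl j = of_real (Re (lam $ j * 1 + of_real (c $ j)) / 2)" for j
        unfolding boundary[OF one] by (rule sum_del_form(1)[where A = A, OF A_herm])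
      then have "complex_of_real (Re (lam $ j * 1 + of_real (c $ j)) / 2) = 0" for j
        unfolding zero by (metis zero_index)
      then have "Re (lam $ j * 1 + of_real (c $ j)) / 2 = 0" for j by (simp only: of_real_eq_0_iff)
      then have "Re (lam $ j * 1 + of_real (c $ j)) = 0" for j by simp
      then have "circle_form A lam c 1 = 0" by (simp add: circle_form_def)
      moreover have "axis undefined 1 \<noteq> (0 :: complex^'m)" by (simp add: axis_eq_0_iff)
      ultimately have "0 < ((0 :: complex^'m^'m) *v axis undefined 1) \<bullet> axis undefined 1"
        using pos one unfolding positive_on_circle_def by metis
      then show False by simp
    qed
    show "extends_holomorphically (\<lambda>\<zeta>. \<zeta> *s \<omega> \<zeta>)"
      unfolding extends_holomorphically_def vec_holomorphic_on_def
    proof (intro exI conjI allI ballI)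
      let ?g = "\<lambda>\<zeta>. \<chi> l. case l of Inl j \<Rightarrow> (lam $ j * \<zeta>\<^sup>2 + cnj (lam $ j)) / 4 + of_real (c $ j / 2) * \<zeta>
          | Inr l \<Rightarrow> - (1 / 2) * (cnj (\<alpha> $ l) + cnj (\<beta> $ l) * \<zeta> + cnj (\<gamma> $ l) * \<zeta>\<^sup>2)"
      show "(\<lambda>\<zeta>. ?g \<zeta> $ l) holomorphic_on ball 0 1" for l
        by (cases l) (auto intro!: holomorphic_intros)
      show "?g \<zeta> = \<zeta> *s \<omega> \<zeta>" if "\<zeta> \<in> ball 0 1 - {0}" for \<zeta>
        using that by (auto simp: vec_eq_iff \<omega>_def field_simps power2_eq_square split: sum.split)
    qed
    show "\<omega> \<zeta> \<in> conormal_space (quadric A) (\<phi> \<zeta>)" if "\<zeta> \<in> sphere 0 1" for \<zeta>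
      unfolding boundary[OF that] by (rule sum_del_form_conormal[where A = A, OF A_herm on_quadric[OF that]])
  qed
  moreover have "((\<lambda>\<zeta>. w \<zeta>) has_derivative (\<lambda>h. h *s v)) (at 1 within cball 0 1)"
  proof (rule has_derivative_componentwise_within[THEN iffD2], rule ballI)
    fix b :: "complex^'m" assume "b \<in> Basis"
    then obtain l u where b: "b = axis l u" by (auto simp: Basis_vec_def)
    obtain r' where r': "((\<lambda>\<zeta>. (res \<zeta> *v y) $ l) has_field_derivative r') (at 1)"
      using res_holomorphic[of y l] res_domain by (force simp: holomorphic_on_open subset_iff)
    have "((\<lambda>\<zeta>. w0 $ l + (\<zeta> - 1) * (res \<zeta> *v y) $ l) has_field_derivative
        (0 + (1 * (res 1 *v y) $ l + r' * (1 - 1)))) (at 1)"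
      by (intro DERIV_add DERIV_const DERIV_mult r') (auto intro!: derivative_eq_intros)
    then have "((\<lambda>\<zeta>. w \<zeta> $ l) has_field_derivative v $ l) (at 1)"
    proof -
      have "(res 1 *v y) $ l = v $ l" using r1 by (simp add: r_def)
      moreover have "(\<lambda>\<zeta>. w \<zeta> $ l) = (\<lambda>\<zeta>. w0 $ l + (\<zeta> - 1) * (res \<zeta> *v y) $ l)"
        by (simp only: w_def r_def vector_add_component vector_smult_component)
      moreover note \<open>((\<lambda>\<zeta>. w0 $ l + (\<zeta> - 1) * (res \<zeta> *v y) $ l) has_field_derivative
        (0 + (1 * (res 1 *v y) $ l + r' * (1 - 1)))) (at 1)\<close>
      ultimately show ?thesis by simp
    qed
    then have "((\<lambda>\<zeta>. w \<zeta> $ l) has_derivative (\<lambda>h. h * v $ l)) (at 1 within cball 0 1)"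
      unfolding has_field_derivative_def by (rule has_derivative_at_withinI[THEN has_derivative_eq_rhs]) (simp add: fun_eq_iff mult.commute)
    then have "((\<lambda>\<zeta>. w \<zeta> $ l \<bullet> u) has_derivative (\<lambda>h. (h * v $ l) \<bullet> u)) (at 1 within cball 0 1)"
      by (rule has_derivative_inner_left)
    then show "((\<lambda>\<zeta>. w \<zeta> \<bullet> b) has_derivative (\<lambda>h. (h *s v) \<bullet> b)) (at 1 within cball 0 1)"
      by (simp add: b inner_axis)
  qed
  moreover have "w 1 = w0" by (simp add: w_def)
  moreover have "Im (\<phi> 1 $ Inl j) = y0 $ j" for j by (simp add: \<phi>_def z_def)
  ultimately have "stationary_data A (lam, c, w0, y0, v) \<phi> \<omega>"
    using att boundary by (simp add: stationary_data_def w_part)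
  then show ?thesis by blast
qed

text \<open>\<open>w\<close> is given by a formula; the quadric prescribes the real part of
  \<open>z\<close> on the circle, so two solutions differ by an imaginary constant, fixed at 1. Both
  lifts multiplied by \<open>\<zeta>\<close> extend to disc algebra functions with equal boundary
  values.\<close>

lemma stationary_data_unique:
  assumes fact: "stable_factorization (lam_matrix A lam) (2 *\<^sub>R c_matrix A c) K X"
    and d1: "stationary_data A (lam, c, w0, y0, v) \<phi> \<omega>"
    and d2: "stationary_data A (lam, c, w0, y0, v) \<phi>' \<omega>'"
  shows "\<forall>\<zeta>\<in>cball 0 1. \<phi> \<zeta> = \<phi>' \<zeta>" "\<forall>\<zeta>\<in>cball 0 1 - {0}. \<omega> \<zeta> = \<omega>' \<zeta>"
proof -
  have att: "attached_disc (quadric A) \<phi>" "attached_disc (quadric A) \<phi>'"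
    using d1 d2 by (auto simp: stationary_data_def)
  have w: "w_part (\<phi> \<zeta>) = w_part (\<phi>' \<zeta>)" if "\<zeta> \<in> cball 0 1" for \<zeta>
    using stationary_w_part[where A = A, OF A_herm fact d1 that] stationary_w_part[where A = A, OF A_herm fact d2 that] by simp
  have z: "\<phi> \<zeta> $ Inl j = \<phi>' \<zeta> $ Inl j" if \<zeta>: "\<zeta> \<in> cball 0 1" for \<zeta> j
  proof -
    have re: "Re (\<phi> \<zeta> $ Inl j) = Re (\<phi>' \<zeta> $ Inl j)" if "\<zeta> \<in> sphere 0 1" for \<zeta>
    proof -
      have "\<phi> \<zeta> \<in> quadric A" "\<phi>' \<zeta> \<in> quadric A" using att that unfolding attached_disc_def by auto
      then have "Re (\<phi> \<zeta> $ Inl j) = (A j *v w_part (\<phi> \<zeta>)) \<bullet> w_part (\<phi> \<zeta>)"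
        "Re (\<phi>' \<zeta> $ Inl j) = (A j *v w_part (\<phi>' \<zeta>)) \<bullet> w_part (\<phi>' \<zeta>)"
        by (auto simp: quadric_def quadric_rho_eq)
      then show ?thesis using w[of \<zeta>] that by simp
    qed
    have "(\<lambda>\<zeta>. \<i> * (\<phi> \<zeta> $ Inl j - \<phi>' \<zeta> $ Inl j)) \<in> disc_algebra"
      by (rule disc_algebra_intros(4)[OF disc_algebra_intros(2) disc_algebra_diff[OF
            disc_algebra_component[OF att(1)] disc_algebra_component[OF att(2)]]])
    then obtain k where k: "\<And>\<zeta>. \<zeta> \<in> cball 0 1 \<Longrightarrow> \<i> * (\<phi> \<zeta> $ Inl j - \<phi>' \<zeta> $ Inl j) = k"
      using real_boundary_values_constant[of "\<lambda>\<zeta>. \<i> * (\<phi> \<zeta> $ Inl j - \<phi>' \<zeta> $ Inl j)"] re by auto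
    have "Im (\<phi> 1 $ Inl j) = Im (\<phi>' 1 $ Inl j)" using d1 d2 by (simp add: stationary_data_def)
    then have "\<phi> 1 $ Inl j = \<phi>' 1 $ Inl j" using re[of 1] by (simp add: complex_eq_iff)
    then have "k = 0" using k[of 1] by simp
    then show ?thesis using k[OF \<zeta>] by simp
  qed
  have eq: "\<phi> \<zeta> = \<phi>' \<zeta>" if "\<zeta> \<in> cball 0 1" for \<zeta>
  proof -
    have "\<phi> \<zeta> $ Inr l = \<phi>' \<zeta> $ Inr l" for l using arg_cong[OF w[OF that], of "\<lambda>t. t $ l"] by simp
    then have "\<phi> \<zeta> $ l = \<phi>' \<zeta> $ l" for l using z[OF that] by (cases l) auto
    then show ?thesis by (simp add: vec_eq_iff)
  qed
  then show "\<forall>\<zeta>\<in>cball 0 1. \<phi> \<zeta> = \<phi>' \<zeta>" by blast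
  show "\<forall>\<zeta>\<in>cball 0 1 - {0}. \<omega> \<zeta> = \<omega>' \<zeta>"
  proof
    fix \<zeta> :: complex assume \<zeta>: "\<zeta> \<in> cball 0 1 - {0}"
    have ext: "\<exists>h. (\<forall>i. h i \<in> disc_algebra) \<and> (\<forall>i. \<forall>\<zeta>\<in>cball 0 1 - {0}. h i \<zeta> = \<zeta> * \<tau> \<zeta> $ i)"
      if lift: "is_lift (quadric A) \<psi> \<tau>" for \<psi> and \<tau> :: "complex \<Rightarrow> complex^('k + 'm)"
    proof -
      obtain g where g: "vec_holomorphic_on g (ball 0 1)" "\<And>\<zeta>. \<zeta> \<in> ball 0 1 - {0} \<Longrightarrow> g \<zeta> = \<zeta> *s \<tau> \<zeta>"
        using lift unfolding is_lift_def extends_holomorphically_def by blast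
      have "(\<lambda>\<zeta>. if \<zeta> = 0 then g 0 $ i else \<zeta> * \<tau> \<zeta> $ i) \<in> disc_algebra" for i
      proof (rule disc_algebra_glue)
        show "continuous_on (cball 0 1 - {0}) (\<lambda>\<zeta>. \<zeta> * \<tau> \<zeta> $ i)"
          using lift unfolding is_lift_def by (intro continuous_intros) auto
        show "(\<lambda>\<zeta>. g \<zeta> $ i) holomorphic_on ball 0 1" using g(1) by (simp add: vec_holomorphic_on_def)
      qed (simp add: g(2))
      then show ?thesis by (intro exI[of _ "\<lambda>i \<zeta>. if \<zeta> = 0 then g 0 $ i else \<zeta> * \<tau> \<zeta> $ i"]) auto
    qed
    have "is_lift (quadric A) \<phi> \<omega>" "is_lift (quadric A) \<phi>' \<omega>'"
      using d1 d2 by (auto simp: stationary_data_def)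
    then obtain h h' where h: "\<And>i. h i \<in> disc_algebra" "\<And>i \<zeta>. \<zeta> \<in> cball 0 1 - {0} \<Longrightarrow> h i \<zeta> = \<zeta> * \<omega> \<zeta> $ i"
      and h': "\<And>i. h' i \<in> disc_algebra" "\<And>i \<zeta>. \<zeta> \<in> cball 0 1 - {0} \<Longrightarrow> h' i \<zeta> = \<zeta> * \<omega>' \<zeta> $ i"
      using ext[of \<phi> \<omega>] ext[of \<phi>' \<omega>'] by blast
    have om: "\<omega> \<xi> = \<omega>' \<xi>" if "\<xi> \<in> sphere 0 1" for \<xi>
      using d1 d2 that eq[of \<xi>] by (simp add: stationary_data_def)
    have "h i \<zeta> = h' i \<zeta>" for i
    proof (rule disc_algebra_boundary_unique[OF h(1) h'(1)])
      show "\<zeta> \<in> cball 0 1" using \<zeta> by blast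
      fix \<xi> :: complex assume \<xi>: "\<xi> \<in> sphere 0 1"
      then have "\<xi> \<in> cball 0 1 - {0}" by auto
      then show "h i \<xi> = h' i \<xi>" by (simp only: h(2) h'(2) om[OF \<xi>])
    qed
    then have "\<zeta> * \<omega> \<zeta> $ i = \<zeta> * \<omega>' \<zeta> $ i" for i using h(2)[OF \<zeta>] h'(2)[OF \<zeta>] by simp
    then show "\<omega> \<zeta> = \<omega>' \<zeta>" using \<zeta> by (simp add: vec_eq_iff)
  qed
qed

section \<open>The space of parameters\<close>

lemma param_region_positive:
  assumes "\<epsilon> > 0" "(lam, c, w0, y0, v) \<in> param_region A \<epsilon> \<delta>"
  shows "positive_on_circle A lam c"
  unfolding positive_on_circle_def
proof (intro ballI allI impI)
  fix \<zeta> :: complex and u :: "complex^'m" assume z: "\<zeta> \<in> sphere 0 1" and u: "u \<noteq> 0"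
  let ?e = "\<epsilon> * (norm lam + norm c)"
  have "pos_definite (circle_form A lam c \<zeta> - ?e *\<^sub>R mat 1)"
    using assms(2) z by (simp add: param_region_def circle_form_def)
  then have "0 < ((circle_form A lam c \<zeta> - ?e *\<^sub>R mat 1) *v u) \<bullet> u"
    using u unfolding pos_definite_def cip_def[symmetric] Re_cip by blast
  also have "\<dots> = (circle_form A lam c \<zeta> *v u) \<bullet> u - ?e * (u \<bullet> u)"
    by (simp add: matrix_vector_mult_diff_rdistrib mat_vec_scaleR_left inner_diff_left)
  also have "\<dots> \<le> (circle_form A lam c \<zeta> *v u) \<bullet> u"
    using assms(1) by (simp add: mult_nonneg_nonneg)
  finally show "0 < (circle_form A lam c \<zeta> *v u) \<bullet> u" .
qed

text \<open>The closed formulas for the discs and their uniqueness rest on positivity on the circle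
  alone, so \<open>param_space\<close> is governed by that condition.\<close>

lemma always_admissible:
  assumes "\<epsilon> > 0" "\<delta> > 0"
  shows "admissible A \<epsilon> \<delta>"
  unfolding admissible_def
proof (intro conjI assms ballI)
  fix p assume p: "p \<in> param_region A \<epsilon> \<delta>"
  obtain lam c w0 y0 v where p_eq: "p = (lam, c, w0, y0, v)" by (cases p) auto
  have pos: "positive_on_circle A lam c"
    using param_region_positive[OF assms(1)] p unfolding p_eq by blast
  obtain K where fact: "stable_factorization (lam_matrix A lam) (2 *\<^sub>R c_matrix A c) K (disc_solvent A lam c)"
    using positive_on_circle_factorization[where A = A, OF A_herm pos] by blast
  show "\<exists>\<phi> \<omega>. stationary_data A p \<phi> \<omega>"
    unfolding p_eq by (rule stationary_data_exists[OF fact pos])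
  show "\<forall>\<phi> \<omega> \<phi>' \<omega>'. stationary_data A p \<phi> \<omega> \<and> stationary_data A p \<phi>' \<omega>' \<longrightarrow>
      (\<forall>\<zeta>\<in>cball 0 1. \<phi> \<zeta> = \<phi>' \<zeta>) \<and> (\<forall>\<zeta>\<in>cball 0 1 - {0}. \<omega> \<zeta> = \<omega>' \<zeta>)"
    unfolding p_eq using stationary_data_unique[OF fact] by blast
qed

lemma param_space_positive:
  assumes "(lam, c, w0, y0, v) \<in> param_space A"
  shows "positive_on_circle A lam c"
  using assms param_region_positive unfolding param_space_def admissible_def by blast

text \<open>Without a pole, the \<open>z\<close>-coefficients of a lift are holomorphic and real on
  the circle, hence constant. The \<open>w\<close>-coefficients are then the negative conjugates of
  \<open>M w\<close> for a constant combination \<open>M\<close> of the \<open>A j\<close>, so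
  \<open>M w\<close> and its conjugate both are boundary values of disc algebra functions, which
  forces \<open>M w\<close> to be constant. Conversely, if \<open>M w\<close> is constant, a
  constant covector is a lift.\<close>

lemma defective_disc_iff:
  assumes att: "attached_disc (quadric A) \<phi>"
  shows "defective_disc (quadric A) \<phi> \<longleftrightarrow>
    (\<exists>a. (\<exists>j. a j \<noteq> 0) \<and> (\<forall>\<zeta>\<in>cball 0 1. (\<Sum>j\<in>UNIV. a j *\<^sub>R A j) *v w_part (\<phi> \<zeta>) = (\<Sum>j\<in>UNIV. a j *\<^sub>R A j) *v w_part (\<phi> 1)))"
    (is "_ \<longleftrightarrow> ?R")
proof
  assume "defective_disc (quadric A) \<phi>"
  then obtain \<omega> g where lift: "is_lift (quadric A) \<phi> \<omega>" and g: "vec_holomorphic_on g (ball 0 1)"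
      "\<And>\<zeta>. \<zeta> \<in> ball 0 1 - {0} \<Longrightarrow> g \<zeta> = \<omega> \<zeta>"
    unfolding defective_disc_def extends_holomorphically_def by blast
  define h where "h i \<zeta> = (if \<zeta> = 0 then g 0 $ i else \<omega> \<zeta> $ i)" for i \<zeta>
  have hDA: "h i \<in> disc_algebra" for i
    unfolding h_def[abs_def]
  proof (rule disc_algebra_glue)
    show "continuous_on (cball 0 1 - {0}) (\<lambda>\<zeta>. \<omega> \<zeta> $ i)"
      using lift unfolding is_lift_def by (intro continuous_intros) auto
    show "(\<lambda>\<zeta>. g \<zeta> $ i) holomorphic_on ball 0 1" using g(1) by (simp add: vec_holomorphic_on_def)
  qed (simp add: g(2))
  have bd: "Im (h (Inl j) \<zeta>) = 0" "h (Inr l) \<zeta> = - 2 * (\<Sum>j\<in>UNIV. h (Inl j) \<zeta> * cnj ((A j *v w_part (\<phi> \<zeta>)) $ l))"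
    if "\<zeta> \<in> sphere 0 1" for \<zeta> j l
  proof -
    have "\<phi> \<zeta> \<in> quadric A" using att that unfolding attached_disc_def by auto
    moreover have "\<omega> \<zeta> \<in> conormal_space (quadric A) (\<phi> \<zeta>)" using lift that by (simp add: is_lift_def)
    moreover have "\<zeta> \<noteq> 0" using that by auto
    ultimately show "Im (h (Inl j) \<zeta>) = 0"
      "h (Inr l) \<zeta> = - 2 * (\<Sum>j\<in>UNIV. h (Inl j) \<zeta> * cnj ((A j *v w_part (\<phi> \<zeta>)) $ l))"
      unfolding h_def using quadric_conormal_iff[where A = A, OF A_herm] by auto
  qed
  have "\<exists>k. \<forall>\<zeta>\<in>cball 0 1. h (Inl j) \<zeta> = k" for j
    by (rule real_boundary_values_constant[OF hDA bd(1)])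
  then obtain k where k: "\<And>j \<zeta>. \<zeta> \<in> cball 0 1 \<Longrightarrow> h (Inl j) \<zeta> = k j" by metis
  \<comment> \<open>The factor 2 compensates the coefficient \<open>1 / 2\<close> of
    \<open>del_form\<close> in the \<open>z\<close>-directions.\<close>
  define a where "a j = 2 * Re (k j)" for j
  have ka: "k j = of_real (a j / 2)" for j
    using bd(1)[of 1 j] k[of 1 j] by (simp add: a_def complex_eq_iff)
  let ?M = "\<Sum>j\<in>UNIV. a j *\<^sub>R A j"
  have bd2: "h (Inr l) \<zeta> = - cnj ((?M *v w_part (\<phi> \<zeta>)) $ l)" if "\<zeta> \<in> sphere 0 1" for \<zeta> l
  proof -
    have hj: "h (Inl j) \<zeta> = of_real (a j / 2)" for j using k[of \<zeta> j] ka that by simp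
    show ?thesis unfolding bd(2)[OF that] hj
      by (simp add: mat_sum_vec mat_vec_scaleR_left scaleR_complex sum_distrib_left sum_negf)
  qed
  have "\<exists>j. a j \<noteq> 0"
  proof (rule ccontr)
    assume "\<not> ?thesis"
    then have a0: "a j = 0" for j by simp
    have h0: "h i \<zeta> = 0" if "\<zeta> \<in> cball 0 1" for i \<zeta>
    proof (cases i)
      case (Inl j)
      then show ?thesis using k[OF that] ka a0 by simp
    next
      case (Inr l)
      show ?thesis
        by (rule disc_algebra_boundary_unique[OF hDA disc_algebra_intros(2) _ that]) (simp add: Inr bd2 a0)
    qed
    have "\<omega> \<zeta> = 0" if "\<zeta> \<in> cball 0 1 - {0}" for \<zeta>
    proof -
      have "\<omega> \<zeta> $ i = 0" for i using h0[of \<zeta> i] that by (simp add: h_def)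
      then show ?thesis by (simp add: vec_eq_iff)
    qed
    then show False using lift unfolding is_lift_def by blast
  qed
  moreover have "?M *v w_part (\<phi> \<zeta>) = ?M *v w_part (\<phi> 1)" if "\<zeta> \<in> cball 0 1" for \<zeta>
  proof -
    have DA: "(\<lambda>\<zeta>. (?M *v w_part (\<phi> \<zeta>)) $ l) \<in> disc_algebra" for l
      by (rule disc_algebra_mat_vec) (simp add: disc_algebra_component[OF att])
    have ex: "\<exists>q. \<forall>\<zeta>\<in>cball 0 1. (?M *v w_part (\<phi> \<zeta>)) $ l = q" for l
      by (rule conjugate_boundary_values_constant[OF DA disc_algebra_minus[OF hDA[of "Inr l"]]]) (simp add: bd2)
    have "(?M *v w_part (\<phi> \<zeta>)) $ l = (?M *v w_part (\<phi> 1)) $ l" for l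
    proof -
      obtain q where q: "\<forall>\<zeta>\<in>cball 0 1. (?M *v w_part (\<phi> \<zeta>)) $ l = q" using ex[of l] by blast
      have one: "1 \<in> cball (0::complex) 1" by simp
      show ?thesis by (rule trans[OF bspec[OF q that] bspec[OF q one, symmetric]])
    qed
    then show ?thesis by (simp add: vec_eq_iff)
  qed
  ultimately show ?R by blast
next
  assume ?R
  then obtain a where a: "\<exists>j. a j \<noteq> 0" and const: "\<And>\<zeta>. \<zeta> \<in> cball 0 1 \<Longrightarrow>
      (\<Sum>j\<in>UNIV. a j *\<^sub>R A j) *v w_part (\<phi> \<zeta>) = (\<Sum>j\<in>UNIV. a j *\<^sub>R A j) *v w_part (\<phi> 1)" by blast
  define \<omega> where "\<omega> = (\<Sum>j\<in>UNIV. a j *\<^sub>R del_form (quadric_rho A j) (\<phi> 1))"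
  have on: "\<phi> \<zeta> \<in> quadric A" if "\<zeta> \<in> sphere 0 1" for \<zeta> using att that unfolding attached_disc_def by auto
  have eq: "\<omega> = (\<Sum>j\<in>UNIV. a j *\<^sub>R del_form (quadric_rho A j) (\<phi> \<zeta>))" if "\<zeta> \<in> sphere 0 1" for \<zeta>
  proof -
    have "\<zeta> \<in> cball 0 1" using that by auto
    then have "\<omega> $ l = (\<Sum>j\<in>UNIV. a j *\<^sub>R del_form (quadric_rho A j) (\<phi> \<zeta>)) $ l" for l
      unfolding \<omega>_def by (cases l) (simp_all only: sum_del_form[where A = A, OF A_herm] const)
    then show ?thesis by (simp add: vec_eq_iff)
  qed
  have nz: "\<omega> \<noteq> 0"
  proof
    assume "\<omega> = 0"
    obtain j where "a j \<noteq> 0" using a by blast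
    moreover have "\<omega> $ Inl j = of_real (a j / 2)" unfolding \<omega>_def by (rule sum_del_form(1)[where A = A, OF A_herm])
    ultimately show False using \<open>\<omega> = 0\<close> by simp
  qed
  have "is_lift (quadric A) \<phi> (\<lambda>_. \<omega>)"
    unfolding is_lift_def
  proof (intro conjI ballI)
    show "vec_holomorphic_on (\<lambda>_. \<omega>) (ball 0 1 - {0})" by (simp add: vec_holomorphic_on_def)
    show "\<exists>\<zeta>\<in>cball 0 1 - {0::complex}. \<omega> \<noteq> 0" using nz by (intro bexI[of _ 1]) auto
    show "extends_holomorphically (\<lambda>\<zeta>. \<zeta> *s \<omega>)"
      unfolding extends_holomorphically_def vec_holomorphic_on_def
      by (intro exI[of _ "\<lambda>\<zeta>. \<zeta> *s \<omega>"]) (auto intro!: holomorphic_intros)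
    show "\<omega> \<in> conormal_space (quadric A) (\<phi> \<zeta>)" if "\<zeta> \<in> sphere 0 1" for \<zeta>
      unfolding eq[OF that] by (rule sum_del_form_conormal[where A = A, OF A_herm on[OF that]])
  qed simp
  moreover have "extends_holomorphically (\<lambda>_. \<omega>)"
    unfolding extends_holomorphically_def vec_holomorphic_on_def by (intro exI[of _ "\<lambda>_. \<omega>"]) simp
  ultimately show "defective_disc (quadric A) \<phi>"
    using att unfolding defective_disc_def by blast
qed

text \<open>Since \<open>w\<close> varies by \<open>\<zeta> - 1\<close> times the resolvent applied
  to \<open>v - X *v v\<close>, and \<open>\<zeta> - 1\<close> has no zero in the open disc,
  constancy of \<open>M w\<close> means that \<open>M\<close> annihilates the resolvent,
  equivalently all powers of \<open>X\<close> applied to \<open>v\<close>.\<close>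

lemma stationary_disc_defective_iff:
  assumes pos: "positive_on_circle A lam c" and data: "stationary_data A (lam, c, w0, y0, v) \<phi> \<omega>"
  shows "defective_disc (quadric A) \<phi> \<longleftrightarrow>
    (\<exists>a. (\<exists>j. a j \<noteq> 0) \<and> (\<forall>n. (\<Sum>j\<in>UNIV. a j *\<^sub>R A j) *v (matpow (disc_solvent A lam c) n *v v) = 0))"
proof -
  obtain K where fact: "stable_factorization (lam_matrix A lam) (2 *\<^sub>R c_matrix A c) K (disc_solvent A lam c)"
    using positive_on_circle_factorization[where A = A, OF A_herm pos] by blast
  interpret stable_factorization "lam_matrix A lam" "2 *\<^sub>R c_matrix A c" K "disc_solvent A lam c"
    by (fact fact)
  let ?y = "v - disc_solvent A lam c *v v"
  have att: "attached_disc (quadric A) \<phi>" using data by (simp add: stationary_data_def)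
  have "(\<forall>\<zeta>\<in>cball 0 1. M *v w_part (\<phi> \<zeta>) = M *v w_part (\<phi> 1)) \<longleftrightarrow>
      (\<forall>n. M *v (matpow (disc_solvent A lam c) n *v v) = 0)" for M :: "complex^'m^'m"
  proof -
    have w: "M *v w_part (\<phi> \<zeta>) = M *v w0 + (\<zeta> - 1) *s (M *v (res \<zeta> *v ?y))" if "\<zeta> \<in> cball 0 1" for \<zeta>
      unfolding stationary_w_part[where A = A, OF A_herm fact data that] by (simp only: matrix_vector_right_distrib mat_vec_scale)
    have w1: "M *v w_part (\<phi> 1) = M *v w0" using w[of 1] by simp
    show ?thesis
    proof
      assume const: "\<forall>\<zeta>\<in>cball 0 1. M *v w_part (\<phi> \<zeta>) = M *v w_part (\<phi> 1)"
      have "M *v (res \<zeta> *v ?y) = 0" if "\<zeta> \<in> ball 0 1" for \<zeta>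
      proof -
        have z: "\<zeta> \<in> cball 0 1" and "\<zeta> \<noteq> 1" using that by auto
        have "(\<zeta> - 1) *s (M *v (res \<zeta> *v ?y)) = 0"
        proof -
          have "M *v w0 + (\<zeta> - 1) *s (M *v (res \<zeta> *v ?y)) = M *v w0"
            using bspec[OF const z] unfolding w[OF z] w1 .
          then show ?thesis by (simp only: add_cancel_left_right)
        qed
        then show ?thesis using \<open>\<zeta> \<noteq> 1\<close> by (simp add: vec_eq_iff)
      qed
      then have "\<forall>n. M *v (matpow (disc_solvent A lam c) n *v ?y) = 0"
        using krylov_annihilated_if_resolvent by blast
      then show "\<forall>n. M *v (matpow (disc_solvent A lam c) n *v v) = 0"
        using krylov_annihilated_shift by blast
    next
      assume "\<forall>n. M *v (matpow (disc_solvent A lam c) n *v v) = 0"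
      then have "\<forall>n. M *v (matpow (disc_solvent A lam c) n *v ?y) = 0"
        using krylov_annihilated_shift by blast
      then have "M *v (res \<zeta> *v ?y) = 0" if "\<zeta> \<in> cball 0 1" for \<zeta>
        using resolvent_annihilated_if_krylov that by simp
      then show "\<forall>\<zeta>\<in>cball 0 1. M *v w_part (\<phi> \<zeta>) = M *v w_part (\<phi> 1)"
        using w w1 by simp
    qed
  qed
  then show ?thesis unfolding defective_disc_iff[OF att] by simp
qed

end

section \<open>Existence of non-defective discs\<close>

text \<open>A Vandermonde argument: the relation for \<open>Suc n\<close> minus \<open>x a\<close>
  times the relation for \<open>n\<close> eliminates the term of \<open>a\<close> and multiplies
  each other term by the nonzero number \<open>x b - x a\<close>.\<close>

lemma distinct_powers_independent:
  fixes x :: "'i \<Rightarrow> real" and y :: "'i \<Rightarrow> 'v::real_vector"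
  assumes "finite S" "inj_on x S" "\<And>n. (\<Sum>b\<in>S. x b ^ n *\<^sub>R y b) = 0"
  shows "\<forall>b\<in>S. y b = 0"
  using assms
proof (induction S arbitrary: y rule: finite_induct)
  case (insert a S)
  have ins: "x a ^ n *\<^sub>R y a + (\<Sum>b\<in>S. x b ^ n *\<^sub>R y b) = 0" for n
    using insert.prems(2)[of n] insert.hyps by simp
  have "(\<Sum>b\<in>S. x b ^ n *\<^sub>R ((x b - x a) *\<^sub>R y b)) = 0" for n
  proof -
    have "(\<Sum>b\<in>S. x b ^ n *\<^sub>R ((x b - x a) *\<^sub>R y b)) =
        (\<Sum>b\<in>S. x b ^ Suc n *\<^sub>R y b - x a *\<^sub>R (x b ^ n *\<^sub>R y b))"
      by (intro sum.cong) (simp_all add: algebra_simps)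
    also have "\<dots> = (\<Sum>b\<in>S. x b ^ Suc n *\<^sub>R y b) - x a *\<^sub>R (\<Sum>b\<in>S. x b ^ n *\<^sub>R y b)"
      by (simp only: sum_subtractf scaleR_sum_right)
    also have "\<dots> = (x a ^ Suc n *\<^sub>R y a + (\<Sum>b\<in>S. x b ^ Suc n *\<^sub>R y b)) -
        x a *\<^sub>R (x a ^ n *\<^sub>R y a + (\<Sum>b\<in>S. x b ^ n *\<^sub>R y b))"
      by (simp add: algebra_simps)
    also have "\<dots> = 0" by (simp only: ins) simp
    finally show ?thesis .
  qed
  moreover have "inj_on x S" using insert.prems(1) by auto
  ultimately have "\<forall>b\<in>S. (x b - x a) *\<^sub>R y b = 0" by (intro insert.IH)
  moreover have "x b \<noteq> x a" if "b \<in> S" for b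
    using insert.prems(1) insert.hyps(2) that by (auto simp: inj_on_def)
  ultimately have "\<forall>b\<in>S. y b = 0" by force
  moreover from this have "y a = 0" using ins[of 0] by simp
  ultimately show ?case by simp
qed simp

lemma nonneg_quadratic_linear_term_zero:
  fixes g h :: real
  assumes "\<And>t. 0 \<le> 2 * t * g + t\<^sup>2 * h" "0 \<le> h"
  shows "g = 0"
proof (rule ccontr)
  assume "g \<noteq> 0"
  \<comment> \<open>Testing at \<open>t = - q\<close> makes the linear term dominate; the summand 1
    in the denominator covers the case \<open>h = 0\<close>.\<close>
  define q where "q = g / (1 + h)"
  have g: "g = q * (1 + h)" using assms(2) by (simp add: q_def)
  have "0 \<le> 2 * (- q) * g + (- q)\<^sup>2 * h" by (rule assms(1))
  also have "\<dots> = - (q\<^sup>2 * (2 + h))" unfolding g by (simp add: power2_eq_square algebra_simps)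
  also have "\<dots> < 0" using \<open>g \<noteq> 0\<close> g assms(2) by auto
  finally show False by simp
qed

section \<open>Eigenvalues of Hermitian matrices relative to a positive one\<close>

context
  fixes C :: "complex^'m::finite^'m"
  assumes C_adj: "adj C = C" and C_pos: "\<And>u. u \<noteq> 0 \<Longrightarrow> 0 < (C *v u) \<bullet> u"
begin

text \<open>Real numbers capture the whole spectrum, as the eigenvalues of a Hermitian matrix
  relative to a positive definite one are real.\<close>

definition pencil_spectrum :: "complex^'m^'m \<Rightarrow> real set" where
  "pencil_spectrum B = {b. \<exists>u. u \<noteq> 0 \<and> B *v u = b *\<^sub>R (C *v u)}"

lemma C_nonneg: "0 \<le> (C *v u) \<bullet> u"
  using C_pos[of u] by (cases "u = 0") auto

text \<open>The generalised Rayleigh quotient attains its maximum \<open>b\<close> at some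
  \<open>u\<close>. The form of \<open>b C - B\<close> is then nonnegative and vanishes at
  \<open>u\<close>; its first variation at \<open>u\<close> in the direction of its own gradient
  shows that \<open>b C - B\<close> kills \<open>u\<close>.\<close>

lemma largest_pencil_eigenvalue:
  assumes B: "adj B = B"
  shows "\<exists>b\<in>pencil_spectrum B. \<forall>w. (B *v w) \<bullet> w \<le> b * ((C *v w) \<bullet> w)"
proof -
  let ?f = "\<lambda>u. ((B *v u) \<bullet> u) / ((C *v u) \<bullet> u)"
  have cont: "continuous_on (sphere 0 1) (\<lambda>u. (M *v u) \<bullet> u)" for M :: "complex^'m^'m"
    by (intro continuous_on_inner bounded_linear.continuous_on[OF bounded_linear_mat_vec] continuous_on_id)
  have "continuous_on (sphere 0 1) ?f"
  proof (intro continuous_on_divide cont ballI)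
    fix u :: "complex^'m" assume "u \<in> sphere 0 1"
    then have "u \<noteq> 0" by auto
    then show "(C *v u) \<bullet> u \<noteq> 0" using C_pos by force
  qed
  moreover have "sphere (0 :: complex^'m) 1 \<noteq> {}" by (simp add: vector_choose_size)
  ultimately have "\<exists>u\<in>sphere 0 1. \<forall>w\<in>sphere 0 1. ?f w \<le> ?f u"
    by (intro continuous_attains_sup compact_sphere)
  then obtain u where u: "u \<in> sphere 0 1" "\<And>w. w \<in> sphere 0 1 \<Longrightarrow> ?f w \<le> ?f u" by blast
  define b where "b = ?f u"
  have u0: "u \<noteq> 0" using u(1) by auto
  have le: "(B *v w) \<bullet> w \<le> b * ((C *v w) \<bullet> w)" for w
  proof (cases "w = 0")
    case False
    define s where "s = (1 / norm w) *\<^sub>R w"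
    have s: "s \<in> sphere 0 1" "s \<noteq> 0" using False by (simp_all add: s_def)
    have w: "w = norm w *\<^sub>R s" using False by (simp add: s_def)
    have scale: "(M *v w) \<bullet> w = (norm w)\<^sup>2 * ((M *v s) \<bullet> s)" for M :: "complex^'m^'m"
      by (subst (1 2) w) (simp only: mat_vec_scaleR_right inner_scaleR_left inner_scaleR_right power2_eq_square mult.assoc)
    have "(B *v s) \<bullet> s \<le> b * ((C *v s) \<bullet> s)"
      using u(2)[OF s(1)] C_pos[OF s(2)] by (simp add: b_def divide_le_eq)
    then have "(norm w)\<^sup>2 * ((B *v s) \<bullet> s) \<le> (norm w)\<^sup>2 * (b * ((C *v s) \<bullet> s))"
      by (rule mult_left_mono) simp
    then show ?thesis unfolding scale by (simp only: mult.left_commute)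
  qed simp
  define N where "N w = b *\<^sub>R (C *v w) - B *v w" for w
  have Nlin: "N (p + t *\<^sub>R q) = N p + t *\<^sub>R N q" for p q t
    by (simp add: N_def matrix_vector_right_distrib mat_vec_scaleR_right algebra_simps)
  have Nsym: "N p \<bullet> q = N q \<bullet> p" for p q
    using inner_adj[of C p q] inner_adj[of B p q] C_adj B
    by (simp add: N_def inner_diff_left inner_diff_right inner_commute)
  have Nnonneg: "0 \<le> N w \<bullet> w" for w using le[of w] by (simp add: N_def inner_diff_left)
  have Nu: "N u \<bullet> u = 0"
    using C_pos[OF u0] by (simp add: N_def b_def inner_diff_left)
  have "N u \<bullet> N u = 0"
  proof (rule nonneg_quadratic_linear_term_zero)
    fix t
    have "N (u + t *\<^sub>R N u) \<bullet> (u + t *\<^sub>R N u) = 2 * t * (N u \<bullet> N u) + t\<^sup>2 * (N (N u) \<bullet> N u)"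
      unfolding Nlin using Nsym[of "N u" u]
      by (simp add: inner_add_left inner_add_right Nu power2_eq_square algebra_simps)
    then show "0 \<le> 2 * t * (N u \<bullet> N u) + t\<^sup>2 * (N (N u) \<bullet> N u)"
      using Nnonneg[of "u + t *\<^sub>R N u"] by simp
  qed (rule Nnonneg)
  then have "B *v u = b *\<^sub>R (C *v u)" by (simp add: N_def)
  then show ?thesis using u0 le unfolding pencil_spectrum_def by blast
qed

text \<open>Eigenvectors for different eigenvalues are orthogonal with respect to \<open>C\<close>,
  hence independent over the reals. What matters is a bound uniform in \<open>B\<close>, so that a
  maximal cardinality exists.\<close>

lemma pencil_spectrum_bound:
  assumes B: "adj B = B"
  shows "finite (pencil_spectrum B)" "card (pencil_spectrum B) \<le> DIM(complex^'m)"
proof -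
  have "finite S \<and> card S \<le> DIM(complex^'m)" if S: "finite S" "S \<subseteq> pencil_spectrum B" for S
  proof -
    obtain u where u: "\<And>b. b \<in> S \<Longrightarrow> u b \<noteq> 0" "\<And>b. b \<in> S \<Longrightarrow> B *v u b = b *\<^sub>R (C *v u b)"
      using S(2) unfolding pencil_spectrum_def subset_iff mem_Collect_eq by metis
    have orth: "(C *v u b) \<bullet> u b' = 0" if "b \<in> S" "b' \<in> S" "b \<noteq> b'" for b b'
    proof -
      have "b * ((C *v u b) \<bullet> u b') = (B *v u b) \<bullet> u b'" using u(2)[OF that(1)] by simp
      also have "\<dots> = u b \<bullet> (B *v u b')" using inner_adj[of B] B by simp
      also have "\<dots> = b' * (u b \<bullet> (C *v u b'))" using u(2)[OF that(2)] by simp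
      also have "u b \<bullet> (C *v u b') = (C *v u b) \<bullet> u b'" using inner_adj[of C] C_adj by simp
      finally show ?thesis using that(3) by simp
    qed
    have inj: "inj_on u S"
    proof (rule inj_onI, rule ccontr)
      fix b b' assume *: "b \<in> S" "b' \<in> S" "u b = u b'" "b \<noteq> b'"
      then have "(C *v u b) \<bullet> u b = 0" using orth[of b b'] by simp
      then show False using C_pos[OF u(1)[OF *(1)]] by simp
    qed
    have "independent (u ` S)"
    proof
      assume "dependent (u ` S)"
      then obtain k where k: "\<exists>w\<in>u ` S. k w \<noteq> 0" "(\<Sum>w\<in>u ` S. k w *\<^sub>R w) = 0"
        using dependent_finite[of "u ` S"] S(1) by auto
      then obtain b where b: "b \<in> S" "k (u b) \<noteq> 0" by auto
      have "0 = (C *v u b) \<bullet> (\<Sum>b'\<in>S. k (u b') *\<^sub>R u b')"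
        using k(2) by (simp add: sum.reindex[OF inj])
      also have "\<dots> = (\<Sum>b'\<in>S. if b' = b then k (u b) * ((C *v u b) \<bullet> u b) else 0)"
        unfolding inner_sum_right using orth b(1) by (intro sum.cong) auto
      also have "\<dots> = k (u b) * ((C *v u b) \<bullet> u b)" using S(1) b(1) by simp
      finally show False using b(2) C_pos[OF u(1)[OF b(1)]] by simp
    qed
    then have "card (u ` S) \<le> DIM(complex^'m)" using independent_bound by blast
    then show ?thesis using S(1) card_image[OF inj] by simp
  qed
  then have "finite (pencil_spectrum B) \<and> card (pencil_spectrum B) \<le> DIM(complex^'m)"
    by (intro finite_if_finite_subsets_card_bdd) blast
  then show "finite (pencil_spectrum B)" "card (pencil_spectrum B) \<le> DIM(complex^'m)" by auto
qed

text \<open>If \<open>M\<close> kills one eigenvector for each point of a spectrum of maximal cardinality, then \<open>B + t M\<close> has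
  the same spectrum for all \<open>t\<close>, which bounds its quadratic form.\<close>

lemma maximal_spectrum_rigid:
  assumes B: "adj B = B" and M: "adj M = M"
    and max: "\<And>t. card (pencil_spectrum (B + t *\<^sub>R M)) \<le> card (pencil_spectrum B)"
    and u: "\<And>b. b \<in> pencil_spectrum B \<Longrightarrow> u b \<noteq> 0 \<and> B *v u b = b *\<^sub>R (C *v u b) \<and> M *v u b = 0"
  shows "M = 0"
proof -
  have adjt: "adj (B + t *\<^sub>R M) = B + t *\<^sub>R M" for t by (simp add: adj_add adj_scaleR B M)
  have sub: "pencil_spectrum B \<subseteq> pencil_spectrum (B + t *\<^sub>R M)" for t
  proof
    fix b assume "b \<in> pencil_spectrum B"
    then show "b \<in> pencil_spectrum (B + t *\<^sub>R M)"
      using u[of b] unfolding pencil_spectrum_def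
      by (auto simp: matrix_vector_mult_add_rdistrib mat_vec_scaleR_left intro!: exI[of _ "u b"])
  qed
  have same: "pencil_spectrum (B + t *\<^sub>R M) = pencil_spectrum B" for t
    using card_seteq[OF pencil_spectrum_bound(1)[OF adjt] sub max] by simp
  define \<mu> where "\<mu> = Max (pencil_spectrum B)"
  have form: "(B *v w) \<bullet> w + t * ((M *v w) \<bullet> w) \<le> \<mu> * ((C *v w) \<bullet> w)" for w t
  proof -
    obtain b where b: "b \<in> pencil_spectrum (B + t *\<^sub>R M)"
      "((B + t *\<^sub>R M) *v w) \<bullet> w \<le> b * ((C *v w) \<bullet> w)"
      using largest_pencil_eigenvalue[OF adjt] by blast
    have "b \<le> \<mu>" unfolding \<mu>_def using b(1) same pencil_spectrum_bound(1)[OF B] by (intro Max_ge) auto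
    then have "b * ((C *v w) \<bullet> w) \<le> \<mu> * ((C *v w) \<bullet> w)" using C_nonneg by (rule mult_right_mono)
    then show ?thesis
      using b(2) by (simp add: matrix_vector_mult_add_rdistrib mat_vec_scaleR_left inner_add_left)
  qed
  have zero: "(M *v w) \<bullet> w = 0" for w
  proof (rule ccontr)
    assume nz: "(M *v w) \<bullet> w \<noteq> 0"
    \<comment> \<open>The value at which the left side of \<open>form\<close> exceeds its right side
      by exactly 1.\<close>
    let ?t = "(\<mu> * ((C *v w) \<bullet> w) - (B *v w) \<bullet> w + 1) / ((M *v w) \<bullet> w)"
    have "?t * ((M *v w) \<bullet> w) = \<mu> * ((C *v w) \<bullet> w) - (B *v w) \<bullet> w + 1" using nz by simp
    then show False using form[of w ?t] by linarith
  qed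
  have "M *v w = 0" for w
  proof -
    \<comment> \<open>Polarisation in the direction \<open>M *v w\<close> passes from the vanishing
      form to the vanishing matrix.\<close>
    have "(M *v (w + M *v w)) \<bullet> (w + M *v w) = 2 * ((M *v w) \<bullet> (M *v w))"
      using zero[of w] zero[of "M *v w"] inner_adj[of M "M *v w" w] M
      by (simp add: matrix_vector_right_distrib inner_add_left inner_add_right inner_commute)
    then show ?thesis using zero[of "w + M *v w"] by simp
  qed
  then show ?thesis by (simp add: matrix_eq)
qed

end

context stable_factorization
begin

text \<open>The quadratic matrix polynomial factors as
  \<open>(1 - \<xi> adj X) K (\<xi> - X)\<close>. On the closed disc the left factor is injective,
  again by decay of the powers of \<open>X\<close>, and \<open>K\<close> is invertible; so a vector
  in the kernel is an eigenvector of \<open>X\<close>.\<close>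

lemma solvent_eigenvector:
  assumes \<xi>: "norm \<xi> \<le> 1" and eq: "P *v u + \<xi> *s (H *v u) + \<xi>\<^sup>2 *s (adj P *v u) = 0"
  shows "X *v u = \<xi> *s u"
proof -
  define f where "f = K *v (\<xi> *s u - X *v u)"
  have KX: "K *v (X *v u) = - (P *v u)"
    by (simp add: P_eq mat_vec_minus_left matrix_vector_mul_assoc)
  have f1: "f = \<xi> *s (K *v u) + P *v u"
    by (simp only: f_def matrix_vector_mult_diff_distrib mat_vec_scale KX) simp
  have aK: "adj X *v (K *v u) = - (adj P *v u)"
    by (simp only: adj_P mat_vec_minus_left matrix_vector_mul_assoc minus_minus)
  have aKX: "adj X *v (K *v (X *v u)) = H *v u - K *v u"
  proof -
    have "H *v u = K *v u + adj X *v (K *v (X *v u))"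
      by (subst H_eq) (simp only: matrix_vector_mult_add_rdistrib matrix_vector_mul_assoc matrix_mul_assoc)
    then show ?thesis by simp
  qed
  have e1: "adj X *v f = - (\<xi> *s (adj P *v u)) - (H *v u - K *v u)"
    by (simp only: f_def matrix_vector_mult_diff_distrib mat_vec_scale aK aKX vec.scale_minus_right)
  have "\<xi> *s (adj X *v f) = f - (P *v u + \<xi> *s (H *v u) + \<xi>\<^sup>2 *s (adj P *v u))"
    unfolding e1 unfolding f1 by (simp add: vec_eq_iff power2_eq_square algebra_simps)
  then have fix_f: "f = \<xi> *s (adj X *v f)" using eq by simp
  have step: "cip f w = \<xi> * cip f (X *v w)" for w
  proof -
    have "cip f w = \<xi> * cip (adj X *v f) w" by (subst fix_f) (rule cip_scale_left)
    then show ?thesis by (simp add: cip_adj)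
  qed
  have iter: "cip f w = \<xi> ^ n * cip f (matpow X n *v w)" for n w
  proof (induction n)
    case (Suc n)
    then show ?case using step[of "matpow X n *v w"] by (simp add: matrix_vector_mul_assoc)
  qed simp
  have "norm (cip f w) \<le> 0" for w
  proof (rule tendsto_lowerbound)
    have "(\<lambda>n. cip f (matpow X n *v w)) \<longlonglongrightarrow> cip f 0"
      unfolding cip_sum by (intro tendsto_intros tendsto_vec_nth stable)
    then show "(\<lambda>n. norm (cip f (matpow X n *v w))) \<longlonglongrightarrow> 0"
      using tendsto_norm by fastforce
    have "norm (cip f w) \<le> norm (cip f (matpow X n *v w))" for n
    proof -
      have "norm (cip f w) = norm \<xi> ^ n * norm (cip f (matpow X n *v w))"
        by (subst iter[of w n]) (simp add: norm_mult norm_power)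
      also have "\<dots> \<le> 1 * norm (cip f (matpow X n *v w))"
        using \<xi> by (intro mult_right_mono power_le_one) auto
      finally show ?thesis by simp
    qed
    then show "\<forall>\<^sub>F n in sequentially. norm (cip f w) \<le> norm (cip f (matpow X n *v w))"
      by (intro always_eventually allI)
  qed simp
  from this[of f] have "f \<bullet> f \<le> 0" by (simp add: cip_self)
  then have "f = 0" using inner_ge_zero[of f] inner_eq_zero_iff[of f] by linarith
  obtain K' where K': "K' ** K = mat 1" using K_inv invertible_left_inverse by blast
  have "K' *v f = \<xi> *s u - X *v u" by (simp add: f_def matrix_vector_mul_assoc K')
  then show ?thesis using \<open>f = 0\<close> by simp
qed

end

lemma unit_circle_cis:
  assumes "norm \<zeta> = 1"
  obtains \<theta> where "\<theta> \<in> circle_range" "\<zeta> = cis \<theta>"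
proof (rule that)
  show "Arg2pi \<zeta> \<in> circle_range" using Arg2pi_ge_0[of \<zeta>] Arg2pi_lt_2pi[of \<zeta>] by simp
  show "\<zeta> = cis (Arg2pi \<zeta>)"
    using Arg2pi(1)[of \<zeta>] assms by (simp add: is_Arg_def cis_conv_exp)
qed

lemma of_real_vec_scale: "of_real r *s u = r *\<^sub>R (u :: complex^'n)"
  by (simp add: vec_eq_iff scaleR_complex)

context
  fixes A :: "'k::finite \<Rightarrow> complex^'m::finite^'m"
  assumes A_herm: "\<And>j. hermitian (A j)"
begin

lemma adj_combination: "adj (\<Sum>j\<in>UNIV. a j *\<^sub>R A j) = (\<Sum>j\<in>UNIV. a j *\<^sub>R A j)"
  using A_self_adj[where A = A, OF A_herm] by (simp add: adj_sum adj_scaleR)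

text \<open>Coercivity of the symbol gives a uniform lower bound \<open>e / 2\<close> for the form
  on the circle, which leaves room for a margin; \<delta> is chosen after the vectors and exceeds
  their norms.\<close>

lemma positive_in_param_space:
  assumes pos: "positive_on_circle A lam c"
  shows "(lam, c, w0, y0, v) \<in> param_space A"
proof -
  interpret positive_symbol "lam_matrix A lam" "2 *\<^sub>R c_matrix A c"
    using positive_on_circle_symbol[where A = A, OF A_herm pos] .
  obtain e where e: "e > 0" "\<And>\<theta> u. \<theta> \<in> circle_range \<Longrightarrow>
      e * (u \<bullet> u) \<le> (symbol (lam_matrix A lam) (2 *\<^sub>R c_matrix A c) \<theta> *v u) \<bullet> u"
    using coercive by blast
  have coer: "e * (u \<bullet> u) \<le> 2 * ((circle_form A lam c \<zeta> *v u) \<bullet> u)" if "\<zeta> \<in> sphere 0 1" for \<zeta> u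
  proof -
    have "norm \<zeta> = 1" using that by simp
    then obtain \<theta> where \<theta>: "\<theta> \<in> circle_range" "\<zeta> = cis \<theta>" by (rule unit_circle_cis)
    have "symbol (lam_matrix A lam) (2 *\<^sub>R c_matrix A c) \<theta> *v u = 2 *\<^sub>R (circle_form A lam c \<zeta> *v u)"
      using symbol_circle_form[where A = A, OF A_herm, of "cis \<theta>" lam u c] by (simp add: symbol_mult cis_cnj \<theta>(2))
    then show ?thesis using e(2)[OF \<theta>(1), of u] by simp
  qed
  define n where "n = norm lam + norm c"
  \<comment> \<open>The product with \<open>n\<close> stays below \<open>e / 4\<close>, strictly
    less than the available \<open>e / 2\<close>; \<open>n + 1\<close> avoids a zero
    denominator.\<close>
  define \<epsilon> where "\<epsilon> = e / (4 * (n + 1))"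
  define \<delta> where "\<delta> = norm w0 + norm y0 + norm v + 1"
  have n: "n \<ge> 0" by (simp add: n_def)
  have \<epsilon>: "\<epsilon> > 0" using e(1) n by (simp add: \<epsilon>_def)
  have \<epsilon>n: "\<epsilon> * n \<le> e / 4"
  proof -
    have "\<epsilon> * n \<le> \<epsilon> * (n + 1)" using \<epsilon> by simp
    also have "\<epsilon> * (n + 1) = e / 4" using n by (simp add: \<epsilon>_def field_simps)
    finally show ?thesis .
  qed
  have "\<delta> > 0" unfolding \<delta>_def by (intro add_nonneg_pos add_nonneg_nonneg norm_ge_zero) simp
  have "pos_definite (circle_form A lam c \<zeta> - (\<epsilon> * n) *\<^sub>R mat 1)" if z: "\<zeta> \<in> sphere 0 1" for \<zeta>
    unfolding pos_definite_def hermitian_iff_adj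
  proof (intro conjI allI impI)
    show "adj (circle_form A lam c \<zeta> - (\<epsilon> * n) *\<^sub>R mat 1) = circle_form A lam c \<zeta> - (\<epsilon> * n) *\<^sub>R mat 1"
      by (simp add: adj_diff adj_scaleR circle_form_def adj_combination)
    fix u :: "complex^'m" assume u: "u \<noteq> 0"
    have "((circle_form A lam c \<zeta> - (\<epsilon> * n) *\<^sub>R mat 1) *v u) \<bullet> u = (circle_form A lam c \<zeta> *v u) \<bullet> u - \<epsilon> * n * (u \<bullet> u)"
      by (simp add: matrix_vector_mult_diff_rdistrib mat_vec_scaleR_left inner_diff_left)
    moreover have "\<epsilon> * n * (u \<bullet> u) \<le> e / 4 * (u \<bullet> u)" using \<epsilon>n by (rule mult_right_mono) simp
    moreover have "e * (u \<bullet> u) > 0" using e(1) u by simp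
    ultimately have "0 < ((circle_form A lam c \<zeta> - (\<epsilon> * n) *\<^sub>R mat 1) *v u) \<bullet> u"
      using coer[OF z, of u] by simp
    then show "0 < Re (pairing ((circle_form A lam c \<zeta> - (\<epsilon> * n) *\<^sub>R mat 1) *v u) (cnj_vec u))"
      unfolding cip_def[symmetric] Re_cip .
  qed
  moreover have "norm w0 < \<delta>" "norm y0 < \<delta>" "norm v < \<delta>"
    unfolding \<delta>_def using norm_ge_zero[of w0] norm_ge_zero[of y0] norm_ge_zero[of v] by linarith+
  ultimately have "(lam, c, w0, y0, v) \<in> param_region A \<epsilon> \<delta>"
    unfolding param_region_def circle_form_def n_def by blast
  moreover have "admissible A \<epsilon> \<delta>" using always_admissible[where A = A, OF A_herm \<epsilon> \<open>\<delta> > 0\<close>] .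
  ultimately show ?thesis unfolding param_space_def by blast
qed

lemma param_space_iff: "(lam, c, w0, y0, v) \<in> param_space A \<longleftrightarrow> positive_on_circle A lam c"
  using positive_in_param_space param_space_positive[where A = A, OF A_herm] by blast

lemma nondefective_parameters:
  assumes inj: "inj A" and ind: "independent (range A)"
    and c0: "pos_definite (\<Sum>j\<in>UNIV. c0 $ j *\<^sub>R A j)"
  shows "\<exists>lam v. positive_on_circle A lam c0 \<and>
    (\<forall>a. (\<forall>n. (\<Sum>j\<in>UNIV. a j *\<^sub>R A j) *v (matpow (disc_solvent A lam c0) n *v v) = 0) \<longrightarrow> (\<forall>j. a j = 0))"
proof -
  define M where "M a = (\<Sum>j\<in>UNIV. a j *\<^sub>R A j)" for a
  define C where "C = c_matrix A c0"
  have M_adj: "adj (M a) = M a" for a unfolding M_def by (rule adj_combination)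
  have C_adj: "adj C = C" unfolding C_def by (rule adj_c_matrix[where A = A, OF A_herm])
  have C_pos: "0 < (C *v u) \<bullet> u" if "u \<noteq> 0" for u
    using c0 that unfolding pos_definite_def cip_def[symmetric] Re_cip C_def c_matrix_def by blast
  let ?S = "\<lambda>a. pencil_spectrum C (M a)"
  note fin = pencil_spectrum_bound[where C = C, OF C_adj C_pos M_adj]
  \<comment> \<open>The cardinalities of the relative spectra are bounded over the whole real span
    of the \<open>A j\<close>, so some coefficient family \<open>\<beta>\<close> attains the
    maximum.\<close>
  have "range (\<lambda>a. card (?S a)) \<subseteq> {..DIM(complex^'m)}" using fin(2) by auto
  then have fr: "finite (range (\<lambda>a. card (?S a)))" by (rule finite_subset) simp
  have "Max (range (\<lambda>a. card (?S a))) \<in> range (\<lambda>a. card (?S a))" using fr by (intro Max_in) auto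
  then obtain \<beta> where \<beta>: "Max (range (\<lambda>a. card (?S a))) = card (?S \<beta>)" by (rule imageE)
  have max: "card (?S a) \<le> card (?S \<beta>)" for a unfolding \<beta>[symmetric] using fr by (intro Max_ge) auto
  have "\<forall>b\<in>?S \<beta>. \<exists>u. u \<noteq> 0 \<and> M \<beta> *v u = b *\<^sub>R (C *v u)"
    using pencil_spectrum_def[where C = C, OF C_adj C_pos] by blast
  from bchoice[OF this] obtain u where
    "\<forall>b\<in>?S \<beta>. u b \<noteq> 0 \<and> M \<beta> *v u b = b *\<^sub>R (C *v u b)" by (rule exE)
  then have u: "\<And>b. b \<in> ?S \<beta> \<Longrightarrow> u b \<noteq> 0" "\<And>b. b \<in> ?S \<beta> \<Longrightarrow> M \<beta> *v u b = b *\<^sub>R (C *v u b)"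
    by blast+
  obtain \<kappa>1 where \<kappa>1: "\<And>w. (M \<beta> *v w) \<bullet> w \<le> \<kappa>1 * ((C *v w) \<bullet> w)"
    using largest_pencil_eigenvalue[where C = C, OF C_adj C_pos M_adj[of \<beta>]] by blast
  have "adj (- M \<beta>) = - M \<beta>" by (simp add: adj_minus M_adj)
  then obtain \<kappa>2 where \<kappa>2: "\<And>w. (- M \<beta> *v w) \<bullet> w \<le> \<kappa>2 * ((C *v w) \<bullet> w)"
    using largest_pencil_eigenvalue[where C = C, OF C_adj C_pos] by blast
  define \<kappa> where "\<kappa> = \<bar>\<kappa>1\<bar> + \<bar>\<kappa>2\<bar>"
  have Cn: "0 \<le> (C *v w) \<bullet> w" for w using C_nonneg[where C = C, OF C_adj C_pos] .
  have \<kappa>: "\<bar>(M \<beta> *v w) \<bullet> w\<bar> \<le> \<kappa> * ((C *v w) \<bullet> w)" for w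
  proof -
    have "\<kappa>1 * ((C *v w) \<bullet> w) \<le> \<kappa> * ((C *v w) \<bullet> w)" "\<kappa>2 * ((C *v w) \<bullet> w) \<le> \<kappa> * ((C *v w) \<bullet> w)"
      using Cn[of w] by (auto simp: \<kappa>_def intro!: mult_right_mono)
    then show ?thesis using \<kappa>1[of w] \<kappa>2[of w] by (simp add: mat_vec_minus_left)
  qed
  have \<kappa>0: "\<kappa> \<ge> 0" by (simp add: \<kappa>_def)
  \<comment> \<open>Small enough for \<open>t * \<kappa> \<le> 1 / 2\<close>, so that the
    perturbation of \<open>C\<close> on the circle stays below half of its form.\<close>
  define t where "t = 1 / (2 * (\<kappa> + 1))"
  have t: "t > 0" "t * \<kappa> \<le> 1 / 2" using \<kappa>0 by (auto simp: t_def field_simps)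
  \<comment> \<open>Real entries make \<open>lam_matrix\<close> a real multiple of
    \<open>M \<beta>\<close>. On a relative eigenvector the quadratic matrix equation then reduces
    to a scalar multiple of \<open>C *v u b\<close>.\<close>
  define lam :: "complex^'k" where "lam = (\<chi> j. of_real (t * \<beta> j))"
  have circle: "circle_form A lam c0 \<zeta> = (t * Re \<zeta>) *\<^sub>R M \<beta> + C" for \<zeta>
    by (simp add: circle_form_def lam_def M_def C_def c_matrix_def scaleR_sum_right scaleR_add_left sum.distrib algebra_simps)
  have pos: "positive_on_circle A lam c0"
    unfolding positive_on_circle_def
  proof (intro ballI allI impI)
    fix \<zeta> :: complex and w :: "complex^'m" assume z: "\<zeta> \<in> sphere 0 1" and w: "w \<noteq> 0"
    have "\<bar>Re \<zeta>\<bar> \<le> 1" using abs_Re_le_cmod[of \<zeta>] z by simp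
    have "\<bar>t * Re \<zeta> * ((M \<beta> *v w) \<bullet> w)\<bar> = (t * \<bar>Re \<zeta>\<bar>) * \<bar>(M \<beta> *v w) \<bullet> w\<bar>"
      using t(1) by (simp add: abs_mult)
    also have "\<dots> \<le> (t * 1) * (\<kappa> * ((C *v w) \<bullet> w))"
      using t(1) \<open>\<bar>Re \<zeta>\<bar> \<le> 1\<close> \<kappa>[of w] by (intro mult_mono mult_left_mono) auto
    also have "\<dots> = (t * \<kappa>) * ((C *v w) \<bullet> w)" by simp
    also have "\<dots> \<le> 1 / 2 * ((C *v w) \<bullet> w)" using t(2) Cn by (rule mult_right_mono)
    finally have "\<bar>t * Re \<zeta> * ((M \<beta> *v w) \<bullet> w)\<bar> \<le> 1 / 2 * ((C *v w) \<bullet> w)" .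
    moreover have "(circle_form A lam c0 \<zeta> *v w) \<bullet> w = t * Re \<zeta> * ((M \<beta> *v w) \<bullet> w) + (C *v w) \<bullet> w"
      by (simp add: circle matrix_vector_mult_add_rdistrib mat_vec_scaleR_left inner_add_left)
    ultimately show "0 < (circle_form A lam c0 \<zeta> *v w) \<bullet> w" using C_pos[OF w] by linarith
  qed
  let ?X = "disc_solvent A lam c0"
  obtain K where "stable_factorization (lam_matrix A lam) (2 *\<^sub>R c_matrix A c0) K ?X"
    using positive_on_circle_factorization[where A = A, OF A_herm pos] by blast
  then interpret stable_factorization "lam_matrix A lam" "2 *\<^sub>R c_matrix A c0" K ?X .
  have lam_M: "lam_matrix A lam = t *\<^sub>R M \<beta>"
    by (simp add: lam_matrix_def lam_def M_def vec_eq_iff scaleR_complex sum_distrib_left mult.assoc)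
  \<comment> \<open>The root of \<open>t * b + 2 * x + t * b * x\<^sup>2 = 0\<close> in the closed
    disc, with the square root moved to the denominator so that \<open>b = 0\<close> needs no
    separate treatment.\<close>
  define x where "x b = - (t * b) / (1 + sqrt (1 - (t * b)\<^sup>2))" for b
  have tb: "\<bar>t * b\<bar> \<le> 1 / 2" if "b \<in> ?S \<beta>" for b
  proof -
    have c: "(C *v u b) \<bullet> u b > 0" by (rule C_pos[OF u(1)[OF that]])
    have "\<bar>b\<bar> * ((C *v u b) \<bullet> u b) = \<bar>(M \<beta> *v u b) \<bullet> u b\<bar>"
      using u(2)[OF that] c by (simp add: abs_mult)
    also have "\<dots> \<le> \<kappa> * ((C *v u b) \<bullet> u b)" by (rule \<kappa>)
    finally have "\<bar>b\<bar> \<le> \<kappa>" using c by simp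
    then have "t * \<bar>b\<bar> \<le> t * \<kappa>" using t(1) by simp
    moreover have "\<bar>t * b\<bar> = t * \<bar>b\<bar>" using t(1) by (simp add: abs_mult)
    ultimately show ?thesis using t(2) by linarith
  qed
  have x_eq: "t * b + 2 * x b + t * b * (x b)\<^sup>2 = 0" and x_le: "\<bar>x b\<bar> \<le> 1" if "b \<in> ?S \<beta>" for b
  proof -
    define s where "s = t * b"
    define r where "r = sqrt (1 - s\<^sup>2)"
    have "s\<^sup>2 \<le> 1" using tb[OF that] abs_square_le_1[of s] by (simp add: s_def)
    then have r: "r\<^sup>2 = 1 - s\<^sup>2" "r \<ge> 0" by (auto simp: r_def)
    have "x b = - s / (1 + r)" by (simp add: x_def r_def s_def)
    moreover have "1 + r \<noteq> 0" using r(2) by linarith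
    ultimately have x: "x b * (1 + r) = - s" by simp
    have "(s + 2 * x b + s * (x b)\<^sup>2) * (1 + r)\<^sup>2 = s * (1 + r)\<^sup>2 + 2 * (x b * (1 + r)) * (1 + r) + s * (x b * (1 + r))\<^sup>2"
      by (simp add: power2_eq_square algebra_simps)
    also have "\<dots> = s * (r\<^sup>2 + s\<^sup>2 - 1)" unfolding x by (simp add: power2_eq_square algebra_simps)
    also have "\<dots> = 0" using r(1) by simp
    finally have "s + 2 * x b + s * (x b)\<^sup>2 = 0" using r(2) by simp
    then show "t * b + 2 * x b + t * b * (x b)\<^sup>2 = 0" by (simp add: s_def)
    have "\<bar>x b\<bar> * 1 \<le> \<bar>x b\<bar> * (1 + r)" using r(2) by (intro mult_left_mono) auto
    also have "\<dots> = \<bar>x b * (1 + r)\<bar>" using r(2) by (simp add: abs_mult)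
    also have "\<dots> = \<bar>s\<bar>" unfolding x by simp
    finally show "\<bar>x b\<bar> \<le> 1" using tb[OF that] by (simp add: s_def)
  qed
  have inj_x: "inj_on x (?S \<beta>)"
  proof (rule inj_onI)
    fix b b' assume b: "b \<in> ?S \<beta>" "b' \<in> ?S \<beta>" "x b = x b'"
    \<comment> \<open>The scalar equation recovers \<open>t * b\<close> from its root, so different
      eigenvalues have different roots.\<close>
    have "t * b * (1 + (x b)\<^sup>2) = t * b' * (1 + (x b)\<^sup>2)"
      using x_eq[OF b(1)] x_eq[OF b(2)] b(3) by (simp add: algebra_simps)
    moreover have "1 + (x b)\<^sup>2 > 0" by (intro add_pos_nonneg) auto
    ultimately show "b = b'" using t(1) by simp
  qed
  have eig: "?X *v u b = x b *\<^sub>R u b" if b: "b \<in> ?S \<beta>" for b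
  proof -
    have "?X *v u b = of_real (x b) *s u b"
    proof (rule solvent_eigenvector)
      show "cmod (of_real (x b)) \<le> 1" using x_le[OF b] by simp
      have "adj (lam_matrix A lam) = t *\<^sub>R M \<beta>" unfolding lam_M by (simp add: adj_scaleR M_adj)
      then have "lam_matrix A lam *v u b + of_real (x b) *s ((2 *\<^sub>R c_matrix A c0) *v u b) +
          (of_real (x b))\<^sup>2 *s (adj (lam_matrix A lam) *v u b) =
          (t * b + 2 * x b + t * b * (x b)\<^sup>2) *\<^sub>R (C *v u b)"
        unfolding lam_M C_def[symmetric] of_real_power[symmetric] of_real_vec_scale
        by (simp add: mat_vec_scaleR_left u(2)[OF b] algebra_simps)
      then show "lam_matrix A lam *v u b + of_real (x b) *s ((2 *\<^sub>R c_matrix A c0) *v u b) +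
          (of_real (x b))\<^sup>2 *s (adj (lam_matrix A lam) *v u b) = 0"
        using x_eq[OF b] by simp
    qed
    then show ?thesis by (simp only: of_real_vec_scale)
  qed
  have pow: "matpow ?X n *v u b = x b ^ n *\<^sub>R u b" if b: "b \<in> ?S \<beta>" for b n
  proof (induction n)
    case (Suc n)
    have "matpow ?X (Suc n) *v u b = ?X *v (matpow ?X n *v u b)" by (simp add: matrix_vector_mul_assoc)
    also have "\<dots> = x b ^ Suc n *\<^sub>R u b" unfolding Suc.IH mat_vec_scaleR_right eig[OF b] by simp
    finally show ?case .
  qed simp
  define v where "v = (\<Sum>b\<in>?S \<beta>. u b)"
  have "\<forall>j. a j = 0" if a: "\<forall>n. M a *v (matpow ?X n *v v) = 0" for a
  proof -
    have "(\<Sum>b\<in>?S \<beta>. x b ^ n *\<^sub>R (M a *v u b)) = 0" for n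
    proof -
      have "M a *v (matpow ?X n *v v) = (\<Sum>b\<in>?S \<beta>. M a *v (matpow ?X n *v u b))"
        unfolding v_def mat_vec_sum ..
      also have "\<dots> = (\<Sum>b\<in>?S \<beta>. x b ^ n *\<^sub>R (M a *v u b))"
        by (intro sum.cong refl) (simp only: pow mat_vec_scaleR_right)
      finally show ?thesis using a by simp
    qed
    then have kill: "\<forall>b\<in>?S \<beta>. M a *v u b = 0"
      by (intro distinct_powers_independent[OF fin(1) inj_x])
    have "M a = 0"
    proof (rule maximal_spectrum_rigid[where C = C and B = "M \<beta>" and u = u, OF C_adj C_pos M_adj M_adj])
      \<comment> \<open>Adding a multiple of \<open>M a\<close> stays in the span of the
        \<open>A j\<close>, where \<open>\<beta>\<close> has maximal spectrum.\<close>
      fix s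
      have "M \<beta> + s *\<^sub>R M a = M (\<lambda>j. \<beta> j + s * a j)"
        by (simp add: M_def scaleR_sum_right scaleR_add_left sum.distrib)
      then show "card (pencil_spectrum C (M \<beta> + s *\<^sub>R M a)) \<le> card (?S \<beta>)" using max by simp
    next
      show "u b \<noteq> 0 \<and> M \<beta> *v u b = b *\<^sub>R (C *v u b) \<and> M a *v u b = 0" if "b \<in> ?S \<beta>" for b
        using u kill that by blast
    qed
    \<comment> \<open>\<open>independent\<close> speaks of sets of matrices; injectivity of
      \<open>A\<close> converts coefficients indexed by \<open>j\<close> into coefficients indexed
      by the matrices themselves.\<close>
    then have "(\<Sum>w\<in>range A. a (inv A w) *\<^sub>R w) = 0"
      using inj by (simp add: sum.reindex M_def)
    then have "a (inv A (A j)) = 0" for j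
      using independentD[OF ind _ subset_refl, of "\<lambda>w. a (inv A w)" "A j"] by simp
    then show ?thesis using inj by simp
  qed
  then show ?thesis using pos unfolding M_def by blast
qed

end

section \<open>The Gram determinant as an algebraic function\<close>

text \<open>The symmetric part becomes the real part and the antisymmetric part the imaginary part:
  a linear isomorphism from all real square matrices onto the Hermitian ones. Hermitian unknowns
  thus fill a Euclidean space, and dimensions can be compared through types.\<close>

definition herm_of_real :: "real^'m^'m \<Rightarrow> complex^'m^'m" where
  "herm_of_real M = (\<chi> i j. Complex ((M $ i $ j + M $ j $ i) / 2) ((M $ i $ j - M $ j $ i) / 2))"

definition real_of_herm :: "complex^'m^'m \<Rightarrow> real^'m^'m" where
  "real_of_herm H = (\<chi> i j. Re (H $ i $ j) + Im (H $ i $ j))"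

lemma adj_herm_of_real: "adj (herm_of_real M) = herm_of_real M"
  by (simp add: adj_def herm_of_real_def vec_eq_iff complex_eq_iff add.commute field_simps)

lemma herm_of_real_of_herm:
  assumes "adj H = H"
  shows "herm_of_real (real_of_herm H) = H"
proof -
  have "herm_of_real (real_of_herm H) $ i $ j = H $ i $ j" for i j
  proof -
    have "Re (H $ j $ i) = Re (H $ i $ j)" "Im (H $ j $ i) = - Im (H $ i $ j)"
      using arg_cong[OF assms, of "\<lambda>M. M $ i $ j"] by (simp_all add: adj_def complex_eq_iff)
    then show ?thesis by (simp add: herm_of_real_def real_of_herm_def complex_eq_iff)
  qed
  then show ?thesis by (simp add: vec_eq_iff)
qed

lemma real_of_herm_of_real: "real_of_herm (herm_of_real M) = M"
  by (simp add: herm_of_real_def real_of_herm_def vec_eq_iff field_simps)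

text \<open>Triples \<open>(P, M, v)\<close>, where \<open>M\<close> encodes a Hermitian matrix.\<close>

type_synonym 'm coeffs = "(complex^'m^'m) \<times> (real^'m^'m) \<times> (complex^'m)"

definition symbol_form :: "'m::finite coeffs \<Rightarrow> complex \<times> (complex^'m) \<Rightarrow> real" where
  "symbol_form y p = (fst p *s (fst y *v snd p) + cnj (fst p) *s (adj (fst y) *v snd p) +
     herm_of_real (fst (snd y)) *v snd p) \<bullet> snd p"

text \<open>Unit vectors suffice by homogeneity, and they make the condition range over a compact
  set, from which openness follows.\<close>

definition positive_coeffs :: "'m::finite coeffs set" where
  "positive_coeffs = {y. \<forall>p\<in>sphere 0 1 \<times> sphere 0 1. 0 < symbol_form y p}"

lemma symbol_form_eq:
  "symbol_form y p = Re (\<Sum>i\<in>UNIV. (fst p * (\<Sum>j\<in>UNIV. fst y $ i $ j * snd p $ j) +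
     cnj (fst p) * (\<Sum>j\<in>UNIV. cnj (fst y $ j $ i) * snd p $ j) +
     (\<Sum>j\<in>UNIV. (of_real ((fst (snd y) $ i $ j + fst (snd y) $ j $ i) / 2) +
        \<i> * of_real ((fst (snd y) $ i $ j - fst (snd y) $ j $ i) / 2)) * snd p $ j)) * cnj (snd p $ i))"
  unfolding symbol_form_def Re_cip[symmetric] cip_sum
  by (simp add: matrix_vector_mult_def adj_def herm_of_real_def Complex_eq)

text \<open>The complement is the projection, along a compact factor, of the closed set where the
  form is nonpositive.\<close>

lemma open_positive_coeffs: "open (positive_coeffs :: 'm::finite coeffs set)"
proof -
  let ?K = "sphere (0::complex) 1 \<times> sphere (0::complex^'m) 1"
  have "continuous_on UNIV (\<lambda>z :: (complex \<times> (complex^'m)) \<times> 'm coeffs. symbol_form (snd z) (fst z))"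
    unfolding symbol_form_eq by (intro continuous_intros) simp_all
  then have "closed {z :: (complex \<times> (complex^'m)) \<times> 'm coeffs. symbol_form (snd z) (fst z) \<le> 0}"
    by (intro closed_Collect_le continuous_on_const)
  then have c: "closed {y. \<exists>p. p \<in> ?K \<and> (p, y) \<in> {z. symbol_form (snd z) (fst z) \<le> 0}}"
    by (intro closed_compact_projection compact_Times compact_sphere)
  have e: "positive_coeffs = - {y. \<exists>p. p \<in> ?K \<and> (p, y) \<in> {z. symbol_form (snd z) (fst z) \<le> 0}}"
    unfolding positive_coeffs_def not_le[symmetric] mem_Collect_eq fst_conv snd_conv by blast
  show ?thesis unfolding e using c by (rule open_Compl)
qed

lemma herm_of_real_linear: "herm_of_real (a *\<^sub>R M + b *\<^sub>R N) = a *\<^sub>R herm_of_real M + b *\<^sub>R herm_of_real N"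
  by (simp add: herm_of_real_def vec_eq_iff complex_eq_iff field_simps)

lemma symbol_form_linear: "symbol_form (a *\<^sub>R y + b *\<^sub>R y') p = a * symbol_form y p + b * symbol_form y' p"
proof -
  have s: "c *s (r *\<^sub>R u) = r *\<^sub>R (c *s u)" for c r and u :: "complex^'n"
    by (simp add: vec_eq_iff scaleR_complex)
  show ?thesis
    by (simp add: symbol_form_def adj_add adj_scaleR herm_of_real_linear matrix_vector_mult_add_rdistrib
        mat_vec_scaleR_left vec.scale_right_distrib s inner_add_left algebra_simps)
qed

lemma convex_positive_coeffs: "convex (positive_coeffs :: 'm::finite coeffs set)"
proof (rule convexI)
  fix x y :: "'m coeffs" and a b :: real
  assume *: "x \<in> positive_coeffs" "y \<in> positive_coeffs" "0 \<le> a" "0 \<le> b" "a + b = 1"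
  show "a *\<^sub>R x + b *\<^sub>R y \<in> positive_coeffs"
    unfolding positive_coeffs_def mem_Collect_eq symbol_form_linear
  proof (rule ballI)
    fix p assume "p \<in> sphere (0::complex) 1 \<times> sphere (0::complex^'m) 1"
    then have p: "0 < symbol_form x p" "0 < symbol_form y p" using *(1,2) by (auto simp: positive_coeffs_def)
    show "0 < a * symbol_form x p + b * symbol_form y p"
    proof (cases "a = 0")
      case True
      then show ?thesis using *(5) p(2) by simp
    next
      case False
      then have "0 < a * symbol_form x p" using *(3) p(1) by simp
      moreover have "0 \<le> b * symbol_form y p" using *(4) p(2) by simp
      ultimately show ?thesis by simp
    qed
  qed
qed

lemma symbol_form_scaleR: "symbol_form y (\<zeta>, r *\<^sub>R u) = r\<^sup>2 * symbol_form y (\<zeta>, u)"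
proof -
  have s: "c *s (r *\<^sub>R u) = r *\<^sub>R (c *s u)" for c and u :: "complex^'n"
    by (simp add: vec_eq_iff scaleR_complex)
  show ?thesis
    by (simp add: symbol_form_def mat_vec_scaleR_right s inner_add_left power2_eq_square algebra_simps)
qed

lemma positive_coeffs_iff:
  "y \<in> positive_coeffs \<longleftrightarrow> (\<forall>\<zeta>\<in>sphere 0 1. \<forall>u. u \<noteq> 0 \<longrightarrow> 0 < symbol_form y (\<zeta>, u))"
proof
  assume y: "y \<in> positive_coeffs"
  show "\<forall>\<zeta>\<in>sphere 0 1. \<forall>u. u \<noteq> 0 \<longrightarrow> 0 < symbol_form y (\<zeta>, u)"
  proof (intro ballI allI impI)
    fix \<zeta> :: complex and u :: "complex^'a" assume z: "\<zeta> \<in> sphere 0 1" and u: "u \<noteq> 0"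
    have "0 < symbol_form y (\<zeta>, (1 / norm u) *\<^sub>R u)"
      using y z u by (auto simp: positive_coeffs_def)
    then show "0 < symbol_form y (\<zeta>, u)"
      unfolding symbol_form_scaleR by (simp add: zero_less_mult_iff)
  qed
next
  assume *: "\<forall>\<zeta>\<in>sphere 0 1. \<forall>u. u \<noteq> 0 \<longrightarrow> 0 < symbol_form y (\<zeta>, u)"
  have "0 < symbol_form y (\<zeta>, u)" if "\<zeta> \<in> sphere 0 1" "u \<in> sphere 0 1" for \<zeta> u
  proof -
    have "u \<noteq> 0" using that(2) by auto
    then show ?thesis using * that(1) by blast
  qed
  then show "y \<in> positive_coeffs" by (auto simp: positive_coeffs_def)
qed

lemma positive_coeffs_symbol:
  assumes "(P, M, v) \<in> positive_coeffs"
  shows "positive_symbol P (herm_of_real M)"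
proof
  show "adj (herm_of_real M) = herm_of_real M" by (rule adj_herm_of_real)
  fix \<theta> and u :: "complex^'a" assume "u \<noteq> 0"
  then have "0 < symbol_form (P, M, v) (cis \<theta>, u)" using assms unfolding positive_coeffs_iff by simp
  then show "0 < (symbol P (herm_of_real M) \<theta> *v u) \<bullet> u"
    by (simp add: symbol_form_def symbol_mult cis_cnj)
qed

text \<open>The Gram determinant, over the reals, of the \<open>k\<close> finite sequences with
  entries \<open>A j *v (matpow X n *v v)\<close>. The real inner product is the right one because
  only real combinations of the \<open>A j\<close> define conormals. The range of \<open>n\<close>
  is long enough by \<open>krylov_stabilizes\<close>.\<close>

definition gram_det :: "('k::finite \<Rightarrow> complex^'m::finite^'m) \<Rightarrow> complex^'m^'m \<Rightarrow> complex^'m \<Rightarrow> real" where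
  "gram_det A X v = det (\<chi> j l. \<Sum>n\<le>DIM(complex^'m). (A j *v (matpow X n *v v)) \<bullet> (A l *v (matpow X n *v v)))"

lemma matpow_entry_subring:
  fixes X :: "'x \<Rightarrow> complex^'m::finite^'m"
  assumes C: "function_subring C" and X: "\<And>i j. (\<lambda>x. X x $ i $ j) \<in> C"
  shows "(\<lambda>x. matpow (X x) n $ i $ j) \<in> C"
proof (induction n arbitrary: i j)
  case 0
  then show ?case using subring_const[OF C] by simp
next
  case (Suc n)
  show ?case unfolding matpow.simps by (rule subring_mat_mult[OF C X Suc.IH])
qed

text \<open>Stated for an arbitrary ring of functions because it serves both smoothness, with period
  integrals, and algebraicity, with polynomials. Closure under conjugation is used since the real
  inner product is the mean of \<open>cip\<close> and its conjugate.\<close>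

lemma gram_det_subring:
  fixes X :: "'x \<Rightarrow> complex^'m::finite^'m"
  assumes C: "function_subring C" and cnj: "\<And>f. f \<in> C \<Longrightarrow> (\<lambda>x. cnj (f x)) \<in> C"
    and X: "\<And>i j. (\<lambda>x. X x $ i $ j) \<in> C" and v: "\<And>i. (\<lambda>x. v x $ i) \<in> C"
  shows "(\<lambda>x. complex_of_real (gram_det A (X x) (v x))) \<in> C"
proof -
  define q where "q x n j = A j *v (matpow (X x) n *v v x)" for x n j
  have q: "(\<lambda>x. q x n j $ i) \<in> C" for n j i
    unfolding q_def
    by (rule subring_mat_vec_mult[OF C subring_const[OF C]], rule subring_mat_vec_mult[OF C _ v],
        rule matpow_entry_subring[OF C X])
  have cip: "(\<lambda>x. cip (q x n j) (q x n l)) \<in> C" for n j l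
    unfolding cip_sum by (rule subring_sum[OF C], rule subring_mult[OF C q cnj[OF q]])
  have e: "complex_of_real (q x n j \<bullet> q x n l) = 1 / 2 * (cip (q x n j) (q x n l) + cnj (cip (q x n j) (q x n l)))" for x n j l
    unfolding Re_cip[symmetric] by (simp add: complex_eq_iff)
  have inner: "(\<lambda>x. complex_of_real (q x n j \<bullet> q x n l)) \<in> C" for n j l
    unfolding e by (rule subring_mult[OF C subring_const[OF C] subring_add[OF C cip cnj[OF cip]]])
  have gram: "(\<lambda>x. complex_of_real (\<Sum>n\<le>DIM(complex^'m). q x n j \<bullet> q x n l)) \<in> C" for j l
    unfolding of_real_sum by (rule subring_sum[OF C inner])
  have "complex_of_real (gram_det A (X x) (v x)) = (\<Sum>p | p permutes UNIV. of_real (of_int (sign p)) *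
      (\<Prod>j\<in>UNIV. complex_of_real (\<Sum>n\<le>DIM(complex^'m). q x n j \<bullet> q x n (p j))))" for x
    unfolding gram_det_def det_def q_def by simp
  then show ?thesis
    by (simp only:) (rule subring_sum[OF C], rule subring_mult[OF C subring_const[OF C]],
        rule subring_prod[OF C gram])
qed

text \<open>Among more vectors than the dimension, some iterate lies in the span of its
  predecessors. That span is then invariant under \<open>X\<close>, contains all iterates, and is
  annihilated by \<open>M\<close>.\<close>

lemma krylov_stabilizes:
  fixes X :: "complex^'m::finite^'m"
  assumes "\<And>n. n \<le> DIM(complex^'m) \<Longrightarrow> M *v (matpow X n *v v) = 0"
  shows "M *v (matpow X n *v v) = 0"
proof -
  let ?x = "\<lambda>n. matpow X n *v v"
  have "\<exists>n\<le>DIM(complex^'m). ?x n \<in> span (?x ` {..<n})"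
  proof (rule ccontr)
    assume "\<not> ?thesis"
    then have notin: "?x n \<notin> span (?x ` {..<n})" if "n \<le> DIM(complex^'m)" for n using that by blast
    have "independent (?x ` {..<n}) \<and> card (?x ` {..<n}) = n" if "n \<le> Suc DIM(complex^'m)" for n
      using that
    proof (induction n)
      case (Suc n)
      then have *: "independent (?x ` {..<n})" "card (?x ` {..<n}) = n" "?x n \<notin> span (?x ` {..<n})"
        using notin[of n] by auto
      from *(3) have nin: "?x n \<notin> ?x ` {..<n}" by (rule contrapos_nn) (rule span_base)
      show ?case
        unfolding lessThan_Suc image_insert independent_insert
        by (simp only: * nin if_False card_insert_disjoint finite_imageI finite_lessThan simp_thms not_False_eq_True)
    qed (simp add: independent_empty)
    from this[of "Suc DIM(complex^'m)"] have "independent (?x ` {..<Suc DIM(complex^'m)})"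
      "card (?x ` {..<Suc DIM(complex^'m)}) = Suc DIM(complex^'m)" by blast+
    then show False using independent_bound[of "?x ` {..<Suc DIM(complex^'m)}"] by linarith
  qed
  then obtain n0 where n0: "n0 \<le> DIM(complex^'m)" "?x n0 \<in> span (?x ` {..<n0})" by blast
  let ?V = "span (?x ` {..<n0})"
  have lin: "linear (\<lambda>u. X *v u)" "linear (\<lambda>u. M *v u)"
    using bounded_linear_mat_vec bounded_linear.linear by blast+
  have inv: "X *v u \<in> ?V" if "u \<in> ?V" for u
    using that
  proof (induction u rule: span_induct)
    show "subspace {u. X *v u \<in> ?V}"
      unfolding subspace_def by (simp add: matrix_vector_right_distrib mat_vec_scaleR_right span_add span_scale span_zero)
    fix w assume "w \<in> ?x ` {..<n0}"
    then obtain i where i: "i < n0" "w = ?x i" by auto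
    have "X *v w = ?x (Suc i)" by (simp add: i(2) matrix_vector_mul_assoc)
    moreover have "?x (Suc i) \<in> ?V"
    proof (cases "Suc i = n0")
      case True
      then show ?thesis using n0(2) by (simp del: matpow.simps)
    next
      case False
      then show ?thesis using i(1) by (intro span_base imageI) simp
    qed
    ultimately show "X *v w \<in> ?V" by (simp only:)
  qed
  have "?x n \<in> ?V"
  proof (induction n)
    case 0
    show ?case
    proof (cases "n0 = 0")
      case True
      then show ?thesis using n0(2) by simp
    next
      case False
      then show ?thesis by (intro span_base image_eqI[of _ _ 0]) auto
    qed
  next
    case (Suc n)
    from inv[OF this] show ?case by (simp add: matrix_vector_mul_assoc)
  qed
  moreover have "M *v u = 0" if "u \<in> ?V" for u
    using that
  proof (induction u rule: span_induct)
    show "subspace {u. M *v u = 0}"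
      unfolding subspace_def by (simp add: matrix_vector_right_distrib mat_vec_scaleR_right)
    fix w assume "w \<in> ?x ` {..<n0}"
    then show "M *v w = 0" using assms n0(1) by auto
  qed
  ultimately show ?thesis by blast
qed

text \<open>The form of the Gram matrix at \<open>a\<close> is the sum of the squared norms of
  \<open>\<Sum>l. a $ l *\<^sub>R A l\<close> applied to the iterates, so a kernel vector is
  precisely a combination that annihilates them.\<close>

lemma gram_det_zero_iff:
  "gram_det A X v = 0 \<longleftrightarrow> (\<exists>a. (\<exists>j. a j \<noteq> 0) \<and> (\<forall>n. (\<Sum>j\<in>UNIV. a j *\<^sub>R A j) *v (matpow X n *v v) = 0))"
proof -
  define q where "q n = matpow X n *v v" for n
  define G :: "real^'a^'a" where
    "G = (\<chi> j l. \<Sum>n\<le>DIM(complex^'b). (A j *v q n) \<bullet> (A l *v q n))"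
  have Ga: "(G *v a) $ j = (\<Sum>n\<le>DIM(complex^'b). (A j *v q n) \<bullet> ((\<Sum>l\<in>UNIV. a $ l *\<^sub>R A l) *v q n))" for a j
  proof -
    have "(G *v a) $ j = (\<Sum>l\<in>UNIV. \<Sum>n\<le>DIM(complex^'b). (A j *v q n) \<bullet> (A l *v q n) * a $ l)"
      by (simp add: G_def matrix_vector_mult_def sum_distrib_right)
    also have "\<dots> = (\<Sum>n\<le>DIM(complex^'b). \<Sum>l\<in>UNIV. (A j *v q n) \<bullet> (A l *v q n) * a $ l)" by (rule sum.swap)
    also have "\<dots> = (\<Sum>n\<le>DIM(complex^'b). (A j *v q n) \<bullet> ((\<Sum>l\<in>UNIV. a $ l *\<^sub>R A l) *v q n))"
      by (simp add: mat_sum_vec mat_vec_scaleR_left inner_sum_right mult.commute)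
    finally show ?thesis .
  qed
  have form: "(G *v a) \<bullet> a = (\<Sum>n\<le>DIM(complex^'b). (norm ((\<Sum>l\<in>UNIV. a $ l *\<^sub>R A l) *v q n))\<^sup>2)" for a
  proof -
    have "(G *v a) \<bullet> a = (\<Sum>j\<in>UNIV. \<Sum>n\<le>DIM(complex^'b). (a $ j *\<^sub>R (A j *v q n)) \<bullet> ((\<Sum>l\<in>UNIV. a $ l *\<^sub>R A l) *v q n))"
      by (simp add: inner_vec_def Ga sum_distrib_left sum_distrib_right mult.commute)
    also have "\<dots> = (\<Sum>n\<le>DIM(complex^'b). \<Sum>j\<in>UNIV. (a $ j *\<^sub>R (A j *v q n)) \<bullet> ((\<Sum>l\<in>UNIV. a $ l *\<^sub>R A l) *v q n))"
      by (rule sum.swap)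
    also have "\<dots> = (\<Sum>n\<le>DIM(complex^'b). ((\<Sum>l\<in>UNIV. a $ l *\<^sub>R A l) *v q n) \<bullet> ((\<Sum>l\<in>UNIV. a $ l *\<^sub>R A l) *v q n))"
      by (simp only: inner_sum_left[symmetric]) (simp add: mat_sum_vec mat_vec_scaleR_left)
    finally show ?thesis by (simp add: power2_norm_eq_inner)
  qed
  have "det G = 0 \<longleftrightarrow> (\<exists>a. a \<noteq> 0 \<and> G *v a = 0)"
    using invertible_det_nz[of G] matrix_left_invertible_ker[of G] invertible_left_inverse[of G] by blast
  also have "\<dots> \<longleftrightarrow> (\<exists>a :: real^'a. a \<noteq> 0 \<and> (\<forall>n\<le>DIM(complex^'b). (\<Sum>l\<in>UNIV. a $ l *\<^sub>R A l) *v q n = 0))"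
  proof (intro ex_cong1 conj_cong refl iffI)
    fix a assume "G *v a = 0"
    then have "(\<Sum>n\<le>DIM(complex^'b). (norm ((\<Sum>l\<in>UNIV. a $ l *\<^sub>R A l) *v q n))\<^sup>2) = 0" using form[of a] by simp
    then show "\<forall>n\<le>DIM(complex^'b). (\<Sum>l\<in>UNIV. a $ l *\<^sub>R A l) *v q n = 0"
      by (subst (asm) sum_nonneg_eq_0_iff) auto
  next
    fix a assume "\<forall>n\<le>DIM(complex^'b). (\<Sum>l\<in>UNIV. a $ l *\<^sub>R A l) *v q n = 0"
    then show "G *v a = 0" by (simp add: vec_eq_iff[of "G *v a"] Ga)
  qed
  also have "\<dots> \<longleftrightarrow> (\<exists>a :: real^'a. a \<noteq> 0 \<and> (\<forall>n. (\<Sum>l\<in>UNIV. a $ l *\<^sub>R A l) *v q n = 0))"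
    unfolding q_def using krylov_stabilizes by blast
  also have "\<dots> \<longleftrightarrow> (\<exists>a. (\<exists>j. a j \<noteq> 0) \<and> (\<forall>n. (\<Sum>j\<in>UNIV. a j *\<^sub>R A j) *v q n = 0))"
  proof
    assume "\<exists>a :: real^'a. a \<noteq> 0 \<and> (\<forall>n. (\<Sum>l\<in>UNIV. a $ l *\<^sub>R A l) *v q n = 0)"
    then obtain a :: "real^'a" where a: "a \<noteq> 0" "\<forall>n. (\<Sum>l\<in>UNIV. a $ l *\<^sub>R A l) *v q n = 0" by blast
    then have "\<exists>j. a $ j \<noteq> 0" by (simp add: vec_eq_iff)
    then show "\<exists>a. (\<exists>j. a j \<noteq> 0) \<and> (\<forall>n. (\<Sum>j\<in>UNIV. a j *\<^sub>R A j) *v q n = 0)"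
      using a(2) by (intro exI[of _ "\<lambda>j. a $ j"] conjI)
  next
    assume "\<exists>a. (\<exists>j. a j \<noteq> 0) \<and> (\<forall>n. (\<Sum>j\<in>UNIV. a j *\<^sub>R A j) *v q n = 0)"
    then obtain a where a: "\<exists>j. a j \<noteq> 0" "\<forall>n. (\<Sum>j\<in>UNIV. a j *\<^sub>R A j) *v q n = 0" by blast
    then show "\<exists>a :: real^'a. a \<noteq> 0 \<and> (\<forall>n. (\<Sum>l\<in>UNIV. a $ l *\<^sub>R A l) *v q n = 0)"
      by (intro exI[of _ "\<chi> j. a j"]) (auto simp: vec_eq_iff)
  qed
  finally show ?thesis by (simp add: gram_det_def G_def q_def)
qed

definition coeff_gram_det :: "('k::finite \<Rightarrow> complex^'m::finite^'m) \<Rightarrow> 'm coeffs \<Rightarrow> real" where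
  "coeff_gram_det A y = gram_det A (solvent (fst y) (herm_of_real (fst (snd y)))) (snd (snd y))"

lemma param_class_subring: "function_subring (param_class U)"
  unfolding function_subring_def by (auto intro: param_class_const param_class.add param_class.mult)

lemma period_class_subring: "function_subring (period_class U)"
  unfolding function_subring_def by (auto intro: period_class_const period_class.add period_class.mult)

lemma bounded_linear_entries:
  "bounded_linear (\<lambda>y :: 'm::finite coeffs. fst y $ i $ j)"
  "bounded_linear (\<lambda>y :: 'm coeffs. cnj (fst y $ i $ j))"
  "bounded_linear (\<lambda>y :: 'm coeffs. herm_of_real (fst (snd y)) $ i $ j)"
  "bounded_linear (\<lambda>y :: 'm coeffs. snd (snd y) $ i)"
  by (rule linear_conv_bounded_linear[THEN iffD1], rule linearI,
      simp_all add: herm_of_real_def complex_eq_iff scaleR_complex field_simps)+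

text \<open>The inverse symbol is rational in the coefficients by Cramer's rule, its moments are
  period integrals, and a second Cramer inverse leads to the solvent; positivity keeps both
  determinants away from zero.\<close>

lemma coeff_gram_det_period_class:
  fixes A :: "'k::finite \<Rightarrow> complex^'m::finite^'m"
  shows "(\<lambda>y. complex_of_real (coeff_gram_det A y)) \<in> period_class positive_coeffs"
proof -
  let ?S = "\<lambda>p :: 'm coeffs \<times> real. symbol (fst (fst p)) (herm_of_real (fst (snd (fst p)))) (snd p)"
  let ?g = "\<lambda>n y :: 'm coeffs. moment (fst y) (herm_of_real (fst (snd y))) n"
  have angle: "(\<lambda>p :: 'm coeffs \<times> real. cis (c * snd p)) \<in> param_class positive_coeffs" for c
    by (rule param_class.angle) (intro continuous_intros)
  have S: "(\<lambda>p. ?S p $ i $ j) \<in> param_class positive_coeffs" for i j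
  proof -
    have "(\<lambda>p :: 'm coeffs \<times> real. cis (1 * snd p) * fst (fst p) $ i $ j +
        cis (- 1 * snd p) * cnj (fst (fst p) $ j $ i) + herm_of_real (fst (snd (fst p))) $ i $ j) \<in> param_class positive_coeffs"
      by (intro param_class.add param_class.mult angle param_class.lin[OF bounded_linear_entries(1)]
          param_class.lin[OF bounded_linear_entries(2)] param_class.lin[OF bounded_linear_entries(3)])
    then show ?thesis by (simp add: symbol_def)
  qed
  have pos: "positive_symbol (fst y) (herm_of_real (fst (snd y)))" if "y \<in> positive_coeffs" for y :: "'m coeffs"
    using positive_coeffs_symbol[of "fst y" "fst (snd y)" "snd (snd y)"] that by simp
  have "(\<lambda>p. inverse (det (?S p))) \<in> param_class positive_coeffs"
  proof (rule param_class.inverse[OF subring_det[OF param_class_subring S]])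
    fix y :: "'m coeffs" and \<theta> assume "y \<in> positive_coeffs"
    then show "det (?S (y, \<theta>)) \<noteq> 0"
      using positive_symbol.symbol_invertible[OF pos] invertible_det_nz by fastforce
  qed
  then have "(\<lambda>p. cramer_inverse (?S p) $ i $ j) \<in> param_class positive_coeffs" for i j
    by (rule subring_cramer_inverse[OF param_class_subring S])
  then have "(\<lambda>p. cis (- of_int n * snd p) * cramer_inverse (?S p) $ i $ j) \<in> param_class positive_coeffs" for n i j
    by (intro param_class.mult angle)
  from period_class.int[OF this]
  have g: "(\<lambda>y. ?g n y $ i $ j) \<in> period_class positive_coeffs" for n i j
    by (simp only: moment_def vec_lambda_beta fst_conv snd_conv)
  have "(\<lambda>y. inverse (det (?g 0 y))) \<in> period_class positive_coeffs"
  proof (rule period_class.inverse[OF subring_det[OF period_class_subring g]])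
    fix y :: "'m coeffs" assume "y \<in> positive_coeffs"
    then show "det (?g 0 y) \<noteq> 0"
      using positive_symbol.moment_0_invertible[OF pos] invertible_det_nz by blast
  qed
  then have cg: "(\<lambda>y :: 'm coeffs. cramer_inverse (?g 0 y) $ i $ j) \<in> period_class positive_coeffs" for i j
    by (rule subring_cramer_inverse[OF period_class_subring g])
  have X: "(\<lambda>y :: 'm coeffs. solvent (fst y) (herm_of_real (fst (snd y))) $ i $ j) \<in> period_class positive_coeffs" for i j
    unfolding solvent_def
    by (rule subring_mat_mult[where M = "?g 1" and N = "\<lambda>y. cramer_inverse (?g 0 y)", OF period_class_subring g cg])
  show ?thesis
    unfolding coeff_gram_det_def
    by (rule gram_det_subring[OF period_class_subring period_class.cnj X period_class_linear[OF bounded_linear_entries(4)]])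
qed

definition complex_polynomials :: "('a::real_normed_vector \<Rightarrow> complex) set" where
  "complex_polynomials = {f. real_polynomial_function (\<lambda>x. Re (f x)) \<and> real_polynomial_function (\<lambda>x. Im (f x))}"

lemma complex_polynomials_subring: "function_subring complex_polynomials"
  unfolding function_subring_def complex_polynomials_def by auto

lemma complex_polynomials_cnj: "f \<in> complex_polynomials \<Longrightarrow> (\<lambda>x. cnj (f x)) \<in> complex_polynomials"
  unfolding complex_polynomials_def by auto

lemma complex_polynomials_linear: "bounded_linear f \<Longrightarrow> f \<in> complex_polynomials"
  unfolding complex_polynomials_def
  by (auto intro!: real_polynomial_function.intros(1) bounded_linear_compose[OF bounded_linear_Re]
      bounded_linear_compose[OF bounded_linear_Im])

lemma polynomial_function_vec:
  fixes f :: "'a::real_normed_vector \<Rightarrow> 'b::euclidean_space^'n"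
  assumes "\<And>i. polynomial_function (\<lambda>x. f x $ i)"
  shows "polynomial_function f"
  unfolding polynomial_function_iff_Basis_inner
proof
  fix b :: "'b^'n" assume "b \<in> Basis"
  then obtain i u where "b = axis i u" "u \<in> Basis" by (auto simp: Basis_vec_def)
  then show "real_polynomial_function (\<lambda>x. f x \<bullet> b)"
    using assms[of i] unfolding polynomial_function_iff_Basis_inner by (simp add: inner_axis)
qed

lemma polynomial_function_complex: "f \<in> complex_polynomials \<Longrightarrow> polynomial_function f"
  unfolding polynomial_function_iff_Basis_inner complex_polynomials_def
  by (auto simp: Basis_complex_def inner_complex_def)

text \<open>The spectral factorization inverts a polynomial map between spaces of equal dimension, so that every
  polynomial in the factors is algebraic over the coefficients.\<close>

lemma coeff_gram_det_algebraic:
  "\<exists>Q :: 'm coeffs \<times> real \<Rightarrow> real. real_polynomial_function Q \<and> Q \<noteq> (\<lambda>_. 0) \<and>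
    (\<forall>y\<in>positive_coeffs. Q (y, coeff_gram_det (A :: 'k::finite \<Rightarrow> complex^'m::finite^'m) y) = 0)"
proof -
  \<comment> \<open>The type of coefficient triples is used here for triples of factors, with
    \<open>X\<close> in the first place and the encoded \<open>K\<close> in the second. Equality of
    the two dimensions is thereby immediate.\<close>
  let ?K = "\<lambda>u :: 'm coeffs. herm_of_real (fst (snd u))"
  let ?P = "\<lambda>u :: 'm coeffs. (\<chi> i j. - 1 * (?K u ** fst u) $ i $ j)"
  let ?H = "\<lambda>u :: 'm coeffs. ?K u + adj (fst u) ** ?K u ** fst u"
  let ?\<Phi> = "\<lambda>u :: 'm coeffs. ((?P u, real_of_herm (?H u), snd (snd u)), gram_det A (fst u) (snd (snd u)))"
  note R = complex_polynomials_subring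
  have X: "(\<lambda>u :: 'm coeffs. fst u $ i $ j) \<in> complex_polynomials" for i j
    by (rule complex_polynomials_linear[OF bounded_linear_entries(1)])
  have aX: "(\<lambda>u :: 'm coeffs. adj (fst u) $ i $ j) \<in> complex_polynomials" for i j
    using complex_polynomials_linear[OF bounded_linear_entries(2)[of j i]] by (simp add: adj_def)
  have K: "(\<lambda>u. ?K u $ i $ j) \<in> complex_polynomials" for i j
    by (rule complex_polynomials_linear[OF bounded_linear_entries(3)])
  have v: "(\<lambda>u :: 'm coeffs. snd (snd u) $ i) \<in> complex_polynomials" for i
    by (rule complex_polynomials_linear[OF bounded_linear_entries(4)])
  have P: "(\<lambda>u. ?P u $ i $ j) \<in> complex_polynomials" for i j
    unfolding vec_lambda_beta by (rule subring_mult[OF R subring_const[OF R] subring_mat_mult[OF R K X]])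
  have H: "(\<lambda>u. ?H u $ i $ j) \<in> complex_polynomials" for i j
    unfolding vector_add_component by (rule subring_add[OF R K subring_mat_mult[OF R subring_mat_mult[OF R aX K] X]])
  have "polynomial_function ?\<Phi>"
  proof (intro polynomial_function_Pair)
    show "polynomial_function ?P"
      by (intro polynomial_function_vec polynomial_function_complex P)
    have "real_polynomial_function (\<lambda>u. Re (?H u $ i $ j) + Im (?H u $ i $ j))" for i j
      using H[of i j] unfolding complex_polynomials_def by auto
    then have "polynomial_function (\<lambda>u. real_of_herm (?H u) $ i $ j)" for i j
      unfolding real_polynomial_function_eq[symmetric] real_of_herm_def vec_lambda_beta .
    then show "polynomial_function (\<lambda>u. real_of_herm (?H u))"
      by (intro polynomial_function_vec)
    show "polynomial_function (\<lambda>u :: 'm coeffs. snd (snd u))"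
      by (intro polynomial_function_vec polynomial_function_complex v)
    have "(\<lambda>u :: 'm coeffs. complex_of_real (gram_det A (fst u) (snd (snd u)))) \<in> complex_polynomials"
      by (rule gram_det_subring[OF R complex_polynomials_cnj X v])
    then show "polynomial_function (\<lambda>u :: 'm coeffs. gram_det A (fst u) (snd (snd u)))"
      unfolding real_polynomial_function_eq[symmetric] complex_polynomials_def by simp
  qed
  \<comment> \<open>The target of the map has exactly one dimension more than its source, namely the
    value of the determinant.\<close>
  then obtain Q where Q: "real_polynomial_function Q" "Q \<noteq> (\<lambda>_. 0)" "\<And>u. Q (?\<Phi> u) = 0"
    using polynomial_map_algebraically_dependent[of ?\<Phi>] by auto
  have "Q (y, coeff_gram_det A y) = 0" if y: "y \<in> positive_coeffs" for y
  proof -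
    obtain P M v where y_eq: "y = (P, M, v)" by (cases y) auto
    let ?X = "solvent P (herm_of_real M)"
    obtain K where K: "adj K = K" "P = - (K ** ?X)" "herm_of_real M = K + adj ?X ** K ** ?X"
      using positive_symbol.factorization[OF positive_coeffs_symbol[OF y[unfolded y_eq]]] by metis
    have "?P (?X, real_of_herm K, v) = - (K ** ?X)"
      by (simp add: vec_eq_iff herm_of_real_of_herm[OF K(1)])
    then have 1: "?P (?X, real_of_herm K, v) = P" using K(2) by (rule trans[OF _ sym])
    have "real_of_herm (?H (?X, real_of_herm K, v)) = real_of_herm (herm_of_real M)"
      unfolding fst_conv snd_conv herm_of_real_of_herm[OF K(1)] K(3)[symmetric] ..
    then have 2: "real_of_herm (?H (?X, real_of_herm K, v)) = M" unfolding real_of_herm_of_real .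
    have "?\<Phi> (?X, real_of_herm K, v) = (y, coeff_gram_det A y)"
      unfolding 1 2 by (simp add: y_eq coeff_gram_det_def)
    then show ?thesis using Q(3)[of "(?X, real_of_herm K, v)"] by (simp only:)
  qed
  then show ?thesis using Q(1,2) by blast
qed

section \<open>Algebraic relations on the parameter space\<close>

lemma period_class_continuous:
  assumes "open V" "convex V" "g \<in> period_class V" "y \<in> V"
  shows "isCont g y"
  using period_class_deriv[OF assms(1,2,3)] assms(4) has_derivative_continuous by blast

text \<open>Plain substitution of \<open>L x\<close> could give the zero polynomial. A direction
  \<open>y1\<close> leading off the image, taken with an extra variable \<open>s\<close>, avoids
  this; after division by the largest power of \<open>s\<close> the relation holds for small nonzero
  \<open>s\<close>, and continuity of \<open>F\<close> gives it at \<open>s = 0\<close>.\<close>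

lemma algebraic_on_subspace:
  fixes L :: "'a::euclidean_space \<Rightarrow> 'b::euclidean_space"
  assumes L: "bounded_linear L" and V: "open V" and F: "\<And>y. y \<in> V \<Longrightarrow> isCont F y"
    and Q: "real_polynomial_function Q" "Q \<noteq> (\<lambda>_. 0)" "\<And>y. y \<in> V \<Longrightarrow> Q (y, F y) = 0"
  shows "\<exists>Q' :: 'a \<times> real \<Rightarrow> real. real_polynomial_function Q' \<and> Q' \<noteq> (\<lambda>_. 0) \<and>
    (\<forall>x. L x \<in> V \<longrightarrow> Q' (x, F (L x)) = 0)"
proof -
  obtain y1 t1 where y1: "Q (y1, t1) \<noteq> 0" using Q(2) unfolding fun_eq_iff by (metis surj_pair)
  \<comment> \<open>At \<open>x = 0\<close> and \<open>s = 1\<close> this takes the nonzero value of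
    \<open>Q\<close> at \<open>(y1, t1)\<close>.\<close>
  define R where "R z = Q (L (fst (fst z)) + snd z *\<^sub>R y1, snd (fst z))" for z :: "('a \<times> real) \<times> real"
  have "bounded_linear (\<lambda>z :: ('a \<times> real) \<times> real. (L (fst (fst z)) + snd z *\<^sub>R y1, snd (fst z)))"
    by (rule bounded_linear_Pair[OF bounded_linear_add[OF
          bounded_linear_compose[OF L bounded_linear_compose[OF bounded_linear_fst bounded_linear_fst]]
          bounded_linear_compose[OF bounded_linear_scaleR_left bounded_linear_snd]]
          bounded_linear_compose[OF bounded_linear_snd bounded_linear_fst]])
  then have "real_polynomial_function R"
    unfolding R_def[abs_def]
    by (intro real_polynomial_function_compose'[OF Q(1)] polynomial_function_bounded_linear)
  moreover have "R ((0, t1), 1) \<noteq> 0"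
    using y1 linear_0[OF bounded_linear.linear[OF L]] by (simp add: R_def)
  then have "R \<noteq> (\<lambda>_. 0)" by auto
  ultimately obtain r R' z0 where R': "real_polynomial_function R'" "\<And>z s. R (z, s) = s ^ r * R' (z, s)" "R' (z0, 0) \<noteq> 0"
    using divide_out_last_variable by metis
  have "real_polynomial_function (\<lambda>z. R' (z, 0))"
    by (rule real_polynomial_function_compose'[OF R'(1)], rule polynomial_function_bounded_linear,
        rule bounded_linear_Pair[OF bounded_linear_ident bounded_linear_zero])
  moreover have "(\<lambda>z. R' (z, 0)) \<noteq> (\<lambda>_. 0)" using R'(3) by metis
  moreover have "R' ((x, F (L x)), 0) = 0" if x: "L x \<in> V" for x
  proof -
    define y where "y s = L x + s *\<^sub>R y1" for s
    have y0: "y 0 = L x" by (simp add: y_def)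
    have cy: "isCont y 0" unfolding y_def by (intro continuous_intros)
    have cFy: "isCont (\<lambda>s. F (y s)) 0"
      by (rule isCont_o2[OF cy]) (use F x y0 in simp)
    have "isCont (\<lambda>s. R' ((x, F (y s)), s)) 0"
    proof (rule isCont_o2[where g = R' and f = "\<lambda>s. ((x, F (y s)), s)"])
      show "isCont (\<lambda>s. ((x, F (y s)), s)) 0" by (intro continuous_intros cFy)
    qed (rule continuous_real_polymonial_function[OF R'(1)])
    then have lim: "((\<lambda>s. R' ((x, F (y s)), s)) \<longlongrightarrow> R' ((x, F (L x)), 0)) (at 0)"
      by (simp add: isCont_def y0)
    have "\<forall>\<^sub>F s in at 0. y s \<in> V"
      using cy V x y0 unfolding isCont_def by (metis topological_tendstoD)
    moreover have "\<forall>\<^sub>F s in at 0. s \<noteq> (0::real)" by (simp add: eventually_at_filter)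
    ultimately have "\<forall>\<^sub>F s in at 0. R' ((x, F (y s)), s) = 0"
    proof eventually_elim
      case (elim s)
      have "s ^ r * R' ((x, F (y s)), s) = Q (y s, F (y s))"
        by (simp add: R'(2)[symmetric] R_def y_def)
      then show ?case using Q(3)[OF elim(1)] elim(2) by simp
    qed
    then have "((\<lambda>s. R' ((x, F (y s)), s)) \<longlongrightarrow> 0) (at 0)" by (rule tendsto_eventually)
    with lim show ?thesis by (rule LIM_unique)
  qed
  ultimately show ?thesis by (intro exI[of _ "\<lambda>z. R' (z, 0)"]) blast
qed

text \<open>After dividing by the largest power of the last variable, the relation still holds where \<open>F \<circ> L\<close> is
  nonzero, hence everywhere by analyticity; putting the last variable to 0 gives \<open>q\<close>.\<close>

lemma zero_set_in_hypersurface: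
  fixes L :: "'a::euclidean_space \<Rightarrow> 'b::euclidean_space"
  assumes L: "bounded_linear L" and V: "open V" "convex V"
    and F: "(\<lambda>y. complex_of_real (F y)) \<in> period_class V"
    and Q: "real_polynomial_function Q" "Q \<noteq> (\<lambda>_. 0)" "\<And>x. L x \<in> V \<Longrightarrow> Q (x, F (L x)) = 0"
    and x1: "L x1 \<in> V" "F (L x1) \<noteq> 0"
  shows "\<exists>q :: 'a \<Rightarrow> real. real_polynomial_function q \<and> q \<noteq> (\<lambda>_. 0) \<and> (\<forall>x. L x \<in> V \<longrightarrow> F (L x) = 0 \<longrightarrow> q x = 0)"
proof -
  obtain r R x0 where R: "real_polynomial_function R" "\<And>x t. Q (x, t) = t ^ r * R (x, t)" "R (x0, 0) \<noteq> 0"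
    using divide_out_last_variable[OF Q(1,2)] by metis
  have "real_polynomial_function (\<lambda>x. R (x, 0))"
    by (rule real_polynomial_function_compose'[OF R(1)], rule polynomial_function_bounded_linear,
        rule bounded_linear_Pair[OF bounded_linear_ident bounded_linear_zero])
  moreover have "(\<lambda>x. R (x, 0)) \<noteq> (\<lambda>_. 0)" using R(3) by metis
  moreover have "R (x, 0) = 0" if x: "L x \<in> V" "F (L x) = 0" for x
  proof (rule ccontr)
    assume nz: "R (x, 0) \<noteq> 0"
    \<comment> \<open>The segment leads from the supposed exceptional zero to \<open>x1\<close>,
      where \<open>F\<close> is known not to vanish.\<close>
    define p where "p t = x + t *\<^sub>R (x1 - x)" for t
    have p0: "p 0 = x" by (simp add: p_def)
    have Lp: "L (p t) = L x + t *\<^sub>R (L x1 - L x)" for t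
      using bounded_linear.linear[OF L] by (simp add: p_def linear_add linear_cmul linear_diff)
    have cp: "isCont p 0" unfolding p_def by (intro continuous_intros)
    have cL: "isCont (\<lambda>t. L (p t)) 0" unfolding Lp by (intro continuous_intros)
    have cF: "isCont F (L x)"
    proof -
      have "isCont (\<lambda>y. Re (complex_of_real (F y))) (L x)"
        by (intro continuous_Re period_class_continuous[OF V F x(1)])
      then show ?thesis by simp
    qed
    have cFp: "isCont (\<lambda>t. F (L (p t))) 0"
      by (rule isCont_o2[OF cL]) (use cF p0 in simp)
    have "isCont (\<lambda>t. R (p t, F (L (p t)))) 0"
    proof (rule isCont_o2[where g = R and f = "\<lambda>t. (p t, F (L (p t)))"])
      show "isCont (\<lambda>t. (p t, F (L (p t)))) 0" by (intro continuous_intros cp cFp)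
    qed (rule continuous_real_polymonial_function[OF R(1)])
    then have "((\<lambda>t. R (p t, F (L (p t)))) \<longlongrightarrow> R (x, 0)) (nhds 0)"
      using p0 x(2) by (simp add: continuous_at tendsto_nhds_iff isCont_def)
    then have "\<forall>\<^sub>F t in nhds 0. R (p t, F (L (p t))) \<noteq> 0" using nz by (rule tendsto_imp_eventually_ne)
    moreover have "\<forall>\<^sub>F t in nhds 0. L (p t) \<in> V"
    proof -
      have "((\<lambda>t. L (p t)) \<longlongrightarrow> L x) (nhds 0)"
        using cL p0 by (simp add: tendsto_nhds_iff isCont_def)
      then show ?thesis using V(1) x(1) by (rule topological_tendstoD)
    qed
    \<comment> \<open>Where \<open>R\<close> is nonzero, the relation says that a power of
      \<open>F\<close> is zero. So \<open>F\<close> vanishes along the beginning of the segment, and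
      the identity principle carries this to \<open>x1\<close>.\<close>
    ultimately have "\<forall>\<^sub>F t in nhds 0. F (L (p t)) = 0"
    proof eventually_elim
      case (elim t)
      then show ?case using Q(3)[of "p t"] R(2)[of "p t" "F (L (p t))"] by simp
    qed
    then obtain \<eta> where \<eta>: "\<eta> > 0" "\<And>t. \<bar>t\<bar> < \<eta> \<Longrightarrow> F (L (p t)) = 0"
      unfolding eventually_nhds_metric dist_real_def by auto
    have "complex_of_real (F (L x1)) = 0"
    proof (rule period_class_zero_on_segment[OF F _ \<eta>(1)])
      show "closed_segment (L x) (L x1) \<subseteq> V" using V(2) x(1) x1(1) by (simp add: closed_segment_subset)
      show "complex_of_real (F (L x + t *\<^sub>R (L x1 - L x))) = 0" if "\<bar>t\<bar> < \<eta>" for t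
        using \<eta>(2)[OF that] by (simp add: Lp)
    qed
    then show False using x1(2) by simp
  qed
  ultimately show ?thesis by (intro exI[of _ "\<lambda>x. R (x, 0)"]) blast
qed

text \<open>Defectiveness does not depend on \<open>w0\<close> and \<open>y0\<close>, so they are
  forgotten.\<close>

definition coeff_map :: "('k::finite \<Rightarrow> complex^'m::finite^'m) \<Rightarrow> ('k, 'm) param \<Rightarrow> 'm coeffs" where
  "coeff_map A p = (lam_matrix A (fst p), real_of_herm (2 *\<^sub>R c_matrix A (fst (snd p))), snd (snd (snd (snd p))))"

lemma bounded_linear_coeff_map: "bounded_linear (coeff_map A)"
proof -
  have "lam_matrix A (a + b) = lam_matrix A a + lam_matrix A b" for a b
    by (simp add: lam_matrix_def vec_eq_iff sum.distrib distrib_right)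
  moreover have "lam_matrix A (r *\<^sub>R a) = r *\<^sub>R lam_matrix A a" for r a
    by (simp add: lam_matrix_def vec_eq_iff scaleR_complex sum_distrib_left mult.assoc)
  moreover have "c_matrix A (a + b) = c_matrix A a + c_matrix A b" for a b
    by (simp add: c_matrix_def scaleR_add_left sum.distrib)
  moreover have "c_matrix A (r *\<^sub>R a) = r *\<^sub>R c_matrix A a" for r a
    by (simp add: c_matrix_def scaleR_sum_right)
  moreover have "real_of_herm (M + N) = real_of_herm M + real_of_herm N" for M N :: "complex^'b^'b"
    by (simp add: real_of_herm_def vec_eq_iff)
  moreover have "real_of_herm (r *\<^sub>R M) = r *\<^sub>R real_of_herm M" for r and M :: "complex^'b^'b"
    by (simp add: real_of_herm_def vec_eq_iff distrib_left)
  ultimately have "linear (coeff_map A)"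
    by (intro linearI) (simp_all add: coeff_map_def scaleR_add_right scaleR_left_commute)
  then show ?thesis by (simp add: linear_conv_bounded_linear)
qed

context
  fixes A :: "'k::finite \<Rightarrow> complex^'m::finite^'m"
  assumes A_herm: "\<And>j. hermitian (A j)"
begin

lemma herm_of_coeff_map: "herm_of_real (real_of_herm (2 *\<^sub>R c_matrix A c)) = 2 *\<^sub>R c_matrix A c"
  by (rule herm_of_real_of_herm) (simp add: adj_scaleR adj_c_matrix[where A = A, OF A_herm])

text \<open>The parameter space becomes the preimage of an open convex set under a linear map,
  through which smoothness and the identity principle are transported.\<close>

lemma coeff_map_positive_iff: "coeff_map A p \<in> positive_coeffs \<longleftrightarrow> p \<in> param_space A"
proof -
  obtain lam c w0 y0 v where p: "p = (lam, c, w0, y0, v)" by (cases p) auto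
  have "symbol_form (coeff_map A p) (\<zeta>, u) = (2 *\<^sub>R (circle_form A lam c \<zeta> *v u)) \<bullet> u" for \<zeta> u
    unfolding symbol_form_def coeff_map_def p fst_conv snd_conv herm_of_coeff_map
      symbol_circle_form[where A = A, OF A_herm] ..
  then show ?thesis
    unfolding positive_coeffs_iff p param_space_iff[where A = A, OF A_herm] positive_on_circle_def by simp
qed

lemma defective_iff:
  assumes p: "p \<in> param_space A" and data: "stationary_data A p \<phi> \<omega>"
  shows "defective_disc (quadric A) \<phi> \<longleftrightarrow> coeff_gram_det A (coeff_map A p) = 0"
proof -
  obtain lam c w0 y0 v where p_eq: "p = (lam, c, w0, y0, v)" by (cases p) auto
  have pos: "positive_on_circle A lam c" using p unfolding p_eq param_space_iff[where A = A, OF A_herm] .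
  show ?thesis
    unfolding coeff_gram_det_def coeff_map_def p_eq fst_conv snd_conv herm_of_coeff_map gram_det_zero_iff
    by (rule stationary_disc_defective_iff[where A = A, OF A_herm pos data[unfolded p_eq]])
qed

lemma stationary_data_in_param_space:
  assumes "p \<in> param_space A"
  shows "\<exists>\<phi> \<omega>. stationary_data A p \<phi> \<omega>"
  using assms unfolding param_space_def admissible_def by blast

text \<open>Defectiveness is a property of a disc, the determinant a function of the parameters;
  existence of a disc for every parameter supplies the inclusion from right to left.\<close>

lemma defective_params_eq:
  "defective_params A = {p \<in> param_space A. coeff_gram_det A (coeff_map A p) = 0}"
  unfolding defective_params_def s_pair_def
  using defective_iff stationary_data_in_param_space by blast

end

theorem theorem4p3:
  fixes A :: "'k::finite \<Rightarrow> complex^'m::finite^'m"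
  assumes "\<And>j. hermitian (A j)"
    and "inj A" and "independent (range A)"
    and "\<exists>c0::real^'k. pos_definite (\<Sum>j\<in>UNIV. c0 $ j *\<^sub>R A j)"
  shows "(\<exists>P \<phi> \<omega>. s_pair A P \<phi> \<omega> \<and> \<not> defective_disc (quadric A) \<phi>) \<and>
    proper_algebraic_set_in (param_space A) (defective_params A)"
proof -
  let ?L = "coeff_map A" and ?F = "coeff_gram_det A"
  let ?U = "param_space A" and ?V = "positive_coeffs :: 'm coeffs set"
  note herm = assms(1)
  note iff = coeff_map_positive_iff[where A = A, OF herm]
  note V = open_positive_coeffs[where 'm = 'm] convex_positive_coeffs[where 'm = 'm]
  note F = coeff_gram_det_period_class[of A]
  obtain c0 where c0: "pos_definite (\<Sum>j\<in>UNIV. c0 $ j *\<^sub>R A j)" using assms(4) by blast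
  obtain lam v where pos: "positive_on_circle A lam c0"
    and nondef: "\<And>a. (\<forall>n. (\<Sum>j\<in>UNIV. a j *\<^sub>R A j) *v (matpow (disc_solvent A lam c0) n *v v) = 0) \<Longrightarrow> (\<forall>j. a j = 0)"
    using nondefective_parameters[where A = A, OF herm assms(2,3) c0] by blast
  define p1 where "p1 = (lam, c0, 0 :: complex^'m, 0 :: real^'k, v)"
  have p1: "p1 \<in> ?U" unfolding p1_def using positive_in_param_space[where A = A, OF herm pos] .
  have Fp1: "?F (?L p1) \<noteq> 0"
    unfolding coeff_gram_det_def coeff_map_def p1_def fst_conv snd_conv herm_of_coeff_map[where A = A, OF herm]
      gram_det_zero_iff
    using nondef by blast
  obtain \<phi> \<omega> where data: "stationary_data A p1 \<phi> \<omega>"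
    using stationary_data_in_param_space[where A = A, OF herm p1] by blast
  have "s_pair A p1 \<phi> \<omega> \<and> \<not> defective_disc (quadric A) \<phi>"
    using p1 data Fp1 defective_iff[where A = A, OF herm p1 data] by (simp add: s_pair_def)
  moreover have D: "defective_params A = {p \<in> ?U. ?F (?L p) = 0}"
    by (rule defective_params_eq[where A = A, OF herm])
  have cont: "isCont ?F y" if "y \<in> ?V" for y
  proof -
    have "isCont (\<lambda>y. Re (complex_of_real (?F y))) y"
      by (intro continuous_Re period_class_continuous[OF V F that])
    then show ?thesis by simp
  qed
  \<comment> \<open>The relation first obtained lives on all positive coefficients;
    \<open>algebraic_on_subspace\<close> turns it into a nonzero polynomial in the parameters
    themselves.\<close>
  obtain Q0 where "real_polynomial_function Q0" "Q0 \<noteq> (\<lambda>_. 0)" "\<And>y. y \<in> ?V \<Longrightarrow> Q0 (y, ?F y) = 0"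
    using coeff_gram_det_algebraic[of A] by blast
  then obtain Q :: "('k, 'm) param \<times> real \<Rightarrow> real" where Q: "real_polynomial_function Q" "Q \<noteq> (\<lambda>_. 0)"
      "\<And>x. ?L x \<in> ?V \<Longrightarrow> Q (x, ?F (?L x)) = 0"
    using algebraic_on_subspace[OF bounded_linear_coeff_map[of A] V(1) cont] by metis
  have "smooth_fun_on ?V ?F"
    using period_class_smooth[OF V F] by simp
  then have "smooth_fun_on ?U (\<lambda>p. ?F (?L p))"
    by (rule smooth_fun_on_compose_linear[OF _ bounded_linear_coeff_map]) (simp add: iff)
  then have "algebraic_fun_on ?U (\<lambda>p. ?F (?L p))"
    unfolding algebraic_fun_on_def using Q iff by blast
  then have "algebraic_set_in ?U (defective_params A)"
    \<comment> \<open>A single equation defines the set, because a Gram determinant detects all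
      linear dependencies at once.\<close>
    unfolding algebraic_set_in_def D by (intro exI[of _ "{\<lambda>p. ?F (?L p)}"]) simp
  moreover have "defective_params A \<subset> ?U" using p1 Fp1 unfolding D by blast
  moreover obtain q :: "('k, 'm) param \<Rightarrow> real" where q: "real_polynomial_function q" "q \<noteq> (\<lambda>_. 0)"
      "\<And>x. ?L x \<in> ?V \<Longrightarrow> ?F (?L x) = 0 \<Longrightarrow> q x = 0"
    using zero_set_in_hypersurface[OF bounded_linear_coeff_map[of A] V F Q, of p1] p1 Fp1 iff by blast
  then have "\<exists>q. real_polynomial_function q \<and> q \<noteq> (\<lambda>_. 0) \<and> (\<forall>x\<in>defective_params A. q x = 0)"
    unfolding D iff[symmetric] by blast
  ultimately show ?thesis unfolding proper_algebraic_set_in_def by blast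
qed

end
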